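(* Let $\mathcal{P}\subseteq V$ be a full-dimensional lattice polytope. Then there exists $t_0\in\mathbb{Z}_{>0}$ such that for each integer $t\ge t_0$ the translated regions $$\{\,x+R(N_f)\;:\; f\le \mathcal{P},\ x\in\mathcal{X}(tf)\,\}$$ form a tiling of $\mathrm{CDC}(t\mathcal{P})$; that is, the sets $x+R(N_f)$, indexed by the pairs $(f,x)$ with $f$ a nonempty face of $\mathcal{P}$ (including $f=\mathcal{P}$) and $x\in\mathcal{X}(tf)$, are subsets of $\mathrm{CDC}(t\mathcal{P})$, are pairwise disjoint for distinct pairs, and their union is $\mathrm{CDC}(t\mathcal{P})$.
   Context: Setting. $V$ is a finite-dimensional Euclidean space with inner product $\langle\cdot,\cdot\rangle$ and $\Lambda\subset V$ is a lattice of full rank $\dim V$. A rational cone is a subset of $V$ defined by finitely many homogeneous linear inequalities with rational coefficients with respect to a basis of $\Lambda$; it is pointed if it contains no nontrivial linear subspace. For a cone $C$ put $C^\vee=\{x\in V:\langle x,y\rangle\le 0\ \forall y\in C\}$ and $C^\perp=\{x\in V:\langle x,y\rangle=0\ \forall y\in C\}$. Standing assumption: for every rational cone $C$ the lattice $L(C):=\Lambda\cap C^\perp$ has rank $\dim C^\perp$. "Face" always means nonempty face; $f\le g$ means $f$ is a face of $g$ (possibly equal), $f<g$ means $f\le g$ and $f\ne g$. A ray of a cone is a one-dimensional face. Two faces are incomparable if neither is a face of the other. A tiling of a set $A$ is a family of subsets of $A$ that cover $A$ and are pairwise disjoint. Fundamental domains. A fundamental domain of a sublattice $L\subseteq\Lambda$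 is a connected bounded set $T\subseteq\mathrm{lin}(L)$ (linear hull) containing $0$, such that the translates $x+T$, $x\in L$, form a tiling of $\mathrm{lin}(L)$ and such that the intersection of $T$ with every affine subspace is measurable. For every sublattice $L\subseteq\Lambda$ an arbitrary fundamental domain is chosen and fixed; for a pointed rational cone $C$, $T(C)\subseteq C^\perp$ denotes the chosen fundamental domain of $L(C)$. With $C_0=\{0\}$ put $T:=T(C_0)$, the chosen fundamental domain of $\Lambda$. For a polyhedron $Q\subseteq V$, the covering domain complex is $\mathrm{CDC}(Q)=\bigcup_{x\in\Lambda,\,(x+T)\cap Q\neq\varnothing}(x+T)$. Regions. For pointed rational cones $C$, the region $R(C)\subseteq V$ is defined inductively on dimension. $R(C_0):=T(C_0)$. If $\dim C\ge1$ and $R(K)$ is defined for all faces $K<C$, let $X^C_K$ (for $K<C$) be the set of all $x\in L(K)$ such that (I) $x+R(K)\subseteq\mathrm{int}(M^\vee)$ for all rays $M\le C$ with $M\not\le K$; and (II) $(x+R(K))\cap(x'+R(K'))=\varnothing$ for all faces $K'<C$ incomparable to $K$ and all $x'\in L(K')$. Then $$R(C):=\Big(V\setminus\bigcup_{K<C}(X^C_K+R(K))\Big)\cap\big(T(C)+\mathrm{lin}(C)\big)\cap\mathrm{CDC}(C^\vee).$$ Polytopes. A lattice polytope is the convex hull of finitely many points of $\Lambda$. For a face $f$ of a polytope $\mathcal{P}$, the normal cone is $N_f=\{x\in V:\langle x,y-s\rangle\le0\ \forall y\in\mathcal{P}\}$ for any $s$ in the relative interior of $f$; if $\mathcal{P}$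 is full-dimensional, all $N_f$ are pointed. We have $N_f\le N_g$ iff $g\le f$. For $t\in\mathbb{Z}_{>0}$ and a face $f\le\mathcal{P}$ the set of feasible lattice points in $tf$ is $$\mathcal{X}(tf):=\bigcap_{v\text{ vertex of }f}\big(X^{N_v}_{N_f}+tv\big),$$ where for a vertex $v$ one sets $X^{N_v}_{N_v}:=\{0\}$ (so $\mathcal{X}(tv)=\{tv\}$). *)

theory Defs
  imports "HOL-Analysis.Analysis"
begin

section \<open>Lattices and rational cones\<close>

definition lattice_basis :: "'a::euclidean_space set \<Rightarrow> 'a set \<Rightarrow> bool" where
  "lattice_basis \<Lambda> B \<longleftrightarrow>
     independent B \<and> \<Lambda> = range (\<lambda>c :: 'a \<Rightarrow> int. \<Sum>b\<in>B. of_int (c b) *\<^sub>R b)"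

definition full_rank_lattice :: "'a::euclidean_space set \<Rightarrow> bool" where
  "full_rank_lattice \<Lambda> \<longleftrightarrow> (\<exists>B. lattice_basis \<Lambda> B \<and> span B = UNIV)"

definition sublattice :: "'a::euclidean_space set \<Rightarrow> 'a set \<Rightarrow> bool" where
  "sublattice L \<Lambda> \<longleftrightarrow> L \<subseteq> \<Lambda> \<and> 0 \<in> L \<and> (\<forall>x\<in>L. \<forall>y\<in>L. x - y \<in> L)"

text \<open>The coefficients of a linear form \<open>\<phi>\<close> with respect to the basis \<open>B\<close> are the values \<open>\<phi> b\<close>.\<close>

definition rational_cone :: "'a::euclidean_space set \<Rightarrow> 'a set \<Rightarrow> bool" where
  "rational_cone \<Lambda> C \<longleftrightarrow>
     (\<exists>B \<Phi>. lattice_basis \<Lambda> B \<and> finite \<Phi> \<and>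
        (\<forall>\<phi>\<in>\<Phi>. linear \<phi> \<and> (\<forall>b\<in>B. \<phi> b \<in> \<rat>)) \<and>
        C = {x. \<forall>\<phi>\<in>\<Phi>. \<phi> x \<le> (0::real)})"

definition pointed :: "'a::euclidean_space set \<Rightarrow> bool" where
  "pointed C \<longleftrightarrow> (\<forall>S. subspace S \<and> S \<subseteq> C \<longrightarrow> S = {0})"

definition polar_cone :: "'a::euclidean_space set \<Rightarrow> 'a set" where
  "polar_cone C = {x. \<forall>y\<in>C. x \<bullet> y \<le> 0}"

definition perp_lattice :: "'a::euclidean_space set \<Rightarrow> 'a set \<Rightarrow> 'a set" where
  "perp_lattice \<Lambda> C = \<Lambda> \<inter> orthogonal_comp C"

text \<open>On the left, \<open>dim\<close> of a set of vectors is the dimension of its linear hull; for a subgroup of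
  a lattice this is the rank.\<close>

definition perp_lattices_full_rank :: "'a::euclidean_space set \<Rightarrow> bool" where
  "perp_lattices_full_rank \<Lambda> \<longleftrightarrow>
     (\<forall>C. rational_cone \<Lambda> C \<longrightarrow> dim (perp_lattice \<Lambda> C) = dim (orthogonal_comp C))"

definition proper_face :: "'a::euclidean_space set \<Rightarrow> 'a set \<Rightarrow> bool" where
  "proper_face K C \<longleftrightarrow> K face_of C \<and> K \<noteq> {} \<and> K \<noteq> C"

definition ray_of :: "'a::euclidean_space set \<Rightarrow> 'a set \<Rightarrow> bool" where
  "ray_of M C \<longleftrightarrow> M face_of C \<and> aff_dim M = 1"

definition incomparable :: "'a::euclidean_space set \<Rightarrow> 'a set \<Rightarrow> bool" where
  "incomparable K K' \<longleftrightarrow> \<not> K face_of K' \<and> \<not> K' face_of K"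


section \<open>Tilings and fundamental domains\<close>

definition tiling :: "'i set \<Rightarrow> ('i \<Rightarrow> 'a set) \<Rightarrow> 'a set \<Rightarrow> bool" where
  "tiling I F A \<longleftrightarrow> (\<Union>i\<in>I. F i) = A \<and> disjoint_family_on F I"

text \<open>Lebesgue measurability inside the nonempty affine subspace \<open>A\<close>, with its own dimension:
  in Cartesian coordinates (origin \<open>a\<close>, orthonormal directions \<open>E\<close>) the set is measurable for the
  completed product of \<open>card E\<close> copies of the one-dimensional Lebesgue-Borel measure. The choice of
  the coordinate system is immaterial. Measurability for \<open>lebesgue\<close> on the whole space would say
  nothing when \<open>A\<close> is proper.\<close>

definition measurable_in_affine :: "'a::euclidean_space set \<Rightarrow> 'a set \<Rightarrow> bool" where
  "measurable_in_affine A S \<longleftrightarrow>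
     (\<exists>a\<in>A. \<exists>E. pairwise orthogonal E \<and> (\<forall>e\<in>E. norm e = 1) \<and> A = (+) a ` span E \<and>
        {c \<in> E \<rightarrow>\<^sub>E UNIV. a + (\<Sum>e\<in>E. c e *\<^sub>R e) \<in> S}
          \<in> sets (completion (Pi\<^sub>M E (\<lambda>_. lborel :: real measure))))"

definition fundamental_domain :: "'a::euclidean_space set \<Rightarrow> 'a set \<Rightarrow> bool" where
  "fundamental_domain L T \<longleftrightarrow>
     connected T \<and> bounded T \<and> T \<subseteq> span L \<and> 0 \<in> T \<and>
     tiling L (\<lambda>x. (+) x ` T) (span L) \<and>
     (\<forall>A. affine A \<and> A \<noteq> {} \<longrightarrow> measurable_in_affine A (T \<inter> A))"

text \<open>From here on \<open>D\<close> is the fixed choice of a fundamental domain \<open>D L\<close> for every sublattice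
  \<open>L\<close> of \<open>\<Lambda>\<close>.\<close>

definition fundamental_domain_choice ::
    "'a::euclidean_space set \<Rightarrow> ('a set \<Rightarrow> 'a set) \<Rightarrow> bool" where
  "fundamental_domain_choice \<Lambda> D \<longleftrightarrow> (\<forall>L. sublattice L \<Lambda> \<longrightarrow> fundamental_domain L (D L))"

definition cone_domain ::
    "'a::euclidean_space set \<Rightarrow> ('a set \<Rightarrow> 'a set) \<Rightarrow> 'a set \<Rightarrow> 'a set" where
  "cone_domain \<Lambda> D C = D (perp_lattice \<Lambda> C)"

definition CDC ::
    "'a::euclidean_space set \<Rightarrow> ('a set \<Rightarrow> 'a set) \<Rightarrow> 'a set \<Rightarrow> 'a set" where
  "CDC \<Lambda> D Q =
     (let T = cone_domain \<Lambda> D {0} in \<Union>x\<in>{x\<in>\<Lambda>. (+) x ` T \<inter> Q \<noteq> {}}. (+) x ` T)"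


section \<open>Regions\<close>

text \<open>The feasibility condition defining \<open>X\<^sup>C\<^sub>K\<close> for \<open>K < C\<close>, relative to a given assignment \<open>R\<close> of
  regions to the proper faces of \<open>C\<close>.\<close>

definition feasible_for ::
    "'a::euclidean_space set \<Rightarrow> ('a set \<Rightarrow> 'a set) \<Rightarrow> 'a set \<Rightarrow> 'a set \<Rightarrow> 'a set" where
  "feasible_for \<Lambda> R C K =
     {x \<in> perp_lattice \<Lambda> K.
        (\<forall>M. ray_of M C \<and> \<not> M face_of K \<longrightarrow> (+) x ` R K \<subseteq> interior (polar_cone M)) \<and>
        (\<forall>K'. proper_face K' C \<and> incomparable K' K \<longrightarrow>
           (\<forall>x'\<in>perp_lattice \<Lambda> K'. (+) x ` R K \<inter> (+) x' ` R K' = {}))}"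

lemma feasible_for_cong [fundef_cong]:
  assumes "\<Lambda> = \<Lambda>'" "C = C'" "K = K'"
    and "\<And>J. J = K' \<or> proper_face J C' \<Longrightarrow> R J = R' J"
  shows "feasible_for \<Lambda> R C K = feasible_for \<Lambda>' R' C' K'"
  using assms unfolding feasible_for_def by (intro Collect_cong) auto

lemma rational_cone_imp_convex:
  assumes "rational_cone \<Lambda> C"
  shows "convex C"
proof -
  obtain \<Phi> where lin: "\<forall>\<phi>\<in>\<Phi>. linear \<phi>" and C: "C = {x. \<forall>\<phi>\<in>\<Phi>. \<phi> x \<le> (0::real)}"
    using assms unfolding rational_cone_def by blast
  have "C = (\<Inter>\<phi>\<in>\<Phi>. \<phi> -` {..0})"
    using C by auto
  moreover have "convex (\<phi> -` {..0})" if "\<phi> \<in> \<Phi>" for \<phi>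
    using lin that by (intro convex_linear_vimage) auto
  ultimately show ?thesis
    by (simp add: convex_INT)
qed

text \<open>Outside the pointed rational cones the value is a junk value, never used.\<close>

function region ::
    "'a::euclidean_space set \<Rightarrow> ('a set \<Rightarrow> 'a set) \<Rightarrow> 'a set \<Rightarrow> 'a set" where
  "region \<Lambda> D C =
     (if \<not> (rational_cone \<Lambda> C \<and> pointed C) then {}
      else if C = {0} then cone_domain \<Lambda> D {0}
      else (UNIV - (\<Union>K\<in>{K. proper_face K C}.
                      feasible_for \<Lambda> (\<lambda>J. region \<Lambda> D J) C K + region \<Lambda> D K))
           \<inter> (cone_domain \<Lambda> D C + span C)
           \<inter> CDC \<Lambda> D (polar_cone C))"
  by pat_completeness auto

termination
proof (relation "Wellfounded.measure (\<lambda>(\<Lambda>, D, C). nat (aff_dim C + 1))", goal_cases)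
  case 1
  then show ?case by simp
next
  case (2 \<Lambda> D C K J)
  then have "proper_face J C" "convex C"
    using rational_cone_imp_convex by auto
  then have "aff_dim J < aff_dim C"
    by (simp add: proper_face_def face_of_aff_dim_lt)
  then show ?case
    using aff_dim_geq[of J] by simp
next
  case (3 \<Lambda> D C K)
  then have "proper_face K C" "convex C"
    using rational_cone_imp_convex by auto
  then have "aff_dim K < aff_dim C"
    by (simp add: proper_face_def face_of_aff_dim_lt)
  then show ?case
    using aff_dim_geq[of K] by simp
qed

declare region.simps [simp del]

text \<open>\<open>X\<^sup>C\<^sub>K\<close> for \<open>K \<le> C\<close>, with the convention \<open>X\<^sup>C\<^sub>C = {0}\<close>.\<close>

definition feasible_translations ::
    "'a::euclidean_space set \<Rightarrow> ('a set \<Rightarrow> 'a set) \<Rightarrow> 'a set \<Rightarrow> 'a set \<Rightarrow> 'a set" where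
  "feasible_translations \<Lambda> D C K =
     (if K = C then {0} else feasible_for \<Lambda> (region \<Lambda> D) C K)"


section \<open>Polytopes\<close>

definition lattice_polytope :: "'a::euclidean_space set \<Rightarrow> 'a set \<Rightarrow> bool" where
  "lattice_polytope \<Lambda> P \<longleftrightarrow> (\<exists>S. finite S \<and> S \<subseteq> \<Lambda> \<and> P = convex hull S)"

text \<open>For a nonempty face \<open>f\<close> the condition is the same for every \<open>s\<close> in the (nonempty) relative
  interior, so quantifying over all of them amounts to picking one.\<close>

definition normal_cone :: "'a::euclidean_space set \<Rightarrow> 'a set \<Rightarrow> 'a set" where
  "normal_cone P f = {x. \<forall>s\<in>rel_interior f. \<forall>y\<in>P. x \<bullet> (y - s) \<le> 0}"

definition feasible_points ::
    "'a::euclidean_space set \<Rightarrow> ('a set \<Rightarrow> 'a set) \<Rightarrow> 'a set \<Rightarrow> nat \<Rightarrow> 'a set \<Rightarrow> 'a set" where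
  "feasible_points \<Lambda> D P t f =
     (\<Inter>v\<in>{v. v extreme_point_of f}.
        (\<lambda>x. x + real t *\<^sub>R v) `
          feasible_translations \<Lambda> D (normal_cone P {v}) (normal_cone P f))"

end

theory Submission
  imports Defs
begin

text \<open>Write \<open>N\<^sub>f\<close> for the normal cone of a face \<open>f\<close>. The proof separates what happens around one
pointed cone from a comparison of distances in the dilated polytope.

\<^bold>\<open>One cone.\<close> Let \<open>C\<close> be a pointed rational cone. The region \<open>R(C)\<close> consists of the points of
a strip \<open>T(C) + lin(C)\<close> inside \<open>CDC(C\<^sup>\<or>)\<close> which no admissible translate of a lower region covers.
Translating the strip by \<open>L(C)\<close> fills the space, so the admissible translates of the regions of all
faces of \<open>C\<close> cover \<open>CDC(C\<^sup>\<or>)\<close> (\<open>regions_cover\<close>). They are disjoint: for incomparable faces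
this is condition (II), for nested faces it is the removal of the lower translates, and for equal
faces it is the disjointness of strips (\<open>feasible_regions_disjoint\<close>). That an admissible translate
stays inside \<open>CDC(C\<^sup>\<or>)\<close> is where the connectedness of the tile is needed. If a tile meets
\<open>x + R(K)\<close>, which condition (I) keeps on the inner side of the hyperplane \<open>M\<^sup>\<bottom>\<close> for each ray \<open>M\<close>
outside \<open>K\<close>, and if the tile also has a point on the outer side, then it meets \<open>M\<^sup>\<bottom>\<close>; such a tile is
covered by translates of \<open>R(M)\<close>, which by (II) cannot meet \<open>x + R(K)\<close>
(\<open>feasible_region_in_polar_cone\<close>).

\<^bold>\<open>Boundedness.\<close> All conditions that \<open>C\<close> imposes beyond those of a face \<open>K\<close> concern rays outside
\<open>K\<close> and are felt only near their hyperplanes. Hence around a point far from these hyperplanes the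
tilings belonging to \<open>K\<close> and to \<open>C\<close> agree (\<open>X_transfer\<close>). A point of \<open>R(C)\<close> therefore cannot be
far from the hyperplanes of all rays outside some proper face, because then a lower translate would
cover it. This bounds its component in \<open>lin(C)\<close>, and \<open>R(C)\<close> is bounded (\<open>bounded_region\<close>).

\<^bold>\<open>The polytope.\<close> A translate belonging to \<open>tf\<close> satisfies the inequalities of \<open>tP\<close> at the vertices of
\<open>tf\<close> up to a constant, and its translation vector lies in the affine hull of \<open>tf\<close>. A Hoffman type
estimate turns this into a distance to \<open>tf\<close> bounded independently of \<open>t\<close> (\<open>near_face\<close>,
\<open>tiles_near_face\<close>), whereas disjoint faces of \<open>tP\<close> move apart linearly in \<open>t\<close>. For large \<open>t\<close> two
translates can thus meet only if their faces share a vertex \<open>v\<close>, and the statements about the cone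
\<open>N\<^sub>v\<close> apply (\<open>tiles_disjoint\<close>, \<open>tiles_inside_CDC\<close>). For the covering, a point of \<open>CDC(tP)\<close>
is near only to supporting hyperplanes that have a common face \<open>f\<close>; the tiling for \<open>N\<^sub>f\<close> covers it by
a translate belonging to some face \<open>g\<close> that contains \<open>f\<close>, and the transfer principle, applied at every
vertex of \<open>g\<close>, shows that this translate is feasible (\<open>tiles_cover\<close>).

The lattice is not assumed to be rational with respect to the inner product, so it needs an argument
that the \<open>N\<^sub>f\<close> are rational cones at all: a lattice vector spans a rational line, and the standing
assumption then says that its orthogonal hyperplane is spanned by lattice vectors
(\<open>inner_lattice_rational\<close>).\<close>

section \<open>Pointed polyhedral cones and their rays\<close>

lemma pointedD:
  assumes "pointed C" "conic C" "x \<in> C" "- x \<in> C"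
  shows "x = 0"
proof -
  have "span {x} \<subseteq> C"
  proof
    fix z assume "z \<in> span {x}"
    then obtain s where z: "z = s *\<^sub>R x"
      by (auto simp: span_singleton)
    show "z \<in> C"
    proof (cases "s \<ge> 0")
      case True
      then show ?thesis using z conicD[OF assms(2,3)] by simp
    next
      case False
      then show ?thesis using z conicD[OF assms(2,4), of "- s"] by simp
    qed
  qed
  then have "span {x} = {0}"
    using assms(1) subspace_span unfolding pointed_def by blast
  then show ?thesis
    using span_base[of x "{x}"] by auto
qed

lemma pointed_subset:
  assumes "pointed C" "K \<subseteq> C"
  shows "pointed K"
  using assms unfolding pointed_def by blast

lemma conic_face:
  fixes C :: "'a::euclidean_space set"
  assumes "K face_of C" "conic C"
  shows "conic K"
  using assms face_of_conic by blast

lemma zero_mem_conic: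
  assumes "conic C" "C \<noteq> {}"
  shows "0 \<in> C"
  using assms conicD[of C _ 0] by force

lemma conic_add:
  assumes "conic C" "convex C" "a \<in> C" "b \<in> C"
  shows "a + b \<in> C"
proof -
  have "(1/2) *\<^sub>R a + (1/2) *\<^sub>R b \<in> C"
    using assms(2,3,4) by (intro convexD) auto
  then have "2 *\<^sub>R ((1/2) *\<^sub>R a + (1/2) *\<^sub>R b) \<in> C"
    by (intro conicD[OF assms(1)]) auto
  then show ?thesis
    by (simp add: scaleR_add_right)
qed

lemma conic_sum:
  assumes "conic C" "convex C" "C \<noteq> {}" "\<And>i. i \<in> I \<Longrightarrow> f i \<in> C"
  shows "sum f I \<in> C"
  using assms(4)
proof (induction I rule: infinite_finite_induct)
  case (insert i I)
  then show ?case by (simp add: conic_add[OF assms(1,2)])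
qed (use zero_mem_conic[OF assms(1,3)] in auto)

text \<open>Up to scaling, a sum is the midpoint of its summands, so a face of a cone that contains the
sum contains the summands.\<close>

lemma face_of_conic_summand:
  fixes C :: "'a::euclidean_space set"
  assumes "K face_of C" "conic C" "a \<in> C" "b \<in> C" "a + b \<in> K"
  shows "a \<in> K"
proof -
  have half: "(1/2) *\<^sub>R (a + b) \<in> K"
    by (intro conicD[OF conic_face[OF assms(1,2)] assms(5)]) auto
  show ?thesis
  proof (cases "a = b")
    case True
    then show ?thesis
      using half by (simp add: scaleR_add_right flip: scaleR_add_left)
  next
    case False
    then have "(1/2) *\<^sub>R (a + b) \<in> open_segment a b"
      using midpoint_in_open_segment[of a b] by (simp add: midpoint_def)
    then show ?thesis
      using face_ofD[OF assms(1) _ assms(3,4) half] by blast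
  qed
qed

lemma face_of_conic_sum_mem:
  fixes C :: "'a::euclidean_space set"
  assumes "K face_of C" "conic C" "convex C" "\<And>i. i \<in> I \<Longrightarrow> f i \<in> C" "sum f I \<in> K"
    "finite I" "i \<in> I"
  shows "f i \<in> K"
proof (rule face_of_conic_summand[OF assms(1,2)])
  show "f i \<in> C" using assms by blast
  then have ne: "C \<noteq> {}" by blast
  show "sum f (I - {i}) \<in> C"
    using assms by (intro conic_sum[OF assms(2,3) ne]) auto
  show "f i + sum f (I - {i}) \<in> K"
    using assms by (simp flip: sum.remove)
qed

lemma affine_hull_conic:
  fixes C :: "'a::euclidean_space set"
  assumes "conic C" "C \<noteq> {}"
  shows "affine hull C = span C"
  by (rule affine_hull_span_0[OF hull_inc[OF zero_mem_conic[OF assms]]])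

lemma rel_interior_conic_minus:
  fixes C :: "'a::euclidean_space set"
  assumes "conic C" "w \<in> rel_interior C" "d \<in> C"
  shows "\<exists>e>0. w - e *\<^sub>R d \<in> C"
proof -
  obtain e where e: "e > 0" "cball w e \<inter> affine hull C \<subseteq> C" and w: "w \<in> C"
    using assms(2) by (auto simp: mem_rel_interior_cball)
  have "C \<noteq> {}" using w by auto
  then have hull: "affine hull C = span C"
    by (rule affine_hull_conic[OF assms(1)])
  let ?e = "e / (norm d + 1)"
  have pos: "0 < norm d + 1"
    using norm_ge_zero[of d] by linarith
  have "norm (?e *\<^sub>R d) \<le> e"
    using e pos by (simp add: field_simps)
  then have "w - ?e *\<^sub>R d \<in> cball w e"
    by (simp add: dist_norm)
  moreover have "w - ?e *\<^sub>R d \<in> span C"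
    using w assms(3) by (simp add: span_base span_diff span_mul)
  ultimately have "w - ?e *\<^sub>R d \<in> C"
    using e hull by blast
  moreover have "?e > 0"
    using e pos by simp
  ultimately show ?thesis by blast
qed

text \<open>Going from \<open>x\<close> in direction \<open>- d\<close> one has to leave the cone: otherwise \<open>x / n - d\<close> would
lie in it for all \<open>n\<close>, and closedness would yield \<open>- d \<in> C\<close>, contradicting pointedness. The last
point inside cannot be relatively interior.\<close>

lemma exit_point_of_pointed_cone:
  fixes C :: "'a::euclidean_space set"
  assumes "closed C" "convex C" "conic C" "pointed C" "x \<in> C" "d \<in> C" "d \<noteq> 0"
  shows "\<exists>s\<ge>0. x - s *\<^sub>R d \<in> C \<and> x - s *\<^sub>R d \<notin> rel_interior C"
proof -
  have "\<exists>s\<ge>0. x - s *\<^sub>R d \<notin> C"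
  proof (rule ccontr)
    assume "\<not> ?thesis"
    then have all: "x - s *\<^sub>R d \<in> C" if "s \<ge> 0" for s
      using that by blast
    have "inverse (real (Suc n)) *\<^sub>R x - d \<in> C" for n
    proof -
      have "inverse (real (Suc n)) *\<^sub>R (x - real (Suc n) *\<^sub>R d) \<in> C"
        by (intro conicD[OF assms(3)] all) auto
      then show ?thesis
        by (simp add: scaleR_diff_right del: of_nat_Suc)
    qed
    moreover have "(\<lambda>n. inverse (real (Suc n)) *\<^sub>R x - d) \<longlonglongrightarrow> 0 *\<^sub>R x - d"
      by (intro tendsto_intros LIMSEQ_inverse_real_of_nat)
    ultimately have "0 *\<^sub>R x - d \<in> C"
      by (rule closed_sequentially[OF assms(1)])
    then show False
      using pointedD[OF assms(4,3,6)] assms(7) by simp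
  qed
  then obtain s0 where s0: "s0 \<ge> 0" "x - s0 *\<^sub>R d \<notin> C"
    by blast
  define A where "A = {s \<in> {0..s0}. x - s *\<^sub>R d \<in> C}"
  have "A = {0..s0} \<inter> (\<lambda>s. x - s *\<^sub>R d) -` C"
    by (auto simp: A_def)
  moreover have "closed ((\<lambda>s. x - s *\<^sub>R d) -` C)"
    by (intro continuous_closed_vimage assms(1)) (auto intro!: continuous_intros)
  ultimately have "compact A"
    by (simp add: compact_Int_closed)
  moreover have "A \<noteq> {}"
    using assms(5) s0 by (force simp: A_def)
  ultimately obtain s where s: "s \<in> A" "\<And>s'. s' \<in> A \<Longrightarrow> s' \<le> s"
    using compact_attains_sup[of A] by blast
  have "x - s *\<^sub>R d \<notin> rel_interior C"
  proof
    assume "x - s *\<^sub>R d \<in> rel_interior C"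
    then obtain e where e: "e > 0" "x - s *\<^sub>R d - e *\<^sub>R d \<in> C"
      using rel_interior_conic_minus[OF assms(3) _ assms(6)] by blast
    then have C: "x - (s + e) *\<^sub>R d \<in> C"
      by (simp add: algebra_simps)
    show False
    proof (cases "s + e \<le> s0")
      case True
      moreover have "0 \<le> s"
        using s(1) by (simp add: A_def)
      ultimately have "s + e \<in> A"
        using C e(1) by (simp add: A_def)
      then show ?thesis
        using s(2)[of "s + e"] e(1) by simp
    next
      case False
      have "x - (s + e) *\<^sub>R d + (s + e - s0) *\<^sub>R d \<in> C"
        using False by (intro conic_add[OF assms(3,2) C conicD[OF assms(3,6)]]) simp
      also have "x - (s + e) *\<^sub>R d + (s + e - s0) *\<^sub>R d = x - s0 *\<^sub>R d"
        by (simp add: scaleR_left_diff_distrib)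
      finally show ?thesis
        using s0(2) by simp
    qed
  qed
  then show ?thesis
    using s(1) by (auto simp: A_def)
qed

text \<open>A ray of a pointed cone is the half-line through its unique unit vector. Working with these
unit vectors turns inclusion of rays in faces into membership, and polar cones of rays into
half-spaces with a normalised inequality.\<close>

definition ray_dirs :: "'a::euclidean_space set \<Rightarrow> 'a set" where
  "ray_dirs C = {u. norm u = 1 \<and> (\<exists>M. ray_of M C \<and> u \<in> M)}"

lemma ray_dirs_subset: "ray_dirs C \<subseteq> C"
  unfolding ray_dirs_def ray_of_def using face_of_imp_subset by fastforce

lemma norm_ray_dirs: "u \<in> ray_dirs C \<Longrightarrow> norm u = 1"
  by (simp add: ray_dirs_def)

lemma ray_eq_half_line:
  assumes "conic C" "pointed C" "ray_of M C" "u \<in> M" "norm u = 1"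
  shows "M = (\<lambda>s. s *\<^sub>R u) ` {0..}"
proof
  have face: "M face_of C" and dim: "aff_dim M = 1"
    using assms by (auto simp: ray_of_def)
  have conic: "conic M"
    using conic_face[OF face assms(1)] .
  have MC: "M \<subseteq> C"
    using face face_of_imp_subset by blast
  show "(\<lambda>s. s *\<^sub>R u) ` {0..} \<subseteq> M"
    using conicD[OF conic assms(4)] by auto
  have "0 \<in> M"
    using zero_mem_conic[OF conic] assms(4) by auto
  then have "aff_dim M = int (dim M)"
    by (simp add: aff_dim_zero hull_inc)
  then have "dim M = 1"
    using dim by simp
  then have "span {u} = span M"
    using assms(4,5) by (intro dim_eq_span) auto
  then have line: "z \<in> range (\<lambda>s. s *\<^sub>R u)" if "z \<in> M" for z
    using that span_base[of z M] by (auto simp: span_singleton)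
  show "M \<subseteq> (\<lambda>s. s *\<^sub>R u) ` {0..}"
  proof
    fix z assume z: "z \<in> M"
    then obtain s where s: "z = s *\<^sub>R u"
      using line by auto
    show "z \<in> (\<lambda>s. s *\<^sub>R u) ` {0..}"
    proof (cases "s \<ge> 0")
      case False
      have "inverse (- s) *\<^sub>R z \<in> M"
        using False by (intro conicD[OF conic z]) auto
      then have "- u \<in> M"
        using False s by (simp add: divide_simps)
      then have "u = 0"
        using pointedD[OF assms(2,1)] MC assms(4) by blast
      then show ?thesis
        using assms(5) by simp
    qed (use s in auto)
  qed
qed

lemma ray_obtain_dir:
  fixes C :: "'a::euclidean_space set"
  assumes "conic C" "ray_of M C"
  obtains u where "u \<in> M" "norm u = 1"
proof -
  have M: "conic M" "aff_dim M = 1"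
    using assms conic_face by (auto simp: ray_of_def)
  have "M \<noteq> {}" "M \<noteq> {0}"
    using M(2) by auto
  then obtain z where z: "z \<in> M" "z \<noteq> 0"
    by auto
  have "inverse (norm z) *\<^sub>R z \<in> M"
    using z by (intro conicD[OF M(1)]) auto
  then show ?thesis
    using that z by simp
qed

lemma ray_subset_conic:
  assumes "conic C" "pointed C" "ray_of M C" "u \<in> M" "norm u = 1" "conic K" "u \<in> K"
  shows "M \<subseteq> K"
  unfolding ray_eq_half_line[OF assms(1-5)] using conicD[OF assms(6,7)] by auto

lemma ray_dirs_face:
  assumes "conic C" "pointed C" "K face_of C"
  shows "ray_dirs K = ray_dirs C \<inter> K"
proof
  show "ray_dirs K \<subseteq> ray_dirs C \<inter> K"
    using ray_dirs_subset[of K] face_of_trans[OF _ assms(3)]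
    by (auto simp: ray_dirs_def ray_of_def)
  show "ray_dirs C \<inter> K \<subseteq> ray_dirs K"
  proof
    fix u assume "u \<in> ray_dirs C \<inter> K"
    then obtain M where M: "ray_of M C" "u \<in> M" "norm u = 1" "u \<in> K"
      by (auto simp: ray_dirs_def)
    have "M \<subseteq> K"
      using ray_subset_conic[OF assms(1,2) M(1-3) conic_face[OF assms(3,1)] M(4)] .
    then have "ray_of M K"
      using M(1) face_of_subset[OF _ _ face_of_imp_subset[OF assms(3)]]
      by (auto simp: ray_of_def)
    then show "u \<in> ray_dirs K"
      using M by (auto simp: ray_dirs_def)
  qed
qed

lemma finite_ray_dirs:
  assumes "conic C" "pointed C" "polyhedron C"
  shows "finite (ray_dirs C)"
proof -
  have "finite {u \<in> M. norm u = 1}" if ray: "ray_of M C" for M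
  proof -
    obtain u where u: "u \<in> M" "norm u = 1"
      using ray_obtain_dir[OF assms(1) ray] by blast
    have "{u \<in> M. norm u = 1} \<subseteq> {u}"
      unfolding ray_eq_half_line[OF assms(1,2) ray u] using u by auto
    then show ?thesis
      using finite_subset by blast
  qed
  moreover have "finite {M. ray_of M C}"
    by (rule finite_subset[OF _ finite_polyhedron_faces[OF assms(3)]]) (auto simp: ray_of_def)
  ultimately have "finite (\<Union>M\<in>{M. ray_of M C}. {u \<in> M. norm u = 1})"
    by blast
  then show ?thesis
    by (rule finite_subset[rotated]) (auto simp: ray_dirs_def)
qed

text \<open>The conic counterpart of the theorem of Krein and Milman, by induction on the dimension.
Points outside the relative interior lie in proper faces. If one of them, \<open>d\<close>, is nonzero, then
every point is the sum of a multiple of \<open>d\<close> and an exit point of the cone. If there is no such \<open>d\<close>,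
then every exit point is \<open>0\<close>, and the cone is a half-line or trivial.\<close>

lemma polyhedral_cone_generated_by_rays:
  assumes "polyhedron C" "conic C" "pointed C"
    and H: "conic H" "convex H" "0 \<in> H" and rays: "ray_dirs C \<subseteq> H"
  shows "C \<subseteq> H"
  using assms(1-3) rays
proof (induction "nat (aff_dim C + 1)" arbitrary: C rule: less_induct)
  case (less C)
  note C = \<open>polyhedron C\<close> \<open>conic C\<close> \<open>pointed C\<close>
  have cv: "convex C" and cl: "closed C"
    using C(1) polyhedron_imp_convex polyhedron_imp_closed by auto
  have proper: "x \<in> H" if "x \<in> C" "x \<notin> rel_interior C" for x
  proof -
    have "x \<in> rel_frontier C"
      using that cl by (simp add: rel_frontier_def)
    then obtain F where F: "F face_of C" "F \<noteq> C" "x \<in> F"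
      using rel_frontier_of_polyhedron_alt[OF C(1)] by auto
    have "aff_dim F < aff_dim C"
      using face_of_aff_dim_lt[OF cv F(1,2)] .
    moreover have "0 \<le> aff_dim F"
      using F(3) aff_dim_negative_iff[of F] by (metis empty_iff not_less)
    ultimately have lt: "nat (aff_dim F + 1) < nat (aff_dim C + 1)"
      by simp
    have "F \<subseteq> H"
    proof (rule less.hyps[OF lt])
      show "polyhedron F"
        using face_of_polyhedron_polyhedron[OF C(1) F(1)] .
      show "conic F"
        using conic_face[OF F(1) C(2)] .
      show "pointed F"
        using pointed_subset[OF C(3) face_of_imp_subset[OF F(1)]] .
      show "ray_dirs F \<subseteq> H"
        using less.prems(4) ray_dirs_face[OF C(2,3) F(1)] by blast
    qed
    then show ?thesis
      using F(3) by blast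
  qed
  show ?case
  proof (cases "\<exists>d\<in>C. d \<noteq> 0 \<and> d \<notin> rel_interior C")
    case True
    then obtain d where d: "d \<in> C" "d \<noteq> 0" "d \<notin> rel_interior C"
      by blast
    show ?thesis
    proof
      fix x assume "x \<in> C"
      then obtain s where s: "s \<ge> 0" "x - s *\<^sub>R d \<in> C" "x - s *\<^sub>R d \<notin> rel_interior C"
        using exit_point_of_pointed_cone[OF cl cv C(2,3) _ d(1,2)] by blast
      have "(x - s *\<^sub>R d) + s *\<^sub>R d \<in> H"
        by (rule conic_add[OF H(1,2) proper[OF s(2,3)] conicD[OF H(1) proper[OF d(1,3)] s(1)]])
      then show "x \<in> H" by simp
    qed
  next
    case False
    have line: "\<exists>s\<ge>0. x = s *\<^sub>R d" if xd: "x \<in> C" "d \<in> C" "d \<noteq> 0" for x d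
    proof -
      obtain s where s: "s \<ge> 0" "x - s *\<^sub>R d \<in> C" "x - s *\<^sub>R d \<notin> rel_interior C"
        using exit_point_of_pointed_cone[OF cl cv C(2,3) xd] by blast
      then have "x - s *\<^sub>R d = 0"
        using False by blast
      then show ?thesis
        using s(1) by auto
    qed
    show ?thesis
    proof
      fix x assume x: "x \<in> C"
      show "x \<in> H"
      proof (cases "x = 0")
        case True
        then show ?thesis using H by simp
      next
        case False
        let ?u = "inverse (norm x) *\<^sub>R x"
        have u: "?u \<in> C" "?u \<noteq> 0" "norm ?u = 1"
          using False conicD[OF C(2) x] by auto
        have "span C = span {?u}"
        proof
          show "span {?u} \<subseteq> span C"
            using u by (intro span_mono) auto
          have "C \<subseteq> span {?u}"
            using line u(1,2) by (force simp: span_singleton)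
          then show "span C \<subseteq> span {?u}"
            by (simp add: span_minimal)
        qed
        then have "dim C = dim {?u}"
          by (metis dim_span)
        then have "dim C = 1"
          using u(2) by (simp add: dim_insert)
        moreover have "0 \<in> C"
          using zero_mem_conic C(2) x by blast
        ultimately have "aff_dim C = 1"
          by (simp add: aff_dim_zero hull_inc)
        then have "ray_of C C"
          using cv face_of_refl by (auto simp: ray_of_def)
        then have "?u \<in> H"
          using u less.prems(4) by (auto simp: ray_dirs_def)
        then have "norm x *\<^sub>R ?u \<in> H"
          by (rule conicD[OF H(1)]) simp
        then show ?thesis
          using False by simp
      qed
    qed
  qed
qed


section \<open>Rational cones\<close>

lemma rational_cone_conic:
  assumes "rational_cone \<Lambda> C"
  shows "conic C"
proof -
  obtain \<Phi> where "\<forall>\<phi>\<in>\<Phi>. linear \<phi>" "C = {x. \<forall>\<phi>\<in>\<Phi>. \<phi> x \<le> (0::real)}"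
    using assms unfolding rational_cone_def by blast
  then show ?thesis
    by (auto simp: conic_def linear_cmul mult_le_0_iff)
qed

lemma rational_cone_zero:
  assumes "rational_cone \<Lambda> C"
  shows "0 \<in> C"
proof -
  obtain \<Phi> where "\<forall>\<phi>\<in>\<Phi>. linear \<phi>" "C = {x. \<forall>\<phi>\<in>\<Phi>. \<phi> x \<le> (0::real)}"
    using assms unfolding rational_cone_def by blast
  then show ?thesis
    by (auto simp: linear_0)
qed

lemma rational_cone_polyhedron:
  assumes "rational_cone \<Lambda> C"
  shows "polyhedron C"
proof -
  obtain \<Phi> where \<Phi>: "finite \<Phi>" "\<forall>\<phi>\<in>\<Phi>. linear \<phi>" "C = {x. \<forall>\<phi>\<in>\<Phi>. \<phi> x \<le> (0::real)}"
    using assms unfolding rational_cone_def by blast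
  have "polyhedron {x. \<phi> x \<le> 0}" if "\<phi> \<in> \<Phi>" for \<phi>
  proof -
    have "{x. \<phi> x \<le> 0} = {x. adjoint \<phi> 1 \<bullet> x \<le> 0}"
      using adjoint_works[OF bspec[OF \<Phi>(2) that], of _ 1] by (simp add: inner_commute)
    then show ?thesis
      by (simp add: polyhedron_halfspace_le)
  qed
  then have "polyhedron (\<Inter>\<phi>\<in>\<Phi>. {x. \<phi> x \<le> 0})"
    using \<Phi>(1) by (intro polyhedron_Inter) auto
  moreover have "C = (\<Inter>\<phi>\<in>\<Phi>. {x. \<phi> x \<le> 0})"
    using \<Phi>(3) by auto
  ultimately show ?thesis
    by simp
qed

text \<open>A face is cut out by turning into equations those inequalities which are equations on all of
\<open>K\<close>. For the others there is a point \<open>s\<close> of \<open>K\<close> where all of them are strict; if \<open>x\<close> satisfies the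
new system, \<open>s - e x\<close> stays in \<open>C\<close> for small \<open>e\<close>, so \<open>e x\<close> is a summand of \<open>s\<close>.\<close>

lemma rational_cone_face:
  assumes "rational_cone \<Lambda> C" "K face_of C" "K \<noteq> {}"
  shows "rational_cone \<Lambda> K"
proof -
  obtain B \<Phi> where B: "lattice_basis \<Lambda> B" and fin: "finite \<Phi>"
    and \<Phi>: "\<forall>\<phi>\<in>\<Phi>. linear \<phi> \<and> (\<forall>b\<in>B. \<phi> b \<in> \<rat>)"
    and C: "C = {x. \<forall>\<phi>\<in>\<Phi>. \<phi> x \<le> (0::real)}"
    using assms(1) unfolding rational_cone_def by blast
  have lin: "linear \<phi>" and rat: "b \<in> B \<Longrightarrow> \<phi> b \<in> \<rat>" if "\<phi> \<in> \<Phi>" for \<phi> b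
    using \<Phi> that by auto
  note conic = rational_cone_conic[OF assms(1)]
  note conicK = conic_face[OF assms(2) conic]
  have KC: "K \<subseteq> C"
    using face_of_imp_subset[OF assms(2)] .
  define \<Psi> where "\<Psi> = {\<phi> \<in> \<Phi>. \<forall>x\<in>K. \<phi> x = 0}"
  have "\<exists>k\<in>K. \<phi> k < 0" if "\<phi> \<in> \<Phi> - \<Psi>" for \<phi>
    using that KC C unfolding \<Psi>_def by (force simp: not_less less_le)
  then obtain k where k: "\<And>\<phi>. \<phi> \<in> \<Phi> - \<Psi> \<Longrightarrow> k \<phi> \<in> K \<and> \<phi> (k \<phi>) < 0"
    by metis
  define s where "s = sum k (\<Phi> - \<Psi>)"
  have s: "s \<in> K"
    unfolding s_def using k face_of_imp_convex[OF assms(2)] assms(3)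
    by (intro conic_sum[OF conicK]) auto
  have neg: "\<phi> s < 0" if \<phi>: "\<phi> \<in> \<Phi> - \<Psi>" for \<phi>
  proof -
    have "\<phi> s = (\<Sum>\<psi>\<in>\<Phi> - \<Psi>. \<phi> (k \<psi>))"
      using \<phi> lin by (simp add: s_def linear_sum)
    also have "\<dots> = \<phi> (k \<phi>) + (\<Sum>\<psi>\<in>\<Phi> - \<Psi> - {\<phi>}. \<phi> (k \<psi>))"
      using \<phi> fin by (subst sum.remove[of _ \<phi>]) auto
    also have "(\<Sum>\<psi>\<in>\<Phi> - \<Psi> - {\<phi>}. \<phi> (k \<psi>)) \<le> 0"
      using k KC \<phi> C by (intro sum_nonpos) blast
    finally show ?thesis
      using k[OF \<phi>] by simp
  qed
  have "K = {x. \<forall>\<phi>\<in>\<Phi> \<union> (\<lambda>\<phi> x. - \<phi> x) ` \<Psi>. \<phi> x \<le> 0}"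
  proof
    show "K \<subseteq> {x. \<forall>\<phi>\<in>\<Phi> \<union> (\<lambda>\<phi> x. - \<phi> x) ` \<Psi>. \<phi> x \<le> 0}"
      using KC C by (auto simp: \<Psi>_def)
    show "{x. \<forall>\<phi>\<in>\<Phi> \<union> (\<lambda>\<phi> x. - \<phi> x) ` \<Psi>. \<phi> x \<le> 0} \<subseteq> K"
    proof
      fix x assume "x \<in> {x. \<forall>\<phi>\<in>\<Phi> \<union> (\<lambda>\<phi> x. - \<phi> x) ` \<Psi>. \<phi> x \<le> 0}"
      then have all: "\<forall>\<phi>\<in>\<Phi> \<union> (\<lambda>\<phi> x. - \<phi> x) ` \<Psi>. \<phi> x \<le> 0"
        by simp
      then have x: "\<And>\<phi>. \<phi> \<in> \<Phi> \<Longrightarrow> \<phi> x \<le> 0"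
        by blast
      have x0: "\<phi> x \<ge> 0" if "\<phi> \<in> \<Psi>" for \<phi>
        using bspec[OF all, of "\<lambda>x. - \<phi> x"] that by simp
      have "\<forall>\<phi>\<in>\<Phi> - \<Psi>. \<forall>\<^sub>F e in at_right 0. \<phi> s - e * \<phi> x < 0"
      proof
        fix \<phi> assume \<phi>: "\<phi> \<in> \<Phi> - \<Psi>"
        have "((\<lambda>e. \<phi> s - e * \<phi> x) \<longlongrightarrow> \<phi> s - 0 * \<phi> x) (at_right 0)"
          by (intro tendsto_intros)
        then show "\<forall>\<^sub>F e in at_right 0. \<phi> s - e * \<phi> x < 0"
          using neg[OF \<phi>] by (intro order_tendstoD(2)) auto
      qed
      then have "\<forall>\<^sub>F e in at_right 0. \<forall>\<phi>\<in>\<Phi> - \<Psi>. \<phi> s - e * \<phi> x < 0"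
        using fin by (intro eventually_ball_finite) auto
      moreover have "\<forall>\<^sub>F e::real in at_right 0. e > 0"
        by (rule eventually_at_right_less)
      ultimately have "\<forall>\<^sub>F e in at_right 0. e > 0 \<and> (\<forall>\<phi>\<in>\<Phi> - \<Psi>. \<phi> s - e * \<phi> x < 0)"
        by (rule eventually_conj[rotated])
      then obtain e :: real where e: "e > 0" "\<And>\<phi>. \<phi> \<in> \<Phi> - \<Psi> \<Longrightarrow> \<phi> s - e * \<phi> x < 0"
        using eventually_happens'[OF trivial_limit_at_right_real] by blast
      have xC: "x \<in> C"
        using x C by auto
      have "s - e *\<^sub>R x \<in> C"
      proof -
        have "\<phi> (s - e *\<^sub>R x) \<le> 0" if \<phi>: "\<phi> \<in> \<Phi>" for \<phi>
        proof -
          have eq: "\<phi> (s - e *\<^sub>R x) = \<phi> s - e * \<phi> x"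
            using lin[OF \<phi>] by (simp add: linear_diff linear_cmul)
          show ?thesis
          proof (cases "\<phi> \<in> \<Psi>")
            case True
            then have "\<phi> s = 0" "\<phi> x = 0"
              using s x[OF \<phi>] x0[OF True] by (auto simp: \<Psi>_def)
            then show ?thesis
              using eq by simp
          next
            case False
            then show ?thesis
              using e(2)[of \<phi>] \<phi> eq by simp
          qed
        qed
        then show ?thesis
          using C by simp
      qed
      then have "e *\<^sub>R x \<in> K"
        using conicD[OF conic xC, of e] e(1) s
        by (intro face_of_conic_summand[OF assms(2) conic, of "e *\<^sub>R x" "s - e *\<^sub>R x"]) auto
      then show "x \<in> K"
        using conicD[OF conicK, of "e *\<^sub>R x" "inverse e"] e(1) by simp
    qed
  qed
  moreover have "finite (\<Phi> \<union> (\<lambda>\<phi> x. - \<phi> x) ` \<Psi>)"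
    using fin by (auto simp: \<Psi>_def)
  moreover have "linear \<phi> \<and> (\<forall>b\<in>B. \<phi> b \<in> \<rat>)" if "\<phi> \<in> \<Phi> \<union> (\<lambda>\<phi> x. - \<phi> x) ` \<Psi>" for \<phi>
    using that lin rat by (auto simp: \<Psi>_def linear_compose_neg)
  ultimately show ?thesis
    using B unfolding rational_cone_def by blast
qed


section \<open>Lattices, tiles and strips\<close>

locale lattice_tiles =
  fixes \<Lambda> :: "'a::euclidean_space set" and D :: "'a set \<Rightarrow> 'a set"
  assumes full_rank: "full_rank_lattice \<Lambda>"
    and perp_full_rank: "perp_lattices_full_rank \<Lambda>"
    and domains: "fundamental_domain_choice \<Lambda> D"
begin

abbreviation "L \<equiv> perp_lattice \<Lambda>"
abbreviation "T \<equiv> cone_domain \<Lambda> D"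
abbreviation "T\<^sub>0 \<equiv> cone_domain \<Lambda> D {0}"
abbreviation "R \<equiv> region \<Lambda> D"
abbreviation "X \<equiv> feasible_for \<Lambda> (region \<Lambda> D)"
abbreviation "cdc \<equiv> CDC \<Lambda> D"

definition pcone :: "'a set \<Rightarrow> bool" where
  "pcone C \<longleftrightarrow> rational_cone \<Lambda> C \<and> pointed C"

lemma lattice_zero: "0 \<in> \<Lambda>"
  and lattice_diff: "x \<in> \<Lambda> \<Longrightarrow> y \<in> \<Lambda> \<Longrightarrow> x - y \<in> \<Lambda>"
proof -
  obtain B where \<Lambda>: "\<Lambda> = range (\<lambda>c :: 'a \<Rightarrow> int. \<Sum>b\<in>B. of_int (c b) *\<^sub>R b)"
    using full_rank by (auto simp: full_rank_lattice_def lattice_basis_def)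
  show "0 \<in> \<Lambda>"
    unfolding \<Lambda> by (rule range_eqI[of _ _ "\<lambda>_. 0"]) simp
  assume "x \<in> \<Lambda>" "y \<in> \<Lambda>"
  then obtain c d :: "'a \<Rightarrow> int" where "x = (\<Sum>b\<in>B. of_int (c b) *\<^sub>R b)" "y = (\<Sum>b\<in>B. of_int (d b) *\<^sub>R b)"
    unfolding \<Lambda> by blast
  then show "x - y \<in> \<Lambda>"
    unfolding \<Lambda> by (intro range_eqI[of _ _ "\<lambda>b. c b - d b"])
      (simp add: sum_subtractf scaleR_left_diff_distrib)
qed

lemma lattice_add:
  assumes "x \<in> \<Lambda>" "y \<in> \<Lambda>"
  shows "x + y \<in> \<Lambda>"
  using lattice_diff[OF assms(1) lattice_diff[OF lattice_zero assms(2)]] by simp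

lemma lattice_scale_nat: "x \<in> \<Lambda> \<Longrightarrow> real n *\<^sub>R x \<in> \<Lambda>"
  by (induction n) (auto simp: lattice_zero scaleR_left_distrib intro: lattice_add)

lemma lattice_basis_subset:
  assumes "lattice_basis \<Lambda> B"
  shows "B \<subseteq> \<Lambda>"
proof
  fix b assume b: "b \<in> B"
  have fin: "finite B"
    using assms by (simp add: lattice_basis_def independent_imp_finite)
  let ?c = "\<lambda>b'. if b' = b then 1 else 0 :: int"
  have "(\<Sum>b'\<in>B. of_int (?c b') *\<^sub>R b') = (\<Sum>b'\<in>B. if b' = b then b' else 0)"
    by (intro sum.cong) auto
  also have "\<dots> = b"
    using b fin by simp
  finally have "b = (\<Sum>b'\<in>B. of_int (?c b') *\<^sub>R b')" ..
  then show "b \<in> \<Lambda>"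
    using assms unfolding lattice_basis_def by (simp add: image_iff) (rule exI[of _ ?c], simp)
qed

lemma span_lattice: "span \<Lambda> = UNIV"
proof -
  obtain B where "lattice_basis \<Lambda> B" "span B = UNIV"
    using full_rank by (auto simp: full_rank_lattice_def)
  then show ?thesis
    using span_mono[OF lattice_basis_subset] by blast
qed

lemma mem_L_iff: "x \<in> L C \<longleftrightarrow> x \<in> \<Lambda> \<and> (\<forall>y\<in>C. x \<bullet> y = 0)"
  by (auto simp: perp_lattice_def orthogonal_comp_def orthogonal_def inner_commute)

lemma L_zero: "0 \<in> L C"
  and L_diff: "x \<in> L C \<Longrightarrow> y \<in> L C \<Longrightarrow> x - y \<in> L C"
  and L_add: "x \<in> L C \<Longrightarrow> y \<in> L C \<Longrightarrow> x + y \<in> L C"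
  by (auto simp: mem_L_iff lattice_zero lattice_diff lattice_add inner_diff_left inner_add_left)

lemma L_antimono: "K \<subseteq> C \<Longrightarrow> x \<in> L C \<Longrightarrow> x \<in> L K"
  by (auto simp: mem_L_iff)

lemma fundamental_domain_T: "fundamental_domain (L C) (T C)"
proof -
  have "sublattice (L C) \<Lambda>"
    using L_zero L_diff by (auto simp: sublattice_def mem_L_iff)
  then show ?thesis
    using domains by (simp add: fundamental_domain_choice_def cone_domain_def)
qed

lemma span_L:
  assumes "rational_cone \<Lambda> C"
  shows "span (L C) = orthogonal_comp C"
proof -
  have "span (L C) = span (orthogonal_comp C)"
    using perp_full_rank assms
    by (intro dim_eq_span) (auto simp: perp_lattice_def perp_lattices_full_rank_def)
  then show ?thesis
    by (simp add: span_eq_iff[THEN iffD2] subspace_orthogonal_comp)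
qed

lemma T_tiles:
  assumes "p \<in> span (L C)"
  shows "\<exists>y\<in>L C. \<exists>\<tau>\<in>T C. p = y + \<tau>"
  using fundamental_domain_T[of C] assms
  unfolding fundamental_domain_def tiling_def by blast

lemma T_unique:
  assumes "y \<in> L C" "y' \<in> L C" "\<tau> \<in> T C" "\<tau>' \<in> T C" "y + \<tau> = y' + \<tau>'"
  shows "y = y'"
proof (rule ccontr)
  assume "y \<noteq> y'"
  moreover have "disjoint_family_on (\<lambda>x. (+) x ` T C) (L C)"
    using fundamental_domain_T[of C] by (simp add: fundamental_domain_def tiling_def)
  ultimately have "(+) y ` T C \<inter> (+) y' ` T C = {}"
    using assms(1,2) by (simp add: disjoint_family_on_def)
  then show False
    using assms(3,4,5) by (metis disjoint_iff imageI)
qed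

lemma bounded_T: "bounded (T C)"
  and T_subset_span: "T C \<subseteq> span (L C)"
  using fundamental_domain_T[of C] by (simp_all add: fundamental_domain_def)

lemma connected_T0: "connected T\<^sub>0"
  and zero_mem_T0: "0 \<in> T\<^sub>0"
  using fundamental_domain_T[of "{0}"] by (simp_all add: fundamental_domain_def)

lemma L0: "L {0} = \<Lambda>"
  by (simp add: perp_lattice_def)

lemma T0_tiles: "\<exists>z\<in>\<Lambda>. \<exists>\<tau>\<in>T\<^sub>0. p = z + \<tau>"
  using T_tiles[of p "{0}"] by (simp add: L0 span_lattice)

lemma T0_unique:
  assumes "z \<in> \<Lambda>" "z' \<in> \<Lambda>" "\<tau> \<in> T\<^sub>0" "\<tau>' \<in> T\<^sub>0" "z + \<tau> = z' + \<tau>'"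
  shows "z = z'"
  using T_unique[of z "{0}" z' \<tau> \<tau>'] assms by (simp add: L0)

text \<open>The standing assumption on \<open>\<Lambda>\<close> enters here: the component of \<open>p\<close> orthogonal to \<open>C\<close> lies in the
linear hull of \<open>L C\<close>, which the translates of \<open>T C\<close> tile.\<close>

lemma strip_tiles:
  assumes "rational_cone \<Lambda> C"
  shows "\<exists>y\<in>L C. \<exists>\<tau>\<in>T C. p - y - \<tau> \<in> span C"
proof -
  obtain a b where ab: "a \<in> span C" "\<And>w. w \<in> span C \<Longrightarrow> orthogonal b w" "p = a + b"
    using orthogonal_subspace_decomp_exists[of C p] by metis
  have "b \<in> orthogonal_comp C"
    using ab(2) span_base by (auto simp: orthogonal_comp_def orthogonal_commute)
  then obtain y \<tau> where "y \<in> L C" "\<tau> \<in> T C" "b = y + \<tau>"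
    using T_tiles[of b C] by (auto simp: span_L[OF assms])
  then show ?thesis
    using ab by (metis add_diff_cancel_right' diff_diff_eq)
qed

lemma strip_unique:
  assumes "rational_cone \<Lambda> C" "y \<in> L C" "y' \<in> L C" "\<tau> \<in> T C" "\<tau>' \<in> T C"
    "(y + \<tau>) - (y' + \<tau>') \<in> span C"
  shows "y = y'"
proof -
  let ?d = "(y + \<tau>) - (y' + \<tau>')"
  have "?d \<in> span (L C)"
    using assms T_subset_span by (intro span_diff span_add) (auto intro: span_base)
  then have perp: "?d \<in> orthogonal_comp C"
    by (simp add: span_L[OF assms(1)])
  have "orthogonal ?d ?d"
    by (rule orthogonal_to_span[OF assms(6)])
      (use perp in \<open>auto simp: orthogonal_comp_def orthogonal_commute\<close>)
  then have "y + \<tau> = y' + \<tau>'"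
    by (simp add: orthogonal_def)
  then show ?thesis
    using T_unique[OF assms(2-5)] by blast
qed

lemma mem_CDC_iff:
  "p \<in> cdc Q \<longleftrightarrow> (\<exists>z\<in>\<Lambda>. \<exists>\<tau>\<in>T\<^sub>0. \<exists>\<tau>'\<in>T\<^sub>0. p = z + \<tau> \<and> z + \<tau>' \<in> Q)"
proof -
  have "(+) z ` T\<^sub>0 \<inter> Q \<noteq> {} \<longleftrightarrow> (\<exists>\<tau>'\<in>T\<^sub>0. z + \<tau>' \<in> Q)" for z
    by blast
  then have "p \<in> cdc Q \<longleftrightarrow> (\<exists>z. (z \<in> \<Lambda> \<and> (\<exists>\<tau>'\<in>T\<^sub>0. z + \<tau>' \<in> Q)) \<and> (\<exists>\<tau>\<in>T\<^sub>0. p = z + \<tau>))"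
    by (simp add: CDC_def Let_def image_iff)
  then show ?thesis
    by blast
qed

lemma CDC_translate:
  assumes "p \<in> cdc Q" "l \<in> \<Lambda>" "\<And>q. q \<in> Q \<Longrightarrow> q + l \<in> Q'"
  shows "p + l \<in> cdc Q'"
proof -
  obtain z \<tau> \<tau>' where z: "z \<in> \<Lambda>" "\<tau> \<in> T\<^sub>0" "\<tau>' \<in> T\<^sub>0" "p = z + \<tau>" "z + \<tau>' \<in> Q"
    using assms(1) by (auto simp: mem_CDC_iff)
  have "z + l \<in> \<Lambda>"
    using z(1) assms(2) by (rule lattice_add)
  moreover have "p + l = (z + l) + \<tau>" "(z + l) + \<tau>' \<in> Q'"
    using z(4) assms(3)[OF z(5)] by (auto simp: algebra_simps)
  ultimately show ?thesis
    using z(2,3) unfolding mem_CDC_iff by blast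
qed

lemma CDC_mono:
  assumes "p \<in> cdc Q" "Q \<subseteq> Q'"
  shows "p \<in> cdc Q'"
  using CDC_translate[OF assms(1) lattice_zero, of Q'] assms(2) by auto

lemma polar_cone_antimono: "K \<subseteq> C \<Longrightarrow> polar_cone C \<subseteq> polar_cone K"
  by (auto simp: polar_cone_def)

lemma rational_cone_zero_set: "rational_cone \<Lambda> {0}"
proof -
  obtain B where lb: "lattice_basis \<Lambda> B" and B: "independent B" "span B = UNIV"
    using full_rank by (auto simp: full_rank_lattice_def lattice_basis_def)
  have fin: "finite B"
    using B(1) by (simp add: independent_imp_finite)
  let ?r = "\<lambda>b x. representation B x b"
  define \<Phi> where "\<Phi> = ?r ` B \<union> (\<lambda>b x. - ?r b x) ` B"
  have lin: "linear (?r b)" for b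
    using bounded_linear_representation[OF B] by (simp add: bounded_linear.linear)
  have "x = 0" if "\<forall>\<phi>\<in>\<Phi>. \<phi> x \<le> 0" for x
  proof -
    have "?r b x = 0" if "b \<in> B" for b
    proof -
      have "?r b \<in> \<Phi>" "(\<lambda>x. - ?r b x) \<in> \<Phi>"
        using that by (auto simp: \<Phi>_def)
      then show ?thesis
        using bspec[OF \<open>\<forall>\<phi>\<in>\<Phi>. \<phi> x \<le> 0\<close>, of "?r b"]
          bspec[OF \<open>\<forall>\<phi>\<in>\<Phi>. \<phi> x \<le> 0\<close>, of "\<lambda>x. - ?r b x"] by simp
    qed
    then have "(\<Sum>b\<in>B. ?r b x *\<^sub>R b) = 0"
      by simp
    then show "x = 0"
      using sum_representation_eq[OF B(1) _ fin order_refl, of x] B(2) by simp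
  qed
  moreover have "\<phi> 0 \<le> 0" if "\<phi> \<in> \<Phi>" for \<phi>
    using that by (auto simp: \<Phi>_def representation_zero)
  ultimately have "{0} = {x. \<forall>\<phi>\<in>\<Phi>. \<phi> x \<le> 0}"
    by auto
  moreover have "finite \<Phi>"
    using fin by (simp add: \<Phi>_def)
  moreover have "linear \<phi> \<and> (\<forall>b\<in>B. \<phi> b \<in> \<rat>)" if "\<phi> \<in> \<Phi>" for \<phi>
    using that lin by (auto simp: \<Phi>_def representation_basis[OF B(1)] linear_compose_neg)
  ultimately show ?thesis
    using lb unfolding rational_cone_def by blast
qed

lemma pcone_zero: "pcone {0}"
proof -
  have "S = {0}" if "subspace S" "S \<subseteq> {0}" for S :: "'a set"
    using that subspace_0[of S] by blast
  then show ?thesis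
    using rational_cone_zero_set by (simp add: pcone_def pointed_def)
qed

lemma pcone_face: "pcone C \<Longrightarrow> K face_of C \<Longrightarrow> K \<noteq> {} \<Longrightarrow> pcone K"
  unfolding pcone_def
  using rational_cone_face pointed_subset[of C K] face_of_imp_subset[of K C] by auto

lemma pcone_conic: "pcone C \<Longrightarrow> conic C"
  and pcone_pointed: "pcone C \<Longrightarrow> pointed C"
  and pcone_polyhedron: "pcone C \<Longrightarrow> polyhedron C"
  and pcone_rational: "pcone C \<Longrightarrow> rational_cone \<Lambda> C"
  and pcone_zero_mem: "pcone C \<Longrightarrow> 0 \<in> C"
  and pcone_convex: "pcone C \<Longrightarrow> convex C"
  using rational_cone_conic rational_cone_polyhedron rational_cone_zero rational_cone_imp_convex
  by (auto simp: pcone_def)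

lemma pcone_ray_dirs_face:
  "pcone C \<Longrightarrow> K face_of C \<Longrightarrow> ray_dirs K = ray_dirs C \<inter> K"
  using ray_dirs_face pcone_conic pcone_pointed by blast

lemma pcone_face_subset:
  assumes "pcone C" "K face_of C" "K' face_of C" "K \<noteq> {}" "K' \<noteq> {}" "\<not> K' \<subseteq> K"
  obtains u where "u \<in> ray_dirs C" "u \<in> K'" "u \<notin> K"
proof -
  have "K' \<subseteq> K" if "ray_dirs K' \<subseteq> K"
  proof (rule polyhedral_cone_generated_by_rays[OF _ _ _ _ _ _ that])
    have "pcone K'" "pcone K"
      using pcone_face assms by auto
    then show "polyhedron K'" "conic K'" "pointed K'" "conic K" "convex K" "0 \<in> K"
      by (auto simp: pcone_conic pcone_convex pcone_zero_mem pcone_pointed pcone_polyhedron)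
  qed
  then show ?thesis
    using that assms(6) pcone_ray_dirs_face[OF assms(1,3)] by blast
qed

lemma mem_polar_cone_iff_rays:
  assumes "pcone C"
  shows "x \<in> polar_cone C \<longleftrightarrow> (\<forall>u\<in>ray_dirs C. x \<bullet> u \<le> 0)"
proof
  assume "\<forall>u\<in>ray_dirs C. x \<bullet> u \<le> 0"
  then have rays: "ray_dirs C \<subseteq> {y. x \<bullet> y \<le> 0}"
    by auto
  have "conic {y. x \<bullet> y \<le> 0}"
    by (auto simp: conic_def mult_le_0_iff)
  then have "C \<subseteq> {y. x \<bullet> y \<le> 0}"
    using polyhedral_cone_generated_by_rays[OF pcone_polyhedron pcone_conic pcone_pointed _ _ _ rays]
      assms convex_halfspace_le by auto
  then show "x \<in> polar_cone C"
    by (auto simp: polar_cone_def)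
qed (use ray_dirs_subset in \<open>auto simp: polar_cone_def\<close>)

lemma ray_of_cases:
  assumes "pcone C" "ray_of M C"
  obtains u where "u \<in> ray_dirs C" "u \<in> M" "M = (\<lambda>s. s *\<^sub>R u) ` {0..}"
    "interior (polar_cone M) = {x. x \<bullet> u < 0}"
proof -
  obtain u where u: "u \<in> M" "norm u = 1"
    using ray_obtain_dir[OF pcone_conic[OF assms(1)] assms(2)] .
  have M: "M = (\<lambda>s. s *\<^sub>R u) ` {0..}"
    using ray_eq_half_line[OF pcone_conic[OF assms(1)] pcone_pointed[OF assms(1)] assms(2) u] .
  have polar: "polar_cone M = {x. x \<bullet> u \<le> 0}"
  proof
    show "polar_cone M \<subseteq> {x. x \<bullet> u \<le> 0}"
      using u by (auto simp: polar_cone_def)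
    show "{x. x \<bullet> u \<le> 0} \<subseteq> polar_cone M"
      unfolding M by (auto simp: polar_cone_def mult_nonneg_nonpos)
  qed
  moreover have "interior {x. u \<bullet> x \<le> 0} = {x. u \<bullet> x < 0}"
    using u by (intro interior_halfspace_le) auto
  moreover have "u \<in> ray_dirs C"
    using u assms(2) by (auto simp: ray_dirs_def)
  ultimately show ?thesis
    using that u M by (simp add: inner_commute)
qed

lemma face_subset_iff:
  assumes "K face_of C" "K' face_of C"
  shows "K face_of K' \<longleftrightarrow> K \<subseteq> K'"
  using face_of_subset[OF assms(1) _ face_of_imp_subset[OF assms(2)]] face_of_imp_subset[of K K']
  by blast

text \<open>The two feasibility conditions in working form: condition (I) becomes a strict inequality for
each ray direction, and among nonempty faces of \<open>C\<close> the face relation is inclusion.\<close>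

lemma mem_X_iff:
  assumes "pcone C" "K face_of C" "K \<noteq> {}"
  shows "x \<in> X C K \<longleftrightarrow> x \<in> L K \<and>
    (\<forall>u\<in>ray_dirs C - K. \<forall>q\<in>R K. (x + q) \<bullet> u < 0) \<and>
    (\<forall>K' x'. K' face_of C \<and> K' \<noteq> {} \<and> \<not> K' \<subseteq> K \<and> \<not> K \<subseteq> K' \<and> x' \<in> L K' \<longrightarrow>
      (+) x ` R K \<inter> (+) x' ` R K' = {})"
proof -
  have I: "(\<forall>M. ray_of M C \<and> \<not> M face_of K \<longrightarrow> (+) x ` R K \<subseteq> interior (polar_cone M))
    \<longleftrightarrow> (\<forall>u\<in>ray_dirs C - K. \<forall>q\<in>R K. (x + q) \<bullet> u < 0)" (is "?l = ?r")
  proof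
    assume l: ?l
    show ?r
    proof (intro ballI)
      fix u q assume u: "u \<in> ray_dirs C - K" and q: "q \<in> R K"
      then obtain M where M: "ray_of M C" "u \<in> M" "norm u = 1"
        by (auto simp: ray_dirs_def)
      then have "polar_cone M \<subseteq> {x. u \<bullet> x \<le> 0}"
        by (auto simp: polar_cone_def inner_commute)
      then have "interior (polar_cone M) \<subseteq> interior {x. u \<bullet> x \<le> 0}"
        by (rule interior_mono)
      also have "\<dots> = {x. u \<bullet> x < 0}"
        using M(3) by (intro interior_halfspace_le) auto
      finally have "interior (polar_cone M) \<subseteq> {x. u \<bullet> x < 0}" .
      moreover have "\<not> M face_of K"
        using u M face_of_imp_subset by blast
      ultimately show "(x + q) \<bullet> u < 0"
        using l M(1) q by (auto simp: inner_commute[of u])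
    qed
  next
    assume r: ?r
    show ?l
    proof (intro allI impI)
      fix M assume M: "ray_of M C \<and> \<not> M face_of K"
      then obtain u where u: "u \<in> ray_dirs C" "M = (\<lambda>s. s *\<^sub>R u) ` {0..}"
          "interior (polar_cone M) = {x. x \<bullet> u < 0}"
        using ray_of_cases[OF assms(1)] by metis
      have "\<not> M \<subseteq> K"
        using M face_subset_iff assms(2) by (auto simp: ray_of_def)
      then have "u \<notin> K"
        using conicD[OF conic_face[OF assms(2) pcone_conic[OF assms(1)]]] u(2) by auto
      then show "(+) x ` R K \<subseteq> interior (polar_cone M)"
        using u r by auto
    qed
  qed
  have II: "proper_face K' C \<and> incomparable K' K \<longleftrightarrow>
      K' face_of C \<and> K' \<noteq> {} \<and> \<not> K' \<subseteq> K \<and> \<not> K \<subseteq> K'" for K'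
    using face_subset_iff[OF assms(2)] face_subset_iff[OF _ assms(2)] face_of_imp_subset[OF assms(2)]
    by (auto simp: proper_face_def incomparable_def)
  show ?thesis
    unfolding feasible_for_def mem_Collect_eq I II by blast
qed

lemma region_zero: "R {0} = T\<^sub>0"
  using pcone_zero by (subst region.simps) (simp add: pcone_def)

lemma mem_region_iff:
  assumes "pcone C" "C \<noteq> {0}"
  shows "z \<in> R C \<longleftrightarrow>
    (\<forall>K x q. K face_of C \<and> K \<noteq> {} \<and> K \<noteq> C \<and> x \<in> X C K \<and> q \<in> R K \<longrightarrow> z \<noteq> x + q) \<and>
    (\<exists>\<tau>\<in>T C. z - \<tau> \<in> span C) \<and> z \<in> cdc (polar_cone C)"
proof -
  have "z \<in> T C + span C \<longleftrightarrow> (\<exists>\<tau>\<in>T C. z - \<tau> \<in> span C)"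
  proof
    assume "z \<in> T C + span C"
    then show "\<exists>\<tau>\<in>T C. z - \<tau> \<in> span C"
      by (force elim!: set_plus_elim)
  next
    assume "\<exists>\<tau>\<in>T C. z - \<tau> \<in> span C"
    then obtain \<tau> where "\<tau> \<in> T C" "z - \<tau> \<in> span C"
      by blast
    then have "\<tau> + (z - \<tau>) \<in> T C + span C"
      by (rule set_plus_intro)
    then show "z \<in> T C + span C"
      by simp
  qed
  moreover have "z \<in> X C K + R K \<longleftrightarrow> (\<exists>x\<in>X C K. \<exists>q\<in>R K. z = x + q)" for K
    by (auto simp: set_plus_def)
  ultimately have "z \<in> (UNIV - (\<Union>K\<in>{K. proper_face K C}. X C K + R K))
       \<inter> (T C + span C) \<inter> cdc (polar_cone C) \<longleftrightarrow>
    (\<forall>K. proper_face K C \<longrightarrow> \<not> (\<exists>x\<in>X C K. \<exists>q\<in>R K. z = x + q)) \<and>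
    (\<exists>\<tau>\<in>T C. z - \<tau> \<in> span C) \<and> z \<in> cdc (polar_cone C)"
    by simp
  moreover have "(\<forall>K. proper_face K C \<longrightarrow> \<not> (\<exists>x\<in>X C K. \<exists>q\<in>R K. z = x + q)) \<longleftrightarrow>
    (\<forall>K x q. K face_of C \<and> K \<noteq> {} \<and> K \<noteq> C \<and> x \<in> X C K \<and> q \<in> R K \<longrightarrow> z \<noteq> x + q)"
    unfolding proper_face_def by blast
  moreover have "R C = (UNIV - (\<Union>K\<in>{K. proper_face K C}. X C K + R K))
       \<inter> (T C + span C) \<inter> cdc (polar_cone C)"
    using assms by (subst region.simps) (simp add: pcone_def)
  ultimately show ?thesis
    by simp
qed

lemma region_strip:
  assumes "pcone C" "q \<in> R C"
  shows "\<exists>\<tau>\<in>T C. q - \<tau> \<in> span C"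
proof (cases "C = {0}")
  case True
  then show ?thesis
    using assms region_zero by (intro bexI[of _ q]) (auto simp: span_zero)
qed (use assms mem_region_iff in blast)

lemma region_subset_CDC:
  assumes "pcone C" "q \<in> R C"
  shows "q \<in> cdc (polar_cone C)"
proof (cases "C = {0}")
  case True
  then have "q \<in> T\<^sub>0"
    using assms(2) region_zero by simp
  moreover have "0 + 0 \<in> polar_cone C"
    by (simp add: polar_cone_def)
  ultimately show ?thesis
    using lattice_zero zero_mem_T0 by (force simp: mem_CDC_iff)
qed (use assms mem_region_iff in blast)

end


section \<open>Two boundedness principles\<close>

text \<open>All constants below first arise for a single face, vertex or ray. As there are finitely many
of them and the estimates only get weaker with growing constant, one constant serves all.\<close>

lemma finite_uniform_bound:
  fixes P :: "'b \<Rightarrow> real \<Rightarrow> bool"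
  assumes "finite A" "\<And>x. x \<in> A \<Longrightarrow> \<exists>B. P x B" "\<And>x B B'. P x B \<Longrightarrow> B \<le> B' \<Longrightarrow> P x B'"
  shows "\<exists>B\<ge>b. \<forall>x\<in>A. P x B"
proof -
  obtain f where f: "\<And>x. x \<in> A \<Longrightarrow> P x (f x)"
    using assms(2) by metis
  let ?B = "Max (insert b (f ` A))"
  have "f x \<le> ?B" if "x \<in> A" for x
    using assms(1) that by (intro Max_ge) auto
  then have "\<forall>x\<in>A. P x ?B"
    using assms(3) f by blast
  moreover have "b \<le> ?B"
    using assms(1) by (intro Max_ge) auto
  ultimately show ?thesis
    by blast
qed

text \<open>On \<open>span U\<close> the linear map \<open>a \<mapsto> \<Sum>\<^sub>u (a \<bullet> u) u\<close> is injective, because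
its inner product with \<open>a\<close> is \<open>\<Sum>\<^sub>u (a \<bullet> u)\<^sup>2\<close>; hence it is bounded from below.\<close>

lemma norm_bounded_by_inner_products:
  fixes U :: "'a::euclidean_space set"
  assumes "finite U"
  shows "\<exists>e>0. \<forall>a\<in>span U. e * norm a \<le> (\<Sum>u\<in>U. \<bar>a \<bullet> u\<bar> * norm u)"
proof -
  let ?f = "\<lambda>a. \<Sum>u\<in>U. (a \<bullet> u) *\<^sub>R u"
  have lin: "bounded_linear ?f"
    by (intro bounded_linear_sum bounded_linear_scaleR_const bounded_linear_inner_left)
  have "a = 0" if a: "a \<in> span U" "?f a = 0" for a
  proof -
    have "(\<Sum>u\<in>U. (a \<bullet> u)\<^sup>2) = a \<bullet> ?f a"
      by (simp add: inner_sum_right power2_eq_square)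
    then have "(\<Sum>u\<in>U. (a \<bullet> u)\<^sup>2) = 0"
      using a(2) by simp
    then have "\<forall>u\<in>U. (a \<bullet> u)\<^sup>2 = 0"
      using assms by (simp add: sum_nonneg_eq_0_iff)
    then have "orthogonal a a"
      by (intro orthogonal_to_span[OF a(1)]) (simp add: orthogonal_def)
    then show ?thesis
      by (simp add: orthogonal_def)
  qed
  then have "\<exists>e>0. \<forall>x\<in>span U. e * norm x \<le> norm (?f x)"
    using injective_imp_isometric[of "span U" ?f] lin closed_subspace[of "span U"] subspace_span
    by blast
  then obtain e where e: "e > 0" "\<And>x. x \<in> span U \<Longrightarrow> e * norm x \<le> norm (?f x)"
    by blast
  have "norm (?f x) \<le> (\<Sum>u\<in>U. \<bar>x \<bullet> u\<bar> * norm u)" for x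
    by (rule order_trans[OF norm_sum]) simp
  then have "\<forall>a\<in>span U. e * norm a \<le> (\<Sum>u\<in>U. \<bar>a \<bullet> u\<bar> * norm u)"
    using e(2) order_trans by blast
  then show ?thesis
    using e(1) by blast
qed


section \<open>Tilings around a cone\<close>

context lattice_tiles
begin

lemma X_subset_L:
  assumes "x \<in> X C K"
  shows "x \<in> L K"
  using assms by (simp add: feasible_for_def)

lemma region_disjoint_translates:
  assumes "pcone K" "x \<in> L K" "x' \<in> L K" "q \<in> R K" "q' \<in> R K" "x + q = x' + q'"
  shows "x = x'"
proof -
  obtain \<tau> \<tau>' where \<tau>: "\<tau> \<in> T K" "q - \<tau> \<in> span K" "\<tau>' \<in> T K" "q' - \<tau>' \<in> span K"
    using region_strip[OF assms(1)] assms(4,5) by metis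
  have "(x + \<tau>) - (x' + \<tau>') = (q' - \<tau>') - (q - \<tau>)"
    using assms(6) by (simp add: algebra_simps)
  also have "\<dots> \<in> span K"
    by (rule span_diff[OF \<tau>(4,2)])
  finally show ?thesis
    using strip_unique[OF pcone_rational[OF assms(1)] assms(2,3) \<tau>(1,3)] by blast
qed

text \<open>Translations in \<open>L C\<close> are orthogonal to all faces of \<open>C\<close>; they change no inner product with
a ray direction and permute the translates of every region of a face.\<close>

lemma X_translate:
  assumes C: "pcone C" "K face_of C" "K \<noteq> {}" and x: "x \<in> X C K" and l: "l \<in> L C"
  shows "x + l \<in> X C K"
  unfolding mem_X_iff[OF C]
proof (intro conjI ballI allI impI)
  note x' = x[unfolded mem_X_iff[OF C]]
  show "x + l \<in> L K"
    using L_add[OF X_subset_L[OF x] L_antimono[OF face_of_imp_subset[OF C(2)] l]] .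
  fix u q assume u: "u \<in> ray_dirs C - K" and "q \<in> R K"
  then have "(x + q) \<bullet> u < 0"
    using x' by blast
  moreover have "u \<in> C"
    using u ray_dirs_subset by blast
  then have "l \<bullet> u = 0"
    using l by (simp add: mem_L_iff)
  ultimately show "(x + l + q) \<bullet> u < 0"
    by (simp add: inner_add_left)
next
  note x' = x[unfolded mem_X_iff[OF C]]
  fix K' y assume K': "K' face_of C \<and> K' \<noteq> {} \<and> \<not> K' \<subseteq> K \<and> \<not> K \<subseteq> K' \<and> y \<in> L K'"
  have "y - l \<in> L K'"
    using K' L_antimono[OF face_of_imp_subset[of K' C] l] by (simp add: L_diff)
  then have disj: "(+) x ` R K \<inter> (+) (y - l) ` R K' = {}"
    using x' K' by blast
  have "False" if "q \<in> R K" "q' \<in> R K'" "x + l + q = y + q'" for q q'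
  proof -
    have "x + q = (y - l) + q'"
      using that(3) by (simp add: algebra_simps)
    then show False
      using disj that(1,2) by (metis disjoint_iff imageI)
  qed
  then show "(+) (x + l) ` R K \<inter> (+) y ` R K' = {}"
    by blast
qed

text \<open>A face of \<open>C\<close> has fewer rays and fewer faces than \<open>C\<close>, hence imposes fewer conditions.\<close>

lemma X_antimono:
  assumes C: "pcone C" "K face_of C" "K \<noteq> {}" and K': "K' face_of C" "K \<subseteq> K'"
    and x: "x \<in> X C K"
  shows "x \<in> X K' K"
proof -
  have ne: "K' \<noteq> {}"
    using C(3) K'(2) by blast
  have p: "pcone K'"
    using pcone_face[OF C(1) K'(1) ne] .
  have f: "K face_of K'"
    using face_subset_iff C(2) K' by blast
  note x' = x[unfolded mem_X_iff[OF C]]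
  show ?thesis
    unfolding mem_X_iff[OF p f C(3)]
  proof (intro conjI ballI allI impI)
    show "x \<in> L K"
      using x' by blast
    fix u q assume "u \<in> ray_dirs K' - K" "q \<in> R K"
    then show "(x + q) \<bullet> u < 0"
      using x' pcone_ray_dirs_face[OF C(1) K'(1)] by blast
  next
    fix K'' y assume "K'' face_of K' \<and> K'' \<noteq> {} \<and> \<not> K'' \<subseteq> K \<and> \<not> K \<subseteq> K'' \<and> y \<in> L K''"
    then show "(+) x ` R K \<inter> (+) y ` R K'' = {}"
      using x' face_of_trans[OF _ K'(1)] by blast
  qed
qed

lemma polar_cone_add_L:
  assumes "q \<in> polar_cone C" "l \<in> L C"
  shows "q + l \<in> polar_cone C"
  using assms by (auto simp: polar_cone_def mem_L_iff inner_add_left)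

text \<open>What the lower regions leave uncovered is invariant under \<open>L C\<close>, as is \<open>CDC(C\<^sup>\<or>)\<close>, so it
suffices to move an uncovered point into the basic strip. The translations of \<open>R C\<close> range over all
of \<open>L C\<close> here, not just over \<open>0\<close>.\<close>

lemma regions_cover:
  assumes C: "pcone C" and p: "p \<in> cdc (polar_cone C)"
  shows "\<exists>J y q. J face_of C \<and> J \<noteq> {} \<and> y \<in> L J \<and> (J \<noteq> C \<longrightarrow> y \<in> X C J) \<and> q \<in> R J \<and> p = y + q"
proof -
  have CC: "C face_of C" "C \<noteq> {}"
    using pcone_convex[OF C] pcone_zero_mem[OF C] face_of_refl by auto
  show ?thesis
  proof (cases "C = {0}")
    case True
    obtain z \<tau> where "z \<in> \<Lambda>" "\<tau> \<in> T\<^sub>0" "p = z + \<tau>"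
      using T0_tiles by blast
    then show ?thesis
      using CC True by (intro exI[of _ C] exI[of _ z] exI[of _ \<tau>]) (simp add: L0 region_zero)
  next
    case nz: False
    show ?thesis
    proof (cases "\<exists>K x q. K face_of C \<and> K \<noteq> {} \<and> K \<noteq> C \<and> x \<in> X C K \<and> q \<in> R K \<and> p = x + q")
      case True
      then show ?thesis
        using X_subset_L by blast
    next
      case False
      obtain y \<tau> where y: "y \<in> L C" "\<tau> \<in> T C" "p - y - \<tau> \<in> span C"
        using strip_tiles[OF pcone_rational[OF C]] by blast
      have my: "- y \<in> L C"
        using L_diff[OF L_zero y(1)] by simp
      have "p + - y \<in> cdc (polar_cone C)"
        using CDC_translate[OF p, of "- y" "polar_cone C"] my polar_cone_add_L mem_L_iff by blast
      moreover have "p - y \<noteq> x + q"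
        if "K face_of C \<and> K \<noteq> {} \<and> K \<noteq> C \<and> x \<in> X C K \<and> q \<in> R K" for K x q
      proof
        assume "p - y = x + q"
        then have "p = (x + y) + q"
          by (simp add: algebra_simps)
        moreover have "x + y \<in> X C K"
          using that X_translate[OF C _ _ _ y(1)] by blast
        ultimately show False
          using False that by blast
      qed
      ultimately have "p - y \<in> R C"
        using y(2,3) mem_region_iff[OF C nz] by auto
      then show ?thesis
        using CC y(1) by (intro exI[of _ C] exI[of _ y] exI[of _ "p - y"]) simp
    qed
  qed
qed

text \<open>The conditions defining \<open>X C J\<close> which are not already part of \<open>X K J\<close> belong to a ray of \<open>C\<close>
outside \<open>K\<close>, with direction \<open>u\<close> say: either \<open>y + R J\<close> has to be strictly inside its half-space, or
\<open>y + R J\<close> has to avoid translates that stay within \<open>\<rho>\<close> of its hyperplane. Since \<open>y + R J\<close> has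
diameter at most \<open>2 \<rho>\<close>, both hold as soon as its point \<open>p\<close> has distance more than \<open>3 \<rho>\<close> from the
hyperplane, on its inner side.\<close>

lemma X_transfer:
  assumes C: "pcone C" and J: "J face_of C" "J \<noteq> {}" "J \<noteq> C" and K: "K face_of C" "J \<subseteq> K"
    and y: "y \<in> L J" "J \<noteq> K \<Longrightarrow> y \<in> X K J" and q: "q \<in> R J" "p = y + q"
    and bound: "\<And>J' z. J' face_of C \<Longrightarrow> J' \<noteq> {} \<Longrightarrow> J' \<noteq> C \<Longrightarrow> z \<in> R J' \<Longrightarrow> norm z \<le> \<rho>"
    and far: "\<And>u. u \<in> ray_dirs C \<Longrightarrow> u \<notin> K \<Longrightarrow> p \<bullet> u < - (3 * \<rho>)"
  shows "y \<in> X C J"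
proof -
  have Kne: "K \<noteq> {}"
    using J K by blast
  have pK: "pcone K"
    using pcone_face[OF C K(1) Kne] .
  have JK: "J face_of K"
    using face_subset_iff[OF J(1) K(1)] K(2) by simp
  have \<rho>: "0 \<le> \<rho>"
    using bound[OF J q(1)] norm_ge_zero[of q] by linarith
  have near: "(y + r) \<bullet> u < - \<rho>" if u: "u \<in> ray_dirs C" "u \<notin> K" and r: "r \<in> R J" for u r
  proof -
    have "(r - q) \<bullet> u \<le> norm (r - q) * norm u"
      by (rule norm_cauchy_schwarz)
    also have "\<dots> \<le> norm r + norm q"
      using norm_ray_dirs[OF u(1)] norm_triangle_ineq4[of r q] by simp
    also have "\<dots> \<le> 2 * \<rho>"
      using bound[OF J q(1)] bound[OF J r] by simp
    finally have "(r - q) \<bullet> u \<le> 2 * \<rho>" .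
    moreover have "(y + r) \<bullet> u = p \<bullet> u + (r - q) \<bullet> u"
      by (simp add: q(2) inner_add_left inner_diff_left)
    ultimately show ?thesis
      using far[OF u] by linarith
  qed
  show ?thesis
    unfolding mem_X_iff[OF C J(1,2)]
  proof (intro conjI ballI allI impI)
    show "y \<in> L J"
      by fact
    fix u r assume u: "u \<in> ray_dirs C - J" and r: "r \<in> R J"
    show "(y + r) \<bullet> u < 0"
    proof (cases "u \<in> K")
      case True
      then have "u \<in> ray_dirs K - J" "J \<noteq> K"
        using u pcone_ray_dirs_face[OF C K(1)] by auto
      then show ?thesis
        using y(2) r mem_X_iff[OF pK JK J(2)] by blast
    next
      case False
      then show ?thesis
        using near[of u r] u r \<rho> by simp
    qed
  next
    fix K' x' assume K': "K' face_of C \<and> K' \<noteq> {} \<and> \<not> K' \<subseteq> J \<and> \<not> J \<subseteq> K' \<and> x' \<in> L K'"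
    show "(+) y ` R J \<inter> (+) x' ` R K' = {}"
    proof (cases "K' \<subseteq> K")
      case True
      then have "K' face_of K" "J \<noteq> K"
        using face_subset_iff K' K by auto
      then show ?thesis
        using y(2) K' mem_X_iff[OF pK JK J(2)] by blast
    next
      case False
      obtain u where u: "u \<in> ray_dirs C" "u \<in> K'" "u \<notin> K"
        using pcone_face_subset[OF C K(1) _ Kne _ False] K' by blast
      have K'C: "K' \<noteq> C"
        using K' face_of_imp_subset[OF J(1)] by blast
      have "y + r \<noteq> x' + r'" if r: "r \<in> R J" "r' \<in> R K'" for r r'
      proof
        assume "y + r = x' + r'"
        then have "(y + r) \<bullet> u = x' \<bullet> u + r' \<bullet> u"
          by (simp add: inner_add_left)
        moreover have "x' \<bullet> u = 0"
          using K' u(2) by (simp add: mem_L_iff)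
        moreover have "- norm r' \<le> r' \<bullet> u"
          using norm_cauchy_schwarz[of "- r'" u] norm_ray_dirs[OF u(1)] by simp
        moreover have "norm r' \<le> \<rho>"
          using bound[of K' r'] K' K'C r(2) by blast
        ultimately show False
          using near[OF u(1,3) r(1)] by linarith
      qed
      then show ?thesis
        by blast
    qed
  qed
qed

lemma CDC_near:
  assumes "p \<in> cdc Q" "\<And>\<tau>. \<tau> \<in> T\<^sub>0 \<Longrightarrow> norm \<tau> \<le> d"
  shows "\<exists>q\<in>Q. norm (p - q) \<le> 2 * d"
proof -
  obtain z \<tau> \<tau>' where z: "\<tau> \<in> T\<^sub>0" "\<tau>' \<in> T\<^sub>0" "p = z + \<tau>" "z + \<tau>' \<in> Q"
    using assms(1) by (auto simp: mem_CDC_iff)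
  have "norm (p - (z + \<tau>')) \<le> norm \<tau> + norm \<tau>'"
    using norm_triangle_ineq4[of \<tau> \<tau>'] by (simp add: z(3))
  also have "\<dots> \<le> 2 * d"
    using assms(2)[OF z(1)] assms(2)[OF z(2)] by simp
  finally show ?thesis
    using z(4) by blast
qed

text \<open>By induction on the dimension. Let \<open>p \<in> R C\<close>, let \<open>S\<close> be the set of ray directions \<open>v\<close> for
which \<open>p \<bullet> v\<close> is not very negative, and suppose that a proper face \<open>K\<close> contains \<open>\<Sum>S\<close>. Then \<open>S \<subseteq> K\<close>,
so \<open>p\<close> is far from the hyperplanes of the rays outside \<open>K\<close>; by the transfer principle a lower
translate covers \<open>p\<close>, which is impossible. So \<open>\<Sum>S\<close> is relatively interior in \<open>C\<close>. As \<open>p \<bullet> \<Sum>S\<close> is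
bounded from below and \<open>p\<close> is near the polar cone, \<open>p \<bullet> u\<close> is bounded for all ray directions \<open>u\<close>,
and the ray directions span \<open>C\<close>.\<close>

lemma bounded_region:
  assumes "pcone C"
  shows "bounded (R C)"
  using assms
proof (induction "nat (aff_dim C + 1)" arbitrary: C rule: less_induct)
  case (less C)
  note C = less.prems
  have CC: "convex C"
    using pcone_convex[OF C] .
  have "\<exists>\<rho>\<ge>0. \<forall>J\<in>{J. J face_of C \<and> J \<noteq> {} \<and> J \<noteq> C} \<union> {{0}}. \<forall>z\<in>R J. norm z \<le> \<rho>"
  proof (rule finite_uniform_bound)
    have "finite {J. J face_of C \<and> J \<noteq> {} \<and> J \<noteq> C}"
      by (rule finite_subset[OF _ finite_polyhedron_faces[OF pcone_polyhedron[OF C]]]) auto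
    then show "finite ({J. J face_of C \<and> J \<noteq> {} \<and> J \<noteq> C} \<union> {{0}})"
      by simp
    fix J assume J: "J \<in> {J. J face_of C \<and> J \<noteq> {} \<and> J \<noteq> C} \<union> {{0}}"
    have "bounded (R J)"
    proof (cases "J = {0}")
      case True
      then show ?thesis
        using bounded_T region_zero by simp
    next
      case False
      then have J': "J face_of C" "J \<noteq> {}" "J \<noteq> C"
        using J by auto
      have "aff_dim J < aff_dim C"
        using face_of_aff_dim_lt[OF CC J'(1,3)] .
      moreover have "0 \<le> aff_dim J"
        using J'(2) aff_dim_negative_iff[of J] by (metis not_less)
      ultimately have "nat (aff_dim J + 1) < nat (aff_dim C + 1)"
        by simp
      then show ?thesis
        using less.hyps pcone_face[OF C J'(1,2)] by blast
    qed
    then show "\<exists>B. \<forall>z\<in>R J. norm z \<le> B"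
      by (simp add: bounded_iff)
  qed force
  then obtain \<rho> where \<rho>: "0 \<le> \<rho>"
    and bound: "\<And>J z. J face_of C \<Longrightarrow> J \<noteq> {} \<Longrightarrow> J \<noteq> C \<Longrightarrow> z \<in> R J \<Longrightarrow> norm z \<le> \<rho>"
    and bound0: "\<And>z. z \<in> T\<^sub>0 \<Longrightarrow> norm z \<le> \<rho>"
    using region_zero by auto
  show ?case
  proof (cases "C = {0}")
    case True
    then show ?thesis
      using bounded_T region_zero by simp
  next
    case nz: False
    define U where "U = ray_dirs C"
    have U: "finite U" "U \<subseteq> C"
      using finite_ray_dirs[OF pcone_conic[OF C] pcone_pointed[OF C] pcone_polyhedron[OF C]]
        ray_dirs_subset[of C] by (auto simp: U_def)
    have sum_mem: "\<Sum>S \<in> C" if "S \<subseteq> U" for S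
      using that U pcone_zero_mem[OF C] by (intro conic_sum[OF pcone_conic[OF C] CC]) auto
    \<comment> \<open>If \<open>\<Sum>S\<close> is relatively interior, \<open>\<Sum>S - e u\<close> is still in \<open>C\<close>, and \<open>p\<close>, being near the polar cone,
      has a bounded inner product with it; so a lower bound on \<open>S\<close> yields one for \<open>u\<close>.\<close>
    have core: "\<exists>B. \<forall>u\<in>U. \<forall>p. p \<in> cdc (polar_cone C) \<longrightarrow> (\<forall>v\<in>S. - (3 * \<rho>) \<le> p \<bullet> v) \<longrightarrow> - B \<le> p \<bullet> u"
      if S: "S \<subseteq> U" "\<Sum>S \<in> rel_interior C" for S
    proof -
      have "\<exists>B\<ge>0. \<forall>u\<in>U. \<forall>p. p \<in> cdc (polar_cone C) \<longrightarrow> (\<forall>v\<in>S. - (3 * \<rho>) \<le> p \<bullet> v) \<longrightarrow> - B \<le> p \<bullet> u"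
      proof (rule finite_uniform_bound[OF U(1)])
        fix u assume u: "u \<in> U"
        obtain e where e: "e > 0" "\<Sum>S - e *\<^sub>R u \<in> C"
          using rel_interior_conic_minus[OF pcone_conic[OF C] S(2), of u] u U(2) by blast
        let ?w = "\<Sum>S - e *\<^sub>R u"
        have "- ((3 * \<rho> * card S + 2 * \<rho> * norm ?w) / e) \<le> p \<bullet> u"
          if p: "p \<in> cdc (polar_cone C)" and pS: "\<forall>v\<in>S. - (3 * \<rho>) \<le> p \<bullet> v" for p
        proof -
          obtain r where r: "r \<in> polar_cone C" "norm (p - r) \<le> 2 * \<rho>"
            using CDC_near[OF p bound0] by blast
          have "p \<bullet> ?w = r \<bullet> ?w + (p - r) \<bullet> ?w"
            by (simp add: inner_diff_left)
          also have "\<dots> \<le> 0 + norm (p - r) * norm ?w"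
            using r(1) e(2) by (intro add_mono norm_cauchy_schwarz) (auto simp: polar_cone_def)
          also have "\<dots> \<le> 2 * \<rho> * norm ?w"
            using r(2) by (simp add: mult_right_mono)
          finally have "p \<bullet> \<Sum>S - e * (p \<bullet> u) \<le> 2 * \<rho> * norm ?w"
            by (simp add: inner_diff_right)
          moreover have "(\<Sum>v\<in>S. - (3 * \<rho>)) \<le> (\<Sum>v\<in>S. p \<bullet> v)"
            using pS by (intro sum_mono) auto
          then have "- (3 * \<rho> * card S) \<le> p \<bullet> \<Sum>S"
            by (simp add: inner_sum_right mult.commute)
          ultimately have "- (3 * \<rho> * card S + 2 * \<rho> * norm ?w) \<le> e * (p \<bullet> u)"
            by linarith
          then show ?thesis
            using e(1) by (simp add: field_simps)
        qed
        then show "\<exists>B. \<forall>p. p \<in> cdc (polar_cone C) \<longrightarrow> (\<forall>v\<in>S. - (3 * \<rho>) \<le> p \<bullet> v) \<longrightarrow> - B \<le> p \<bullet> u"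
          by blast
      qed force
      then show ?thesis by blast
    qed
    have "\<exists>B\<ge>0. \<forall>S\<in>{S. S \<subseteq> U \<and> \<Sum>S \<in> rel_interior C}. \<forall>u\<in>U. \<forall>p. p \<in> cdc (polar_cone C) \<longrightarrow>
        (\<forall>v\<in>S. - (3 * \<rho>) \<le> p \<bullet> v) \<longrightarrow> - B \<le> p \<bullet> u"
    proof (rule finite_uniform_bound)
      show "finite {S. S \<subseteq> U \<and> \<Sum>S \<in> rel_interior C}"
        by (rule finite_subset[of _ "Pow U"]) (use U(1) in auto)
    next
      fix S assume "S \<in> {S. S \<subseteq> U \<and> \<Sum>S \<in> rel_interior C}"
      then show "\<exists>B. \<forall>u\<in>U. \<forall>p. p \<in> cdc (polar_cone C) \<longrightarrow>
          (\<forall>v\<in>S. - (3 * \<rho>) \<le> p \<bullet> v) \<longrightarrow> - B \<le> p \<bullet> u"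
        using core[of S] by simp
    qed force
    then obtain B where B: "0 \<le> B" "\<And>S u p. S \<subseteq> U \<Longrightarrow> \<Sum>S \<in> rel_interior C \<Longrightarrow> u \<in> U \<Longrightarrow>
        p \<in> cdc (polar_cone C) \<Longrightarrow> (\<And>v. v \<in> S \<Longrightarrow> - (3 * \<rho>) \<le> p \<bullet> v) \<Longrightarrow> - B \<le> p \<bullet> u"
      by auto
    have inner_bound: "\<bar>p \<bullet> u\<bar> \<le> B + 2 * \<rho>" if p: "p \<in> R C" and u: "u \<in> U" for p u
    proof -
      have pc: "p \<in> cdc (polar_cone C)"
        using region_subset_CDC[OF C p] .
      define S where "S = {v \<in> U. - (3 * \<rho>) \<le> p \<bullet> v}"
      have SU: "S \<subseteq> U"
        by (auto simp: S_def)
      have rel: "\<Sum>S \<in> rel_interior C"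
      proof (rule ccontr)
        assume "\<Sum>S \<notin> rel_interior C"
        then have "\<Sum>S \<in> rel_frontier C"
          using sum_mem[OF SU] closure_subset by (auto simp: rel_frontier_def)
        then obtain K where K: "K face_of C" "K \<noteq> C" "\<Sum>S \<in> K"
          using rel_frontier_of_polyhedron_alt[OF pcone_polyhedron[OF C]] by auto
        have Kne: "K \<noteq> {}"
          using K(3) by blast
        have KC: "K \<subseteq> C"
          using face_of_imp_subset[OF K(1)] .
        have SK: "v \<in> K" if "v \<in> S" for v
        proof (rule face_of_conic_sum_mem[OF K(1) pcone_conic[OF C] CC])
          show "\<Sum>S \<in> K" "v \<in> S"
            using K(3) that by auto
          show "finite S"
            using finite_subset[OF SU U(1)] .
          show "w \<in> C" if "w \<in> S" for w
            using that SU U by blast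
        qed
        have "p \<in> cdc (polar_cone K)"
          using CDC_mono[OF pc polar_cone_antimono[OF KC]] .
        then obtain J y q where J: "J face_of K" "J \<noteq> {}" "y \<in> L J" "J \<noteq> K \<Longrightarrow> y \<in> X K J"
            "q \<in> R J" "p = y + q"
          using regions_cover[OF pcone_face[OF C K(1) Kne]] by blast
        have JK: "J \<subseteq> K"
          using face_of_imp_subset[OF J(1)] .
        have JC: "J face_of C" "J \<noteq> C"
          using face_of_trans[OF J(1) K(1)] JK KC K(2) by auto
        have "y \<in> X C J"
        proof (rule X_transfer[OF C JC(1) J(2) JC(2) K(1) JK J(3,4,5,6) bound])
          fix u assume "u \<in> ray_dirs C" "u \<notin> K"
          then show "p \<bullet> u < - (3 * \<rho>)"
            using SK[of u] by (force simp: S_def U_def not_le[symmetric])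
        qed
        then show False
          using p mem_region_iff[OF C nz] JC J(2,5,6) by blast
      qed
      have "- B \<le> p \<bullet> u"
        by (rule B(2)[OF SU rel u pc]) (simp add: S_def)
      moreover have "p \<bullet> u \<le> 2 * \<rho>"
      proof -
        obtain r where r: "r \<in> polar_cone C" "norm (p - r) \<le> 2 * \<rho>"
          using CDC_near[OF pc bound0] by blast
        have "p \<bullet> u = r \<bullet> u + (p - r) \<bullet> u"
          by (simp add: inner_diff_left)
        also have "\<dots> \<le> 0 + norm (p - r) * norm u"
          using r(1) u U by (intro add_mono norm_cauchy_schwarz) (auto simp: polar_cone_def)
        also have "norm u = 1"
          using u norm_ray_dirs by (simp add: U_def)
        finally show ?thesis
          using r(2) by simp
      qed
      ultimately show ?thesis
        using B(1) \<rho> by linarith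
    qed
    obtain b where b: "\<And>\<tau>. \<tau> \<in> T C \<Longrightarrow> norm \<tau> \<le> b"
      using bounded_T[of C] by (auto simp: bounded_iff)
    obtain e where e: "e > 0" "\<And>a. a \<in> span U \<Longrightarrow> e * norm a \<le> (\<Sum>u\<in>U. \<bar>a \<bullet> u\<bar> * norm u)"
      using norm_bounded_by_inner_products[OF U(1)] by blast
    have CU: "C \<subseteq> span U"
    proof (rule polyhedral_cone_generated_by_rays)
      show "convex (span U)"
        by (simp add: subspace_imp_convex)
      show "ray_dirs C \<subseteq> span U"
        by (simp add: U_def span_superset)
    qed (use C pcone_polyhedron pcone_conic pcone_pointed in \<open>auto simp: span_zero\<close>)
    have "norm p \<le> b + (\<Sum>u\<in>U. (B + 2 * \<rho> + b) * norm u) / e" if p: "p \<in> R C" for p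
    proof -
      obtain \<tau> where \<tau>: "\<tau> \<in> T C" "p - \<tau> \<in> span C"
        using region_strip[OF C p] by blast
      have "span C \<subseteq> span U"
        using CU by (simp add: span_minimal)
      then have "e * norm (p - \<tau>) \<le> (\<Sum>u\<in>U. \<bar>(p - \<tau>) \<bullet> u\<bar> * norm u)"
        using e(2) \<tau>(2) by blast
      also have "\<dots> \<le> (\<Sum>u\<in>U. (B + 2 * \<rho> + b) * norm u)"
      proof (intro sum_mono mult_right_mono)
        fix u assume u: "u \<in> U"
        have "\<bar>\<tau> \<bullet> u\<bar> \<le> norm \<tau> * norm u"
          by (rule Cauchy_Schwarz_ineq2)
        moreover have "norm u = 1"
          using u norm_ray_dirs by (simp add: U_def)
        moreover have "\<bar>(p - \<tau>) \<bullet> u\<bar> \<le> \<bar>p \<bullet> u\<bar> + \<bar>\<tau> \<bullet> u\<bar>"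
          by (simp add: inner_diff_left)
        ultimately show "\<bar>(p - \<tau>) \<bullet> u\<bar> \<le> B + 2 * \<rho> + b"
          using inner_bound[OF p u] b[OF \<tau>(1)] by simp
      qed simp
      finally have "norm (p - \<tau>) \<le> (\<Sum>u\<in>U. (B + 2 * \<rho> + b) * norm u) / e"
        using e(1) by (simp add: field_simps)
      moreover have "norm p \<le> norm \<tau> + norm (p - \<tau>)"
        by (metis add.commute diff_add_cancel norm_triangle_ineq)
      ultimately show ?thesis
        using b[OF \<tau>(1)] by linarith
    qed
    then show ?thesis
      unfolding bounded_iff by blast
  qed
qed

text \<open>Apply the covering to the ray \<open>M\<close> alone. Its only proper face is \<open>{0}\<close>, whose admissible
translates are the tiles strictly inside the half-space of \<open>M\<close>; a tile with a point on the bounding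
hyperplane is not among them, so translates of \<open>R M\<close> have to cover it.\<close>

lemma tile_meeting_hyperplane_covered_by_ray:
  assumes C: "pcone C" and u: "u \<in> ray_dirs C"
    and z: "z \<in> \<Lambda>" "\<tau> \<in> T\<^sub>0" "\<tau>\<^sub>1 \<in> T\<^sub>0" "(z + \<tau>\<^sub>1) \<bullet> u = 0"
  obtains M y q where "M face_of C" "u \<in> M" "M = (\<lambda>s. s *\<^sub>R u) ` {0..}" "y \<in> L M" "q \<in> R M"
    "z + \<tau> = y + q"
proof -
  obtain M where M: "ray_of M C" "u \<in> M" "norm u = 1"
    using u by (auto simp: ray_dirs_def)
  have eq: "M = (\<lambda>s. s *\<^sub>R u) ` {0..}"
    using ray_eq_half_line[OF pcone_conic[OF C] pcone_pointed[OF C] M] .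
  have MC: "M face_of C" and ne: "M \<noteq> {}"
    using M by (auto simp: ray_of_def)
  have pM: "pcone M"
    using pcone_face[OF C MC ne] .
  have "z + \<tau>\<^sub>1 \<in> polar_cone M"
    unfolding eq using z(4) by (auto simp: polar_cone_def)
  then have "z + \<tau> \<in> cdc (polar_cone M)"
    using z by (auto simp: mem_CDC_iff)
  then obtain J y q where J: "J face_of M" "J \<noteq> {}" "y \<in> L J" "J \<noteq> M \<Longrightarrow> y \<in> X M J"
      "q \<in> R J" "z + \<tau> = y + q"
    using regions_cover[OF pM] by blast
  have "J = M"
  proof (rule ccontr)
    assume JM: "J \<noteq> M"
    have cJ: "conic J"
      using conic_face[OF J(1) pcone_conic[OF pM]] .
    have uJ: "u \<notin> J"
    proof
      assume "u \<in> J"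
      then have "M \<subseteq> J"
        unfolding eq using conicD[OF cJ] by auto
      then show False
        using JM face_of_imp_subset[OF J(1)] by blast
    qed
    have "x = 0" if x: "x \<in> J" for x
    proof (rule ccontr)
      assume "x \<noteq> 0"
      then obtain s where s: "x = s *\<^sub>R u" "s > 0"
        using x face_of_imp_subset[OF J(1)] eq by force
      then show False
        using conicD[OF cJ x, of "inverse s"] uJ by simp
    qed
    then have J0: "J = {0}"
      using J(2) by blast
    have "z = y"
      using T0_unique[OF z(1) _ z(2) _ J(6)] J(3,5) J0 by (simp add: L0 region_zero)
    moreover have "u \<in> ray_dirs M - J"
      using pcone_ray_dirs_face[OF C MC] u M(2) uJ by blast
    then have "(y + \<tau>\<^sub>1) \<bullet> u < 0"
      using mem_X_iff[OF pM J(1,2)] J(4)[OF JM] z(3) J0 region_zero by blast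
    ultimately show False
      using z(4) by simp
  qed
  then show ?thesis
    using that[OF MC M(2) eq _ _ J(6)] J(3,5) by blast
qed

text \<open>This is what keeps feasible translates inside \<open>CDC(C\<^sup>\<or>)\<close>: a tile \<open>z + T\<^sub>0\<close> that shares a point
with \<open>x + R K\<close> cannot reach across the hyperplane of a ray outside \<open>K\<close>. By condition (I) the common
point is strictly inside, so by connectedness a tile reaching across would meet the hyperplane and be
covered by translates of the region of that ray, from which (II) separates \<open>x + R K\<close>. Only the face
\<open>K = {0}\<close> is comparable to such a ray; there \<open>x + R K\<close> is the tile itself, and (I) alone suffices.\<close>

lemma feasible_region_in_polar_cone:
  assumes C: "pcone C" and K: "K face_of C" "K \<noteq> {}" and x: "x \<in> L K" "K \<noteq> C \<Longrightarrow> x \<in> X C K"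
    and q: "q \<in> R K" and z: "z \<in> \<Lambda>" "\<tau> \<in> T\<^sub>0" "\<tau>' \<in> T\<^sub>0" "x + q = z + \<tau>"
    and polar: "z + \<tau>' \<in> polar_cone K"
  shows "z + \<tau>' \<in> polar_cone C"
  unfolding mem_polar_cone_iff_rays[OF C]
proof
  fix u assume u: "u \<in> ray_dirs C"
  show "(z + \<tau>') \<bullet> u \<le> 0"
  proof (cases "u \<in> K")
    case True
    then show ?thesis
      using polar by (simp add: polar_cone_def)
  next
    case uK: False
    then have KC: "K \<noteq> C"
      using u ray_dirs_subset by blast
    note xX = x(2)[OF KC, unfolded mem_X_iff[OF C K]]
    show ?thesis
    proof (rule ccontr)
      assume "\<not> ?thesis"
      then have pos: "0 \<le> u \<bullet> (z + \<tau>')"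
        by (simp add: inner_commute)
      have "(x + q) \<bullet> u < 0"
        using xX u uK q by blast
      then have neg: "u \<bullet> (z + \<tau>) \<le> 0"
        using z(4) by (simp add: inner_commute)
      have "connected ((+) z ` T\<^sub>0)"
        by (rule connected_continuous_image[OF _ connected_T0]) (intro continuous_intros)
      then obtain w where "w \<in> (+) z ` T\<^sub>0" "u \<bullet> w = 0"
        using connected_ivt_hyperplane[of "(+) z ` T\<^sub>0" "z + \<tau>" "z + \<tau>'" u 0] z(2,3) neg pos
        by auto
      then obtain \<tau>\<^sub>1 where \<tau>\<^sub>1: "\<tau>\<^sub>1 \<in> T\<^sub>0" "(z + \<tau>\<^sub>1) \<bullet> u = 0"
        by (auto simp: inner_commute)
      obtain M y r where M: "M face_of C" "u \<in> M" "M = (\<lambda>s. s *\<^sub>R u) ` {0..}" "y \<in> L M" "r \<in> R M"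
          "z + \<tau> = y + r"
        using tile_meeting_hyperplane_covered_by_ray[OF C u z(1,2) \<tau>\<^sub>1] .
      show False
      proof (cases "K = {0}")
        case True
        then have "x = z"
          using T0_unique[OF _ z(1) _ z(2) z(4)] x(1) q by (simp add: L0 region_zero)
        then have "(z + \<tau>\<^sub>1) \<bullet> u < 0"
          using xX u uK \<tau>\<^sub>1(1) True region_zero by blast
        then show False
          using \<tau>\<^sub>1(2) by simp
      next
        case False
        have cK: "conic K"
          using conic_face[OF K(1) pcone_conic[OF C]] .
        have "\<not> K \<subseteq> M"
        proof
          assume KM: "K \<subseteq> M"
          obtain k where k: "k \<in> K" "k \<noteq> 0"
            using False K(2) by blast
          then obtain s where s: "k = s *\<^sub>R u" "s > 0"
            using KM M(3) by force
          then show False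
            using conicD[OF cK k(1), of "inverse s"] uK by simp
        qed
        moreover have "\<not> M \<subseteq> K" "M \<noteq> {}"
          using M(2) uK by auto
        ultimately have "(+) x ` R K \<inter> (+) y ` R M = {}"
          using xX M(1,4) by blast
        moreover have "x + q = y + r"
          using z(4) M(6) by simp
        ultimately show False
          using q M(5) by (metis disjoint_iff imageI)
      qed
    qed
  qed
qed

text \<open>Three different reasons, depending on the two faces: distinct translates of one region lie in
distinct strips, incomparable faces are separated by (II), and for nested faces the smaller
translate has been removed from the larger region.\<close>

lemma feasible_regions_disjoint:
  assumes C: "pcone C" and K: "K face_of C" "K \<noteq> {}" and K': "K' face_of C" "K' \<noteq> {}"
    and x: "x \<in> feasible_translations \<Lambda> D C K" and x': "x' \<in> feasible_translations \<Lambda> D C K'"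
    and q: "q \<in> R K" "q' \<in> R K'" "x + q = x' + q'"
  shows "K = K' \<and> x = x'"
proof -
  have xL: "x \<in> L K" "x' \<in> L K'"
    using x x' X_subset_L L_zero by (auto simp: feasible_translations_def split: if_splits)
  have xX: "x \<in> X C K" if "K \<noteq> C"
    using x that by (simp add: feasible_translations_def)
  have xX': "x' \<in> X C K'" if "K' \<noteq> C"
    using x' that by (simp add: feasible_translations_def)
  \<comment> \<open>For nested faces the translation is feasible already with respect to the larger face, whose
    region excludes the translate by definition.\<close>
  have nested: False if J: "J face_of C" "J \<noteq> {}" "J' face_of C" "J \<subseteq> J'" "J \<noteq> J'" "y \<in> X C J" "y' \<in> L J'"
    "r \<in> R J" "r' \<in> R J'" "y + r = y' + r'" for J J' y y' r r'
  proof -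
    have ne: "J' \<noteq> {}"
      using J by blast
    have p': "pcone J'"
      using pcone_face[OF C J(3) ne] .
    have JJ': "J face_of J'"
      using face_subset_iff[OF J(1,3)] J(4) by simp
    have "y \<in> X J' J"
      using X_antimono[OF C J(1,2,3,4,6)] .
    then have "y + - y' \<in> X J' J"
      using L_diff[OF L_zero J(7)] by (intro X_translate[OF p' JJ' J(2)]) simp_all
    moreover have "r' = (y + - y') + r"
      using J(10) by (simp add: algebra_simps)
    moreover have "J' \<noteq> {0}"
      using J(2,4,5) by blast
    ultimately show False
      using mem_region_iff[OF p', of r'] J(2,5,8,9) JJ' by blast
  qed
  have KK': "K = K'"
  proof (rule ccontr)
    assume ne: "K \<noteq> K'"
    consider "K \<subseteq> K'" | "K' \<subseteq> K" | "\<not> K \<subseteq> K'" "\<not> K' \<subseteq> K"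
      by blast
    then show False
    proof cases
      case 1
      then have "K \<noteq> C"
        using ne face_of_imp_subset[OF K'(1)] by blast
      then show False
        using nested[OF K K'(1) 1 ne xX xL(2) q] by blast
    next
      case 2
      then have "K' \<noteq> C"
        using ne face_of_imp_subset[OF K(1)] by blast
      then show False
        using nested[OF K' K(1) 2 _ xX' xL(1) q(2,1)] ne q(3) by metis
    next
      case 3
      then have "K \<noteq> C"
        using face_of_imp_subset[OF K'(1)] by blast
      then have "(+) x ` R K \<inter> (+) x' ` R K' = {}"
        using xX 3 K' xL(2) mem_X_iff[OF C K] by blast
      then show False
        using q by (metis disjoint_iff imageI)
    qed
  qed
  then show ?thesis
    using region_disjoint_translates[OF pcone_face[OF C K] xL(1) _ q(1) _ q(3)] xL(2) q(2) by blast
qed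

end


section \<open>Rationality of cones cut out by lattice vectors\<close>

context lattice_tiles
begin

lemma representation_lattice:
  assumes "lattice_basis \<Lambda> B" "x \<in> \<Lambda>"
  shows "\<exists>c :: 'a \<Rightarrow> int. x = (\<Sum>b\<in>B. of_int (c b) *\<^sub>R b) \<and>
    (\<forall>b\<in>B. representation B x b = of_int (c b))"
proof -
  have B: "independent B"
    using assms(1) by (simp add: lattice_basis_def)
  have fin: "finite B"
    using B by (simp add: independent_imp_finite)
  obtain c :: "'a \<Rightarrow> int" where c: "x = (\<Sum>b\<in>B. of_int (c b) *\<^sub>R b)"
    using assms unfolding lattice_basis_def by blast
  have "representation B x b = of_int (c b)" if b: "b \<in> B" for b
  proof -
    have "representation B x b = (\<Sum>b'\<in>B. of_int (c b') * representation B b' b)"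
      unfolding c using B
      by (subst representation_sum) (auto simp: span_base span_scale representation_scale)
    also have "\<dots> = (\<Sum>b'\<in>B. if b' = b then of_int (c b') else 0)"
      using B by (intro sum.cong) (auto simp: representation_basis)
    also have "\<dots> = of_int (c b)"
      using b fin by simp
    finally show ?thesis .
  qed
  then show ?thesis
    using c by blast
qed

text \<open>Coordinates are bounded linear functionals, so a ball admits finitely many integral values.\<close>

lemma finite_lattice_points: "finite {z \<in> \<Lambda>. norm z \<le> r}"
proof -
  obtain B where lb: "lattice_basis \<Lambda> B" and B: "independent B" "span B = UNIV"
    using full_rank by (auto simp: full_rank_lattice_def lattice_basis_def)
  have fin: "finite B"
    using B(1) by (simp add: independent_imp_finite)
  have "\<exists>K\<ge>0. \<forall>b\<in>B. \<forall>x. norm (representation B x b) \<le> norm x * K"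
  proof (rule finite_uniform_bound[OF fin])
    fix b
    show "\<exists>K. \<forall>x. norm (representation B x b) \<le> norm x * K"
      using bounded_linear.bounded[OF bounded_linear_representation[OF B]] by blast
  next
    fix b K K' assume K: "\<forall>x. norm (representation B x b) \<le> norm x * K" "K \<le> (K'::real)"
    show "\<forall>x. norm (representation B x b) \<le> norm x * K'"
      using K by (meson mult_left_mono norm_ge_zero order_trans)
  qed
  then obtain K where K: "0 \<le> K" "\<And>b x. b \<in> B \<Longrightarrow> norm (representation B x b) \<le> norm x * K"
    by blast
  define N where "N = \<lceil>r * K\<rceil>"
  have "{z \<in> \<Lambda>. norm z \<le> r} \<subseteq>
      (\<lambda>c. \<Sum>b\<in>B. of_int (c b) *\<^sub>R b) ` (B \<rightarrow>\<^sub>E {- N..N})"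
  proof
    fix z assume z: "z \<in> {z \<in> \<Lambda>. norm z \<le> r}"
    obtain c :: "'a \<Rightarrow> int" where c: "z = (\<Sum>b\<in>B. of_int (c b) *\<^sub>R b)"
        "\<And>b. b \<in> B \<Longrightarrow> representation B z b = of_int (c b)"
      using representation_lattice[OF lb, of z] z by blast
    have "c b \<in> {- N..N}" if "b \<in> B" for b
    proof -
      have "\<bar>of_int (c b)\<bar> \<le> norm z * K"
        using K(2)[OF that, of z] c(2)[OF that] by simp
      also have "\<dots> \<le> r * K"
        using z K(1) by (intro mult_right_mono) auto
      also have "\<dots> \<le> of_int N"
        by (simp add: N_def)
      finally show ?thesis
        by (simp add: abs_le_iff)
    qed
    then have "restrict c B \<in> B \<rightarrow>\<^sub>E {- N..N}"
      by auto
    moreover have "z = (\<Sum>b\<in>B. of_int (restrict c B b) *\<^sub>R b)"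
      unfolding c(1) by (intro sum.cong) auto
    ultimately show "z \<in> (\<lambda>c. \<Sum>b\<in>B. of_int (c b) *\<^sub>R b) ` (B \<rightarrow>\<^sub>E {- N..N})"
      by blast
  qed
  then show ?thesis
    by (rule finite_subset) (use fin in \<open>auto intro: finite_PiE\<close>)
qed

lemma rational_cone_line:
  assumes w: "w \<in> \<Lambda>" "w \<noteq> 0"
  shows "rational_cone \<Lambda> (span {w})"
proof -
  obtain B where lb: "lattice_basis \<Lambda> B" and B: "independent B" "span B = UNIV"
    using full_rank by (auto simp: full_rank_lattice_def lattice_basis_def)
  have fin: "finite B"
    using B(1) by (simp add: independent_imp_finite)
  let ?r = "\<lambda>x b. representation B x b"
  have lin: "linear (\<lambda>x. ?r x b)" for b
    using bounded_linear_representation[OF B] by (simp add: bounded_linear.linear)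
  obtain c :: "'a \<Rightarrow> int" where c: "w = (\<Sum>b\<in>B. of_int (c b) *\<^sub>R b)"
      "\<And>b. b \<in> B \<Longrightarrow> ?r w b = of_int (c b)"
    using representation_lattice[OF lb w(1)] by blast
  define \<phi> where "\<phi> = (\<lambda>(b, b') x. of_int (c b') * ?r x b - of_int (c b) * ?r x b')"
  have lin\<phi>: "linear (\<phi> i)" for i
    by (rule linearI)
      (simp_all add: \<phi>_def split_def linear_add[OF lin] linear_cmul[OF lin] algebra_simps)
  have "span {w} = {x. \<forall>\<psi>\<in>\<phi> ` (B \<times> B). \<psi> x \<le> 0}"
  proof
    have "\<phi> i (s *\<^sub>R w) \<le> 0" if "i \<in> B \<times> B" for i s
    proof -
      have "\<phi> i w = 0"
        using that by (auto simp: \<phi>_def c(2))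
      then show ?thesis
        by (simp add: linear_cmul[OF lin\<phi>])
    qed
    then show "span {w} \<subseteq> {x. \<forall>\<psi>\<in>\<phi> ` (B \<times> B). \<psi> x \<le> 0}"
      by (auto simp: span_singleton)
    show "{x. \<forall>\<psi>\<in>\<phi> ` (B \<times> B). \<psi> x \<le> 0} \<subseteq> span {w}"
    proof
      fix x assume "x \<in> {x. \<forall>\<psi>\<in>\<phi> ` (B \<times> B). \<psi> x \<le> 0}"
      have le: "of_int (c b') * ?r x b \<le> of_int (c b) * ?r x b'" if "b \<in> B" "b' \<in> B" for b b'
      proof -
        have "\<phi> (b, b') \<in> \<phi> ` (B \<times> B)"
          using that by blast
        then have "\<phi> (b, b') x \<le> 0"
          using \<open>x \<in> _\<close> by blast
        then show ?thesis
          by (simp add: \<phi>_def)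
      qed
      have eq: "of_int (c b') * ?r x b = of_int (c b) * ?r x b'" if "b \<in> B" "b' \<in> B" for b b'
        using le[OF that] le[OF that(2,1)] by linarith
      have "\<exists>b\<in>B. c b \<noteq> 0"
      proof (rule ccontr)
        assume "\<not> ?thesis"
        then have "w = 0"
          using c(1) by simp
        then show False
          using w(2) by simp
      qed
      then obtain b0 where b0: "b0 \<in> B" "c b0 \<noteq> 0"
        by blast
      have "x = (\<Sum>b\<in>B. ?r x b *\<^sub>R b)"
        using sum_representation_eq[OF B(1) _ fin order_refl, of x] B(2) by simp
      also have "\<dots> = (\<Sum>b\<in>B. (?r x b0 / of_int (c b0)) *\<^sub>R (of_int (c b) *\<^sub>R b))"
      proof (intro sum.cong refl)
        fix b assume b: "b \<in> B"
        have "?r x b = ?r x b0 / of_int (c b0) * of_int (c b)"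
          using eq[OF b b0(1)] b0(2) by (simp add: field_simps)
        then show "?r x b *\<^sub>R b = (?r x b0 / of_int (c b0)) *\<^sub>R (of_int (c b) *\<^sub>R b)"
          by simp
      qed
      also have "\<dots> = (?r x b0 / of_int (c b0)) *\<^sub>R w"
        unfolding c(1) by (simp add: scaleR_sum_right)
      finally show "x \<in> span {w}"
        by (auto simp: span_singleton)
    qed
  qed
  moreover have "\<psi> b \<in> \<rat>" if "\<psi> \<in> \<phi> ` (B \<times> B)" "b \<in> B" for \<psi> b
    using that by (auto simp: \<phi>_def representation_basis[OF B(1)])
  ultimately show ?thesis
    using lb fin lin\<phi> unfolding rational_cone_def
    by (intro exI[of _ B] exI[of _ "\<phi> ` (B \<times> B)"]) auto
qed

text \<open>By the standing assumption, applied to the line through \<open>w\<close>, lattice vectors span the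
hyperplane orthogonal to \<open>w\<close>. Reduce the multiples \<open>m x\<close> modulo these vectors and modulo \<open>w\<close> to
lattice points in a fixed ball. Two multiples reduce to the same point, so some nonzero multiple of
\<open>x\<close> is an integral multiple of \<open>w\<close> up to a vector orthogonal to \<open>w\<close>.\<close>

lemma inner_lattice_rational:
  assumes w: "w \<in> \<Lambda>" "w \<noteq> 0" and x: "x \<in> \<Lambda>"
  shows "(x \<bullet> w) / (w \<bullet> w) \<in> \<rat>"
proof -
  let ?C = "span {w}"
  let ?a = "(x \<bullet> w) / (w \<bullet> w)"
  have ww: "w \<bullet> w \<noteq> 0"
    using w(2) by simp
  obtain d where d: "\<And>\<tau>. \<tau> \<in> T ?C \<Longrightarrow> norm \<tau> \<le> d"
    using bounded_T[of ?C] by (auto simp: bounded_iff)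
  have "\<exists>y. y \<in> \<Lambda> \<and> norm y \<le> norm w + d \<and>
      (\<exists>k::int. y \<bullet> w = (real m * ?a - of_int k) * (w \<bullet> w))" for m
  proof -
    let ?p = "real m *\<^sub>R x - (real m * ?a) *\<^sub>R w"
    have "?p \<bullet> w = 0"
      using ww by (simp add: inner_diff_left)
    then have "?p \<in> orthogonal_comp ?C"
      by (auto simp: orthogonal_comp_def orthogonal_def span_singleton inner_commute)
    then obtain l \<tau> where l: "l \<in> L ?C" "\<tau> \<in> T ?C" "?p = l + \<tau>"
      using T_tiles[of ?p ?C] span_L[OF rational_cone_line[OF w]] by auto
    \<comment> \<open>Reduction of \<open>m x\<close>: the tile of the hyperplane absorbs the orthogonal part, the floor the rest.\<close>
    let ?k = "\<lfloor>real m * ?a\<rfloor>"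
    let ?y = "real m *\<^sub>R x - of_int ?k *\<^sub>R w - l"
    have y: "?y = frac (real m * ?a) *\<^sub>R w + \<tau>"
      using l(3) by (simp add: frac_def algebra_simps)
    have scale: "of_int k *\<^sub>R w \<in> \<Lambda>" for k :: int
    proof (cases "k \<ge> 0")
      case True
      then show ?thesis
        using lattice_scale_nat[OF w(1), of "nat k"] by simp
    next
      case False
      then show ?thesis
        using lattice_diff[OF lattice_zero lattice_scale_nat[OF w(1), of "nat (- k)"]] by simp
    qed
    have "?y \<in> \<Lambda>"
      using lattice_diff[OF lattice_diff[OF lattice_scale_nat[OF x] scale]] l(1)
      by (simp add: mem_L_iff)
    moreover have "norm ?y \<le> norm w + d"
    proof -
      have "norm ?y \<le> norm (frac (real m * ?a) *\<^sub>R w) + norm \<tau>"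
        unfolding y by (rule norm_triangle_ineq)
      also have "norm (frac (real m * ?a) *\<^sub>R w) \<le> norm w"
        using frac_lt_1[of "real m * ?a"] frac_ge_0[of "real m * ?a"]
        by (simp add: mult_left_le_one_le)
      finally show ?thesis
        using d[OF l(2)] by simp
    qed
    moreover have "l \<bullet> w = 0"
      using l(1) span_base[of w "{w}"] by (simp add: mem_L_iff)
    then have "?y \<bullet> w = (real m * ?a - of_int ?k) * (w \<bullet> w)"
      using ww by (simp add: inner_diff_left left_diff_distrib)
    ultimately show ?thesis
      by blast
  qed
  then obtain y where y: "\<And>m. y m \<in> {z \<in> \<Lambda>. norm z \<le> norm w + d}"
      "\<And>m. \<exists>k::int. y m \<bullet> w = (real m * ?a - of_int k) * (w \<bullet> w)"
    by (metis (mono_tags, lifting) mem_Collect_eq)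
  have "\<not> inj y"
  proof
    assume "inj y"
    moreover have "finite (range y)"
      by (rule finite_subset[OF _ finite_lattice_points[of "norm w + d"]]) (use y(1) in blast)
    ultimately show False
      using finite_imageD[of y UNIV] by simp
  qed
  then obtain m m' where m: "y m = y m'" "m \<noteq> m'"
    by (auto simp: inj_on_def)
  obtain k k' :: int where k: "y m \<bullet> w = (real m * ?a - of_int k) * (w \<bullet> w)"
      "y m' \<bullet> w = (real m' * ?a - of_int k') * (w \<bullet> w)"
    using y(2) by blast
  then have "real m * ?a - of_int k = real m' * ?a - of_int k'"
    using m(1) ww by simp
  then have "(real m - real m') * ?a = of_int k - of_int k'"
    unfolding left_diff_distrib by linarith
  then have "?a = (of_int k - of_int k') / (real m - real m')"
    using m(2) by (simp add: eq_divide_eq mult.commute)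
  then show ?thesis
    by simp
qed

text \<open>Dividing the inequality of \<open>w\<close> by \<open>w \<bullet> w\<close> makes its coefficients rational. (For \<open>w = 0\<close> both
sides vanish, by the convention on division by zero.)\<close>

lemma rational_cone_lattice_inequalities:
  assumes "finite W" "W \<subseteq> \<Lambda>"
  shows "rational_cone \<Lambda> {a. \<forall>w\<in>W. a \<bullet> w \<le> 0}"
proof -
  obtain B where lb: "lattice_basis \<Lambda> B"
    using full_rank by (auto simp: full_rank_lattice_def)
  define \<phi> where "\<phi> w a = (a \<bullet> w) / (w \<bullet> w)" for w a :: 'a
  have sign: "\<phi> w a \<le> 0 \<longleftrightarrow> a \<bullet> w \<le> 0" for w a
  proof (cases "w = 0")
    case False
    then have "0 < w \<bullet> w"
      by simp
    then show ?thesis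
      by (simp add: \<phi>_def pos_divide_le_eq)
  qed (simp add: \<phi>_def)
  have "linear (\<phi> w)" for w
    by (rule linearI) (auto simp: \<phi>_def inner_add_left add_divide_distrib)
  moreover have "\<phi> w b \<in> \<rat>" if "w \<in> W" "b \<in> B" for w b
    using inner_lattice_rational[of w b] lattice_basis_subset[OF lb] that assms(2)
    by (cases "w = 0") (auto simp: \<phi>_def)
  moreover have "{a. \<forall>w\<in>W. a \<bullet> w \<le> 0} = {a. \<forall>\<psi>\<in>\<phi> ` W. \<psi> a \<le> 0}"
    by (simp add: sign)
  ultimately show ?thesis
    using lb assms(1) unfolding rational_cone_def
    by (intro exI[of _ B] exI[of _ "\<phi> ` W"]) auto
qed

end


section \<open>Normal cones of a lattice polytope\<close>

text \<open>The segment from \<open>w\<close> to \<open>s\<close> can be prolonged a little beyond \<open>s\<close> inside \<open>f\<close>; if \<open>a\<close> were smaller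
at \<open>w\<close>, it would exceed its maximum on the prolongation.\<close>

lemma inner_maximal_at_rel_interior:
  fixes f :: "'a::euclidean_space set"
  assumes "convex f" "s \<in> rel_interior f" "\<And>w. w \<in> f \<Longrightarrow> a \<bullet> w \<le> a \<bullet> s" "w \<in> f"
  shows "a \<bullet> w = a \<bullet> s"
proof -
  have "w \<in> affine hull f"
    using assms(4) by (simp add: hull_inc)
  then obtain m where m: "m > 1" "\<And>e. e > 1 \<Longrightarrow> e \<le> m \<Longrightarrow> (1 - e) *\<^sub>R w + e *\<^sub>R s \<in> f"
    using convex_rel_interior_if[OF assms(1,2)] by blast
  then have "(1 - m) *\<^sub>R w + m *\<^sub>R s \<in> f"
    by simp
  then have "(1 - m) * (a \<bullet> w) + m * (a \<bullet> s) \<le> a \<bullet> s"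
    using assms(3) by (fastforce simp: inner_add_right)
  then have "(m - 1) * (a \<bullet> s) \<le> (m - 1) * (a \<bullet> w)"
    by (simp add: algebra_simps)
  then have "a \<bullet> s \<le> a \<bullet> w"
    using m(1) by simp
  then show ?thesis
    using assms(3)[OF assms(4)] by simp
qed

locale lattice_polytope_tiles = lattice_tiles +
  fixes P :: "'a set"
  assumes lattice_polytope: "lattice_polytope \<Lambda> P"
    and full_dim: "aff_dim P = int DIM('a)"
begin

abbreviation "N \<equiv> normal_cone P"

definition "V = {v. v extreme_point_of P}"

definition "pface f \<longleftrightarrow> f face_of P \<and> f \<noteq> {}"

lemma polytope_P: "polytope P"
  using lattice_polytope by (auto simp: lattice_polytope_def polytope_def)

lemma compact_P: "compact P" and convex_P: "convex P"
  using polytope_P by (auto simp: polytope_imp_compact polytope_imp_convex)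

lemma P_nonempty: "P \<noteq> {}"
  using full_dim by auto

lemma hull_V: "P = convex hull V"
  using Krein_Milman_Minkowski[OF compact_P convex_P] by (simp add: V_def)

lemma V_lattice: "V \<subseteq> \<Lambda>"
  and finite_V: "finite V"
proof -
  obtain S where S: "finite S" "S \<subseteq> \<Lambda>" "P = convex hull S"
    using lattice_polytope by (auto simp: lattice_polytope_def)
  have "V \<subseteq> S"
    unfolding V_def unfolding S(3) using extreme_point_of_convex_hull by auto
  then show "V \<subseteq> \<Lambda>" "finite V"
    using S finite_subset by auto
qed

lemma V_subset: "V \<subseteq> P"
  by (auto simp: V_def extreme_point_of_def)

lemma pface_P: "pface P"
  using P_nonempty convex_P face_of_refl by (auto simp: pface_def)

lemma pface_vertex: "v \<in> V \<Longrightarrow> pface {v}"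
  by (simp add: V_def pface_def face_of_singleton)

lemma pface_subset: "pface f \<Longrightarrow> f \<subseteq> P"
  by (auto simp: pface_def dest: face_of_imp_subset)

lemma pface_convex: "pface f \<Longrightarrow> convex f"
  and pface_compact: "pface f \<Longrightarrow> compact f"
  using face_of_imp_convex face_of_imp_compact[OF convex_P compact_P] by (auto simp: pface_def)

lemma extreme_point_of_pface: "pface f \<Longrightarrow> v extreme_point_of f \<longleftrightarrow> v \<in> V \<inter> f"
  by (auto simp: pface_def V_def extreme_point_of_face)

lemma hull_V_pface: "pface f \<Longrightarrow> f = convex hull (V \<inter> f)"
  using Krein_Milman_Minkowski[OF pface_compact pface_convex, of f] extreme_point_of_pface[of f]
  by (metis (no_types, lifting) Collect_cong Collect_mem_eq)

lemma pface_has_vertex: "pface f \<Longrightarrow> V \<inter> f \<noteq> {}"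
  using hull_V_pface[of f] by (auto simp: pface_def)

lemma pface_Int: "pface f \<Longrightarrow> pface g \<Longrightarrow> f \<inter> g \<noteq> {} \<Longrightarrow> pface (f \<inter> g)"
  by (simp add: pface_def face_of_Int)

lemma finite_pfaces: "finite {f. pface f}"
  by (rule finite_subset[OF _ finite_polyhedron_faces[OF polytope_imp_polyhedron[OF polytope_P]]])
    (auto simp: pface_def)

lemma max_over_P_iff: "(\<forall>y\<in>P. a \<bullet> y \<le> b) \<longleftrightarrow> (\<forall>y\<in>V. a \<bullet> y \<le> b)"
proof
  assume "\<forall>y\<in>V. a \<bullet> y \<le> b"
  then have "convex hull V \<subseteq> {y. a \<bullet> y \<le> b}"
    by (intro hull_minimal) (auto simp: convex_halfspace_le)
  then show "\<forall>y\<in>P. a \<bullet> y \<le> b"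
    using hull_V by auto
qed (use V_subset in auto)

lemma mem_N_rel_interior:
  assumes f: "pface f" and s: "s \<in> rel_interior f"
  shows "a \<in> N f \<longleftrightarrow> (\<forall>y\<in>P. a \<bullet> y \<le> a \<bullet> s)"
proof
  assume "a \<in> N f"
  then show "\<forall>y\<in>P. a \<bullet> y \<le> a \<bullet> s"
    using s by (auto simp: normal_cone_def inner_diff_right)
next
  assume max: "\<forall>y\<in>P. a \<bullet> y \<le> a \<bullet> s"
  have "a \<bullet> w = a \<bullet> s" if "w \<in> rel_interior f" for w
  proof (rule inner_maximal_at_rel_interior[OF pface_convex[OF f] s])
    show "w \<in> f"
      using that rel_interior_subset by blast
  qed (use max pface_subset[OF f] in auto)
  then show "a \<in> N f"
    using max by (auto simp: normal_cone_def inner_diff_right)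
qed

lemma rel_interior_pface: "pface f \<Longrightarrow> rel_interior f \<noteq> {}"
  using rel_interior_eq_empty[OF pface_convex] by (auto simp: pface_def)

lemma mem_N_iff:
  assumes f: "pface f"
  shows "a \<in> N f \<longleftrightarrow> (\<forall>w\<in>f. \<forall>y\<in>P. a \<bullet> y \<le> a \<bullet> w)"
proof -
  obtain s where s: "s \<in> rel_interior f"
    using rel_interior_pface[OF f] by blast
  then have sf: "s \<in> f"
    using rel_interior_subset by blast
  show ?thesis
    unfolding mem_N_rel_interior[OF f s]
  proof
    assume max: "\<forall>y\<in>P. a \<bullet> y \<le> a \<bullet> s"
    have "a \<bullet> w = a \<bullet> s" if "w \<in> f" for w
      by (rule inner_maximal_at_rel_interior[OF pface_convex[OF f] s _ that])
        (use max pface_subset[OF f] in auto)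
    then show "\<forall>w\<in>f. \<forall>y\<in>P. a \<bullet> y \<le> a \<bullet> w"
      using max by simp
  qed (use sf in blast)
qed

lemma N_vertex_iff: "v \<in> V \<Longrightarrow> a \<in> N {v} \<longleftrightarrow> (\<forall>y\<in>P. a \<bullet> y \<le> a \<bullet> v)"
  using mem_N_iff[OF pface_vertex] by simp

lemma N_const: "pface f \<Longrightarrow> a \<in> N f \<Longrightarrow> w \<in> f \<Longrightarrow> w' \<in> f \<Longrightarrow> a \<bullet> w = a \<bullet> w'"
  using mem_N_iff[of f a] pface_subset[of f] by (meson order_antisym subsetD)

lemma mem_N_iff_vertices:
  assumes f: "pface f"
  shows "a \<in> N f \<longleftrightarrow> (\<forall>v\<in>V \<inter> f. \<forall>y\<in>V. a \<bullet> y \<le> a \<bullet> v)"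
proof
  assume *: "\<forall>v\<in>V \<inter> f. \<forall>y\<in>V. a \<bullet> y \<le> a \<bullet> v"
  have "a \<bullet> y \<le> a \<bullet> w" if "y \<in> V" "w \<in> f" for y w
  proof -
    have "convex hull (V \<inter> f) \<subseteq> {w. a \<bullet> w \<ge> a \<bullet> y}"
      using * that by (intro hull_minimal) (auto simp: convex_halfspace_ge)
    then show ?thesis
      using that hull_V_pface[OF f] by blast
  qed
  then show "a \<in> N f"
    unfolding mem_N_iff[OF f] by (simp add: max_over_P_iff)
qed (use V_subset mem_N_iff[OF f] in blast)

text \<open>Finitely many inequalities given by differences of lattice points describe \<open>N f\<close>; a line in \<open>N f\<close>
would put \<open>P\<close> into a hyperplane.\<close>

lemma pcone_N:
  assumes f: "pface f"
  shows "pcone (N f)"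
proof -
  let ?W = "(\<lambda>(y, v). y - v) ` (V \<times> (V \<inter> f))"
  have "N f = {a. \<forall>w\<in>?W. a \<bullet> w \<le> 0}"
    using mem_N_iff_vertices[OF f] by (auto simp: inner_diff_right)
  moreover have "finite ?W" "?W \<subseteq> \<Lambda>"
    using finite_V V_lattice lattice_diff by auto
  ultimately have "rational_cone \<Lambda> (N f)"
    using rational_cone_lattice_inequalities[of ?W] by simp
  moreover have "pointed (N f)"
    unfolding pointed_def
  proof (intro allI impI)
    fix S assume S: "subspace S \<and> S \<subseteq> N f"
    obtain w where w: "w \<in> f"
      using f by (auto simp: pface_def)
    have "a = 0" if a: "a \<in> S" for a
    proof (rule ccontr)
      assume "a \<noteq> 0"
      have "- a \<in> S"
        using S a subspace_neg by blast
      then have "a \<in> N f" "- a \<in> N f"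
        using S a by auto
      then have "a \<bullet> y \<le> a \<bullet> w" "- a \<bullet> y \<le> - a \<bullet> w" if "y \<in> P" for y
        using mem_N_iff[OF f] w that by blast+
      then have "P \<subseteq> {y. a \<bullet> y = a \<bullet> w}"
        by force
      then have "aff_dim P \<le> aff_dim {y. a \<bullet> y = a \<bullet> w}"
        by (rule aff_dim_subset)
      then show False
        using full_dim \<open>a \<noteq> 0\<close> by simp
    qed
    then show "S = {0}"
      using S subspace_0 by blast
  qed
  ultimately show ?thesis
    by (simp add: pcone_def)
qed

lemma finite_vertex_rays: "finite (SIGMA v:V. ray_dirs (N {v}))"
proof (rule finite_SigmaI[OF finite_V])
  fix v assume "v \<in> V"
  then have "pcone (N {v})"
    using pcone_N[OF pface_vertex] by blast
  then show "finite (ray_dirs (N {v}))"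
    using finite_ray_dirs pcone_conic pcone_pointed pcone_polyhedron by blast
qed

lemma N_nonempty: "pface f \<Longrightarrow> N f \<noteq> {}"
  using pcone_zero_mem[OF pcone_N] by blast

text \<open>On \<open>N f\<close>, no point of \<open>P\<close> gives a larger value than \<open>f\<close>, and the members of \<open>N g\<close> are those which
attain this maximum at a relatively interior point of \<open>g\<close>.\<close>

lemma N_Int_face:
  assumes f: "pface f" and g: "pface g"
  shows "N f \<inter> N g face_of N f"
proof -
  obtain s where s: "s \<in> rel_interior g"
    using rel_interior_pface[OF g] by blast
  then have sg: "s \<in> g"
    using rel_interior_subset by blast
  then have sP: "s \<in> P"
    using pface_subset[OF g] by blast
  obtain w where w: "w \<in> f"
    using f by (auto simp: pface_def)
  then have wP: "w \<in> P"
    using pface_subset[OF f] by blast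
  have "N f \<inter> N g = N f \<inter> {a. (s - w) \<bullet> a = 0}"
  proof (intro set_eqI iffI)
    fix a assume "a \<in> N f \<inter> N g"
    then have "a \<bullet> s \<le> a \<bullet> w" "a \<bullet> w \<le> a \<bullet> s" "a \<in> N f"
      using mem_N_iff[OF f] mem_N_iff[OF g] w sg wP sP by blast+
    then show "a \<in> N f \<inter> {a. (s - w) \<bullet> a = 0}"
      by (simp add: inner_diff_left inner_diff_right inner_commute)
  next
    fix a assume a: "a \<in> N f \<inter> {a. (s - w) \<bullet> a = 0}"
    then have "a \<bullet> s = a \<bullet> w"
      by (simp add: inner_diff_left inner_diff_right inner_commute)
    moreover have "\<forall>y\<in>P. a \<bullet> y \<le> a \<bullet> w"
      using a w mem_N_iff[OF f] by blast
    ultimately show "a \<in> N f \<inter> N g"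
      using a mem_N_rel_interior[OF g s] by simp
  qed
  moreover have "(N f \<inter> {a. (s - w) \<bullet> a = 0}) face_of N f"
  proof (rule face_of_Int_supporting_hyperplane_le)
    show "convex (N f)"
      using pcone_convex[OF pcone_N[OF f]] .
    fix a assume "a \<in> N f"
    then have "a \<bullet> s \<le> a \<bullet> w"
      using mem_N_iff[OF f] w sP by blast
    then show "(s - w) \<bullet> a \<le> 0"
      by (simp add: inner_diff_left inner_diff_right inner_commute)
  qed
  ultimately show ?thesis
    by simp
qed

lemma N_antimono: "pface f \<Longrightarrow> pface g \<Longrightarrow> f \<subseteq> g \<Longrightarrow> N g \<subseteq> N f"
  using mem_N_iff by (meson subsetD subsetI)

lemma N_face_of_N:
  assumes "pface f" "pface g" "f \<subseteq> g"
  shows "N g face_of N f"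
proof -
  have "N f \<inter> N g = N g"
    using N_antimono[OF assms] by blast
  then show ?thesis
    using N_Int_face[OF assms(1,2)] by simp
qed

text \<open>Faces of polytopes are exposed, so \<open>f\<close> is recovered from a single functional in \<open>N f\<close>.\<close>

lemma N_subset_imp:
  assumes f: "pface f" and g: "pface g" and le: "N f \<subseteq> N g"
  shows "g \<subseteq> f"
proof -
  have "f exposed_face_of P"
    using f exposed_face_of_polyhedron[OF polytope_imp_polyhedron[OF polytope_P]]
    by (simp add: pface_def)
  then obtain a b where ab: "P \<subseteq> {x. a \<bullet> x \<le> b}" "f = P \<inter> {x. a \<bullet> x = b}"
    unfolding exposed_face_of_def by blast
  then have "a \<in> N f"
    unfolding mem_N_iff[OF f] by auto
  then have a: "a \<in> N g"
    using le by blast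
  obtain w where "w \<in> f"
    using f by (auto simp: pface_def)
  then have w: "w \<in> P" "a \<bullet> w = b"
    using ab by auto
  show "g \<subseteq> f"
  proof
    fix y assume y: "y \<in> g"
    then have "y \<in> P"
      using pface_subset[OF g] by blast
    moreover have "b \<le> a \<bullet> y"
      using a y w mem_N_iff[OF g] by metis
    ultimately show "y \<in> f"
      using ab by auto
  qed
qed

lemma N_inj: "pface f \<Longrightarrow> pface g \<Longrightarrow> N f = N g \<Longrightarrow> f = g"
  using N_subset_imp by (metis order_antisym order_refl)

text \<open>Take \<open>a\<close> in the relative interior of \<open>J\<close> and let \<open>g\<close> be the face of \<open>P\<close> on which \<open>a\<close> is maximal.
Every \<open>b \<in> N g\<close> is a summand of \<open>a\<close>, up to scaling: \<open>a - e b\<close> remains in \<open>N f\<close> for small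
\<open>e\<close>, since the vertices outside \<open>g\<close> are strictly below the maximum of \<open>a\<close>.\<close>

lemma face_of_normal_cone_is_normal_cone:
  assumes f: "pface f" and J: "J face_of N f" "J \<noteq> {}"
  obtains g where "pface g" "f \<subseteq> g" "J = N g"
proof -
  note cN = pcone_conic[OF pcone_N[OF f]]
  have cJ: "conic J" "convex J"
    using conic_face[OF J(1) cN] face_of_imp_convex[OF J(1)] .
  obtain a where a: "a \<in> rel_interior J"
    using rel_interior_eq_empty[OF cJ(2)] J(2) by blast
  then have aJ: "a \<in> J" and aN: "a \<in> N f"
    using rel_interior_subset face_of_imp_subset[OF J(1)] by blast+
  obtain s where s: "s \<in> f"
    using f by (auto simp: pface_def)
  then have sP: "s \<in> P"
    using pface_subset[OF f] by blast
  have max: "a \<bullet> y \<le> a \<bullet> w" if "y \<in> P" "w \<in> f" for y w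
    using aN mem_N_iff[OF f] that by blast
  define g where "g = P \<inter> {y. a \<bullet> y = a \<bullet> s}"
  have fg: "f \<subseteq> g"
    using N_const[OF f aN _ s] pface_subset[OF f] by (auto simp: g_def)
  have g: "pface g"
    unfolding pface_def g_def
    using face_of_Int_supporting_hyperplane_le[OF convex_P max[OF _ s]] sP by auto
  have ag: "a \<in> N g"
    unfolding mem_N_iff[OF g] using max[OF _ s] by (auto simp: g_def)
  have "J \<subseteq> N g"
    using subset_of_face_of[OF N_face_of_N[OF f g fg] face_of_imp_subset[OF J(1)]] a ag by blast
  moreover have "N g \<subseteq> J"
  proof
    fix b assume b: "b \<in> N g"
    have "\<forall>i\<in>V \<times> (V \<inter> f). \<forall>\<^sub>F e in at_right 0.
      (a - e *\<^sub>R b) \<bullet> fst i \<le> (a - e *\<^sub>R b) \<bullet> snd i"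
    proof
      fix i assume i: "i \<in> V \<times> (V \<inter> f)"
      then obtain y v where yv: "i = (y, v)" "y \<in> V" "v \<in> V" "v \<in> f"
        by auto
      have yP: "y \<in> P"
        using yv V_subset by blast
      show "\<forall>\<^sub>F e in at_right 0. (a - e *\<^sub>R b) \<bullet> fst i \<le> (a - e *\<^sub>R b) \<bullet> snd i"
      proof (cases "y \<in> g")
        case True
        have "a \<bullet> y = a \<bullet> v" "b \<bullet> y = b \<bullet> v"
          using N_const[OF g ag True] N_const[OF g b True] yv fg by auto
        then show ?thesis
          by (simp add: yv inner_diff_left)
      next
        case False
        have "a \<bullet> v = a \<bullet> s"
          using N_const[OF f aN yv(4) s] .
        moreover have "a \<bullet> y \<noteq> a \<bullet> s"
          using False yP by (simp add: g_def)
        ultimately have "a \<bullet> y - 0 * (b \<bullet> y) < a \<bullet> v - 0 * (b \<bullet> v)"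
          using max[OF yP s] by simp
        moreover have "((\<lambda>e. (a \<bullet> v - e * (b \<bullet> v)) - (a \<bullet> y - e * (b \<bullet> y))) \<longlongrightarrow>
            (a \<bullet> v - 0 * (b \<bullet> v)) - (a \<bullet> y - 0 * (b \<bullet> y))) (at_right 0)"
          by (intro tendsto_intros)
        ultimately have "\<forall>\<^sub>F e in at_right 0. 0 < (a \<bullet> v - e * (b \<bullet> v)) - (a \<bullet> y - e * (b \<bullet> y))"
          by (intro order_tendstoD(1)) auto
        then show ?thesis
          by (rule eventually_mono) (simp add: yv inner_diff_left)
      qed
    qed
    then have "\<forall>\<^sub>F e in at_right 0. \<forall>i\<in>V \<times> (V \<inter> f).
        (a - e *\<^sub>R b) \<bullet> fst i \<le> (a - e *\<^sub>R b) \<bullet> snd i"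
      using finite_V by (intro eventually_ball_finite) auto
    moreover have "\<forall>\<^sub>F e::real in at_right 0. e > 0"
      by (rule eventually_at_right_less)
    ultimately have "\<forall>\<^sub>F e in at_right 0. e > 0 \<and> (\<forall>i\<in>V \<times> (V \<inter> f).
        (a - e *\<^sub>R b) \<bullet> fst i \<le> (a - e *\<^sub>R b) \<bullet> snd i)"
      by (rule eventually_conj[rotated])
    then obtain e :: real where e: "e > 0"
        "\<forall>i\<in>V \<times> (V \<inter> f). (a - e *\<^sub>R b) \<bullet> fst i \<le> (a - e *\<^sub>R b) \<bullet> snd i"
      using eventually_happens'[OF trivial_limit_at_right_real] by blast
    have diff: "a - e *\<^sub>R b \<in> N f"
      unfolding mem_N_iff_vertices[OF f] using e(2) by fastforce
    have bN: "b \<in> N f"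
      using b N_antimono[OF f g fg] by blast
    have "e *\<^sub>R b \<in> J"
    proof (rule face_of_conic_summand[OF J(1) cN])
      show "e *\<^sub>R b \<in> N f"
        using conicD[OF cN bN, of e] e(1) by simp
      show "a - e *\<^sub>R b \<in> N f"
        by (rule diff)
      show "e *\<^sub>R b + (a - e *\<^sub>R b) \<in> J"
        using aJ by simp
    qed
    then show "b \<in> J"
      using conicD[OF cJ(1), of "e *\<^sub>R b" "inverse e"] e(1) by simp
  qed
  ultimately show ?thesis
    using that[OF g fg] by blast
qed

text \<open>A functional separating \<open>y\<close> from \<open>P\<close> attains its maximum over \<open>P\<close> at a vertex, so it lies in the
normal cone of that vertex.\<close>

lemma mem_P_iff_cones: "y \<in> P \<longleftrightarrow> (\<forall>v\<in>V. y - v \<in> polar_cone (N {v}))"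
proof
  assume y: "y \<in> P"
  show "\<forall>v\<in>V. y - v \<in> polar_cone (N {v})"
    using y N_vertex_iff by (auto simp: polar_cone_def inner_diff_left inner_diff_right inner_commute)
next
  assume *: "\<forall>v\<in>V. y - v \<in> polar_cone (N {v})"
  show "y \<in> P"
  proof (rule ccontr)
    assume "y \<notin> P"
    then obtain a b where ab: "a \<bullet> y < b" "\<And>x. x \<in> P \<Longrightarrow> b < a \<bullet> x"
      using separating_hyperplane_closed_point[OF convex_P compact_imp_closed[OF compact_P]] by blast
    have "V \<noteq> {}"
      using pface_has_vertex[OF pface_P] by blast
    then obtain v where v: "v \<in> V" "\<And>x. x \<in> V \<Longrightarrow> a \<bullet> v \<le> a \<bullet> x"
      using finite_V arg_min_if_finite[of V "\<lambda>x. a \<bullet> x"] by (metis not_le)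
    have "\<forall>x\<in>P. - a \<bullet> x \<le> - a \<bullet> v"
      unfolding max_over_P_iff using v by simp
    then have "- a \<in> N {v}"
      using N_vertex_iff[OF v(1)] by blast
    then have "(y - v) \<bullet> - a \<le> 0"
      using * v(1) unfolding polar_cone_def by blast
    then have "a \<bullet> v \<le> a \<bullet> y"
      by (simp add: inner_diff_left inner_diff_right inner_commute)
    moreover have "v \<in> P"
      using v(1) V_subset by blast
    ultimately show False
      using ab(1) ab(2)[of v] by simp
  qed
qed

lemma mem_pface_if_perp:
  assumes f: "pface f" and y: "y \<in> P" and v: "v \<in> V \<inter> f"
    and perp: "\<And>a. a \<in> N f \<Longrightarrow> (y - v) \<bullet> a = 0"
  shows "y \<in> f"
proof -
  have "f exposed_face_of P"
    using f exposed_face_of_polyhedron[OF polytope_imp_polyhedron[OF polytope_P]]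
    by (simp add: pface_def)
  then obtain a b where ab: "P \<subseteq> {x. a \<bullet> x \<le> b}" "f = P \<inter> {x. a \<bullet> x = b}"
    unfolding exposed_face_of_def by blast
  then have "a \<in> N f"
    unfolding mem_N_iff[OF f] by auto
  then have "a \<bullet> y = a \<bullet> v"
    using perp by (simp add: inner_diff_left inner_diff_right inner_commute)
  then show ?thesis
    using ab y v by auto
qed

text \<open>The face \<open>f\<close> is the convex hull of its finitely many vertices, and at each of them \<open>u\<close> is strictly
below its maximum \<open>u \<bullet> v\<close> over \<open>P\<close>.\<close>

lemma gap_off_vertex_cones:
  assumes f: "pface f" and v: "v \<in> V" and u: "u \<in> N {v}"
    and out: "\<And>v'. v' \<in> V \<inter> f \<Longrightarrow> u \<notin> N {v'}"
  shows "\<exists>\<delta>>0. \<forall>w\<in>f. u \<bullet> w \<le> u \<bullet> v - \<delta>"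
proof -
  have lt: "u \<bullet> v' < u \<bullet> v" if v': "v' \<in> V \<inter> f" for v'
  proof -
    have "u \<bullet> v' \<le> u \<bullet> v"
      using u N_vertex_iff[OF v] v' V_subset by blast
    moreover have "u \<bullet> v' \<noteq> u \<bullet> v"
      using u out[OF v'] N_vertex_iff[OF v] N_vertex_iff[of v'] v' by auto
    ultimately show ?thesis
      by simp
  qed
  define m where "m = Max ((\<lambda>v'. u \<bullet> v') ` (V \<inter> f))"
  have fin: "finite ((\<lambda>v'. u \<bullet> v') ` (V \<inter> f))"
    using finite_V by simp
  have "m \<in> (\<lambda>v'. u \<bullet> v') ` (V \<inter> f)"
    unfolding m_def using pface_has_vertex[OF f] fin by (intro Max_in) auto
  then have "m < u \<bullet> v"
    using lt by auto
  moreover have "f \<subseteq> {w. u \<bullet> w \<le> m}"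
  proof -
    have "convex hull (V \<inter> f) \<subseteq> {w. u \<bullet> w \<le> m}"
      unfolding m_def using fin by (intro hull_minimal) (auto simp: convex_halfspace_le)
    then show ?thesis
      using hull_V_pface[OF f] by simp
  qed
  ultimately show ?thesis
    by (intro exI[of _ "u \<bullet> v - m"]) auto
qed

text \<open>Locally at \<open>f\<close> only the cones at vertices of \<open>f\<close> matter. Let \<open>w\<close> be the point of \<open>f\<close> closest to
\<open>y\<close>. A small step from \<open>w\<close> towards \<open>y\<close> violates no inequality of \<open>P\<close>: those that are tight at \<open>w\<close>
belong to a vertex of \<open>f\<close> and hold at \<open>y\<close> by assumption. The step stays orthogonal to \<open>N f\<close>, hence
in \<open>f\<close>, and it gets closer to \<open>y\<close> unless \<open>y = w\<close>.\<close>

lemma mem_pface_of_vertex_cones: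
  assumes f: "pface f"
    and perp: "\<And>v a. v \<in> V \<inter> f \<Longrightarrow> a \<in> N f \<Longrightarrow> (y - v) \<bullet> a = 0"
    and polar: "\<And>v. v \<in> V \<inter> f \<Longrightarrow> y - v \<in> polar_cone (N {v})"
  shows "y \<in> f"
proof -
  have fne: "f \<noteq> {}" and cl: "closed f"
    using f pface_compact compact_imp_closed by (auto simp: pface_def)
  define w where "w = closest_point f y"
  have w: "w \<in> f"
    unfolding w_def using closest_point_in_set[OF cl fne] .
  have wP: "w \<in> P"
    using w pface_subset[OF f] by blast
  define d where "d = y - w"
  have "\<forall>i\<in>(SIGMA v:V. ray_dirs (N {v})). \<forall>\<^sub>F e in at_right 0. (w + e *\<^sub>R d - fst i) \<bullet> snd i \<le> 0"
  proof
    fix i assume "i \<in> (SIGMA v:V. ray_dirs (N {v}))"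
    then obtain v u where i: "i = (v, u)" "v \<in> V" "u \<in> ray_dirs (N {v})"
      by auto
    then have u: "u \<in> N {v}"
      using ray_dirs_subset by blast
    have le: "u \<bullet> w \<le> u \<bullet> v"
      using u N_vertex_iff[OF i(2)] wP by blast
    show "\<forall>\<^sub>F e in at_right 0. (w + e *\<^sub>R d - fst i) \<bullet> snd i \<le> 0"
    proof (cases "u \<bullet> w = u \<bullet> v")
      case True
      have "\<exists>v'\<in>V \<inter> f. u \<in> N {v'}"
      proof (rule ccontr)
        assume "\<not> ?thesis"
        then obtain \<delta> where "\<delta> > 0" "\<forall>w\<in>f. u \<bullet> w \<le> u \<bullet> v - \<delta>"
          using gap_off_vertex_cones[OF f i(2) u] by blast
        then show False
          using True w by force
      qed
      then obtain v' where v': "v' \<in> V \<inter> f" "u \<in> N {v'}"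
        by blast
      have "(y - v') \<bullet> u \<le> 0"
        using polar[OF v'(1)] v'(2) by (simp add: polar_cone_def)
      moreover have "u \<bullet> w \<le> u \<bullet> v'" "u \<bullet> v \<le> u \<bullet> v'"
        using v' N_vertex_iff[of v'] wP i(2) V_subset by blast+
      moreover have "u \<bullet> v' \<le> u \<bullet> v"
        using u N_vertex_iff[OF i(2)] v'(1) V_subset by blast
      ultimately have "d \<bullet> u \<le> 0"
        using True by (simp add: d_def inner_diff_left inner_diff_right inner_commute)
      moreover have "(w - v) \<bullet> u = 0"
        using True by (simp add: inner_diff_left inner_diff_right inner_commute)
      then have "(w + e *\<^sub>R d - v) \<bullet> u = e * (d \<bullet> u)" for e
        by (simp add: inner_diff_left inner_add_left)
      ultimately have "(w + e *\<^sub>R d - v) \<bullet> u \<le> 0" if "e > 0" for e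
        using that by (simp add: mult_nonneg_nonpos)
      then show ?thesis
        using eventually_at_right_less[of "0::real"] by (auto simp: i(1) elim: eventually_mono)
    next
      case False
      then have "(w + 0 *\<^sub>R d - v) \<bullet> u < 0"
        using le by (simp add: inner_diff_left inner_diff_right inner_commute)
      moreover have "((\<lambda>e. (w + e *\<^sub>R d - v) \<bullet> u) \<longlongrightarrow> (w + 0 *\<^sub>R d - v) \<bullet> u) (at_right 0)"
        by (intro tendsto_intros)
      ultimately have "\<forall>\<^sub>F e in at_right 0. (w + e *\<^sub>R d - v) \<bullet> u < 0"
        by (intro order_tendstoD(2)) auto
      then show ?thesis
        by (rule eventually_mono) (simp add: i(1))
    qed
  qed
  then have "\<forall>\<^sub>F e in at_right 0. \<forall>i\<in>(SIGMA v:V. ray_dirs (N {v})).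
      (w + e *\<^sub>R d - fst i) \<bullet> snd i \<le> 0"
    by (rule eventually_ball_finite[OF finite_vertex_rays])
  moreover have "\<forall>\<^sub>F e::real in at_right 0. 0 < e"
    by (rule eventually_at_right_less)
  moreover have "\<forall>\<^sub>F e::real in at_right 0. e < 1"
    by (rule eventually_at_right_real[of 0 1, THEN eventually_mono]) auto
  ultimately have "\<forall>\<^sub>F e in at_right 0. 0 < e \<and> e < 1 \<and> (\<forall>i\<in>(SIGMA v:V. ray_dirs (N {v})).
      (w + e *\<^sub>R d - fst i) \<bullet> snd i \<le> 0)"
    by (intro eventually_conj)
  then obtain e :: real where e: "0 < e" "e < 1"
      "\<forall>i\<in>(SIGMA v:V. ray_dirs (N {v})). (w + e *\<^sub>R d - fst i) \<bullet> snd i \<le> 0"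
    using eventually_happens'[OF trivial_limit_at_right_real] by blast
  have "w + e *\<^sub>R d \<in> P"
    unfolding mem_P_iff_cones
  proof
    fix v assume v: "v \<in> V"
    show "w + e *\<^sub>R d - v \<in> polar_cone (N {v})"
      unfolding mem_polar_cone_iff_rays[OF pcone_N[OF pface_vertex[OF v]]] using e(3) v by auto
  qed
  moreover obtain v where v: "v \<in> V \<inter> f"
    using pface_has_vertex[OF f] by blast
  moreover have "(w + e *\<^sub>R d - v) \<bullet> a = 0" if a: "a \<in> N f" for a
  proof -
    have "(w - v) \<bullet> a = 0"
      using N_const[OF f a w, of v] v by (simp add: inner_diff_left inner_diff_right inner_commute)
    moreover have "(y - v) \<bullet> a = 0"
      using perp[OF v a] .
    ultimately have "d \<bullet> a = 0"
      by (simp add: d_def inner_diff_left)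
    with \<open>(w - v) \<bullet> a = 0\<close> show ?thesis
      by (simp add: inner_diff_left inner_add_left)
  qed
  ultimately have "w + e *\<^sub>R d \<in> f"
    using mem_pface_if_perp[OF f] by blast
  then have "dist y w \<le> dist y (w + e *\<^sub>R d)"
    unfolding w_def using closest_point_le[OF cl] by blast
  also have "dist y (w + e *\<^sub>R d) = norm ((1 - e) *\<^sub>R d)"
    by (simp add: dist_norm d_def algebra_simps)
  also have "\<dots> = (1 - e) * dist y w"
    using e by (simp add: dist_norm d_def)
  finally have "dist y w = 0"
    using e(1) by (simp add: left_diff_distrib mult_le_0_iff)
  then show ?thesis
    using w by simp
qed

text \<open>A Hoffman type error bound for the description of \<open>t f\<close> by the cones at its vertices: if all
inequalities hold up to \<open>c\<close>, the distance to \<open>t f\<close> is bounded independently of \<open>t\<close>. Shrinking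
\<open>y / t\<close> towards a relatively interior point \<open>z0\<close> of \<open>f\<close>, where all inequalities not forced to be
equations have slack at least \<open>\<delta>\<close>, removes the error \<open>c / t\<close> at the cost of a shift of order \<open>1 / t\<close>.\<close>

lemma near_face:
  assumes f: "pface f" and c: "0 \<le> c"
  shows "\<exists>B. \<forall>t\<ge>1. \<forall>y.
    (\<forall>v\<in>V \<inter> f. \<forall>a\<in>N f. (y - t *\<^sub>R v) \<bullet> a = 0) \<and>
    (\<forall>v\<in>V \<inter> f. \<forall>u\<in>ray_dirs (N {v}). (y - t *\<^sub>R v) \<bullet> u \<le> c) \<longrightarrow>
    (\<exists>z\<in>f. norm (y - t *\<^sub>R z) \<le> B)"
proof -
  obtain z0 where z0: "z0 \<in> rel_interior f"
    using rel_interior_pface[OF f] by blast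
  then have z0f: "z0 \<in> f"
    using rel_interior_subset by blast
  then have z0P: "z0 \<in> P"
    using pface_subset[OF f] by blast
  define A where "A = {(v, u). v \<in> V \<inter> f \<and> u \<in> ray_dirs (N {v}) \<and> u \<notin> N f}"
  have finA: "finite A"
  proof -
    have "A \<subseteq> (SIGMA v:V. ray_dirs (N {v}))"
      by (auto simp: A_def)
    then show ?thesis
      by (rule finite_subset[OF _ finite_vertex_rays])
  qed
  define \<delta> where "\<delta> = Min (insert 1 ((\<lambda>(v, u). (v - z0) \<bullet> u) ` A))"
  have pos: "(v - z0) \<bullet> u > 0" if vu: "v \<in> V \<inter> f" "u \<in> ray_dirs (N {v})" "u \<notin> N f" for v u
  proof -
    have u: "\<forall>y\<in>P. u \<bullet> y \<le> u \<bullet> v"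
      using vu N_vertex_iff[of v u] ray_dirs_subset by blast
    have "u \<bullet> z0 \<noteq> u \<bullet> v"
      using vu(3) u mem_N_rel_interior[OF f z0] by auto
    then have "u \<bullet> z0 < u \<bullet> v"
      using u z0P by force
    then show ?thesis
      by (simp add: inner_diff_left inner_diff_right inner_commute)
  qed
  have \<delta>: "\<delta> > 0"
    unfolding \<delta>_def using finA pos by (subst Min_gr_iff) (auto simp: A_def)
  have \<delta>_le: "\<delta> \<le> (v - z0) \<bullet> u" if "v \<in> V \<inter> f" "u \<in> ray_dirs (N {v})" "u \<notin> N f" for v u
    unfolding \<delta>_def using finA that by (intro Min_le) (force simp: A_def)+
  obtain b where b: "\<And>w. w \<in> f \<Longrightarrow> norm w \<le> b"
    using compact_imp_bounded[OF pface_compact[OF f]] by (auto simp: bounded_iff)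
  have "\<exists>z\<in>f. norm (y - t *\<^sub>R z) \<le> (c / \<delta>) * (2 * b)"
    if t: "1 \<le> t" and perp: "\<And>v a. v \<in> V \<inter> f \<Longrightarrow> a \<in> N f \<Longrightarrow> (y - t *\<^sub>R v) \<bullet> a = 0"
      and le: "\<And>v u. v \<in> V \<inter> f \<Longrightarrow> u \<in> ray_dirs (N {v}) \<Longrightarrow> (y - t *\<^sub>R v) \<bullet> u \<le> c" for t y
  proof -
    \<comment> \<open>The shrinking factor for which the gain \<open>(1 - \<theta>) \<delta>\<close> exactly balances the error \<open>\<theta> c / t\<close>.\<close>
    define \<theta> where "\<theta> = t * \<delta> / (t * \<delta> + c)"
    have t\<delta>: "0 < t * \<delta>"
      using t \<delta> by simp
    have \<theta>: "0 < \<theta>" "\<theta> \<le> 1"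
      unfolding \<theta>_def using t\<delta> c by auto
    have bal: "\<theta> * (c / t) = (1 - \<theta>) * \<delta>"
      unfolding \<theta>_def using t\<delta> c t by (simp add: field_simps)
    define z where "z = z0 + \<theta> *\<^sub>R (inverse t *\<^sub>R y - z0)"
    have split: "(z - v) \<bullet> a = (1 - \<theta>) * ((z0 - v) \<bullet> a) + \<theta> * inverse t * ((y - t *\<^sub>R v) \<bullet> a)" for v a
    proof -
      have "z - v = (1 - \<theta>) *\<^sub>R (z0 - v) + (\<theta> * inverse t) *\<^sub>R (y - t *\<^sub>R v)"
        using t by (simp add: z_def algebra_simps)
      then show ?thesis
        by (simp add: inner_add_left)
    qed
    have "z \<in> f"
    proof (rule mem_pface_of_vertex_cones[OF f])
      fix v a assume va: "v \<in> V \<inter> f" "a \<in> N f"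
      have "(z0 - v) \<bullet> a = 0"
        using N_const[OF f va(2) z0f, of v] va(1) by (simp add: inner_diff_left inner_diff_right inner_commute)
      then show "(z - v) \<bullet> a = 0"
        unfolding split using perp[OF va] by simp
    next
      fix v assume v: "v \<in> V \<inter> f"
      then have vV: "v \<in> V"
        by blast
      show "z - v \<in> polar_cone (N {v})"
        unfolding mem_polar_cone_iff_rays[OF pcone_N[OF pface_vertex[OF vV]]]
      proof
        fix u assume u: "u \<in> ray_dirs (N {v})"
        show "(z - v) \<bullet> u \<le> 0"
        proof (cases "u \<in> N f")
          case True
          have "(z0 - v) \<bullet> u = 0"
            using N_const[OF f True z0f, of v] v by (simp add: inner_diff_left inner_diff_right inner_commute)
          then show ?thesis
            unfolding split using perp[OF v True] by simp
        next
          case False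
          have "(z0 - v) \<bullet> u \<le> - \<delta>"
            using \<delta>_le[OF v u False] by (simp add: inner_diff_left)
          then have "(1 - \<theta>) * ((z0 - v) \<bullet> u) \<le> (1 - \<theta>) * (- \<delta>)"
            using \<theta> by (intro mult_left_mono) auto
          moreover have "\<theta> * inverse t * ((y - t *\<^sub>R v) \<bullet> u) \<le> \<theta> * inverse t * c"
            using \<theta> t le[OF v u] by (intro mult_left_mono) auto
          ultimately show ?thesis
            unfolding split using bal by (simp add: field_simps)
        qed
      qed
    qed
    moreover have "norm (y - t *\<^sub>R z) \<le> (c / \<delta>) * (2 * b)"
    proof -
      have "z - z0 = \<theta> *\<^sub>R (inverse t *\<^sub>R y - z0)"
        by (simp add: z_def)
      then have "inverse t *\<^sub>R y - z0 = inverse \<theta> *\<^sub>R (z - z0)"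
        using \<theta> by simp
      then have "t *\<^sub>R (inverse t *\<^sub>R y - z0) = t *\<^sub>R (inverse \<theta> *\<^sub>R (z - z0))"
        by simp
      then have "y = t *\<^sub>R z0 + (t * inverse \<theta>) *\<^sub>R (z - z0)"
        using t by (simp add: algebra_simps)
      then have "y - t *\<^sub>R z = (t * inverse \<theta> - t) *\<^sub>R (z - z0)"
        by (simp add: algebra_simps)
      also have "t * inverse \<theta> - t = c / \<delta>"
        unfolding \<theta>_def using t\<delta> t \<delta> c by (simp add: field_simps)
      finally have "norm (y - t *\<^sub>R z) = (c / \<delta>) * norm (z - z0)"
        using c \<delta> by simp
      also have "\<dots> \<le> (c / \<delta>) * (2 * b)"
        using c \<delta> norm_triangle_ineq4[of z z0] b[OF \<open>z \<in> f\<close>] b[OF z0f]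
        by (intro mult_left_mono) auto
      finally show ?thesis .
    qed
    ultimately show ?thesis
      by blast
  qed
  then show ?thesis
    by (intro exI[of _ "(c / \<delta>) * (2 * b)"]) blast
qed

end


section \<open>The tiling of a dilated lattice polytope\<close>

context lattice_polytope_tiles
begin

abbreviation "scaled t \<equiv> (*\<^sub>R) (real t) ` P"

abbreviation "feasible \<equiv> feasible_points \<Lambda> D P"

lemma feasible_translations_L:
  "x \<in> feasible_translations \<Lambda> D C K \<Longrightarrow> x \<in> L K"
  using X_subset_L L_zero by (auto simp: feasible_translations_def split: if_splits)

lemma feasible_translations_X:
  "x \<in> feasible_translations \<Lambda> D C K \<Longrightarrow> K \<noteq> C \<Longrightarrow> x \<in> X C K"
  by (simp add: feasible_translations_def)

lemma mem_feasible_iff: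
  assumes "pface f"
  shows "x \<in> feasible t f \<longleftrightarrow>
    (\<forall>v\<in>V \<inter> f. x - real t *\<^sub>R v \<in> feasible_translations \<Lambda> D (N {v}) (N f))"
proof -
  have "x \<in> (\<lambda>x. x + real t *\<^sub>R v) ` A \<longleftrightarrow> x - real t *\<^sub>R v \<in> A" for v A
    by (force simp: image_iff)
  then show ?thesis
    using extreme_point_of_pface[OF assms] by (simp add: feasible_points_def) blast
qed

lemma scaled_vertex_lattice: "v \<in> V \<Longrightarrow> real t *\<^sub>R v \<in> \<Lambda>"
  using V_lattice lattice_scale_nat by blast

lemma mem_scaled_P_iff:
  assumes "0 < t"
  shows "y \<in> scaled t \<longleftrightarrow> (\<forall>v\<in>V. y - real t *\<^sub>R v \<in> polar_cone (N {v}))"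
proof -
  have t: "real t > 0"
    using assms by simp
  have "y \<in> scaled t \<longleftrightarrow> inverse (real t) *\<^sub>R y \<in> P"
  proof
    assume "inverse (real t) *\<^sub>R y \<in> P"
    moreover have "y = real t *\<^sub>R (inverse (real t) *\<^sub>R y)"
      using t by simp
    ultimately show "y \<in> scaled t"
      by (rule rev_image_eqI)
  qed (use t in auto)
  moreover have "inverse (real t) *\<^sub>R y - v \<in> polar_cone K \<longleftrightarrow> y - real t *\<^sub>R v \<in> polar_cone K" for v K
  proof -
    have "inverse (real t) *\<^sub>R y - v = inverse (real t) *\<^sub>R (y - real t *\<^sub>R v)"
      using t by (simp add: scaleR_diff_right)
    then show ?thesis
      using t by (simp add: polar_cone_def mult_le_0_iff zero_le_mult_iff)
  qed
  ultimately show ?thesis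
    by (simp add: mem_P_iff_cones)
qed

lemma uniform_region_bound:
  obtains \<rho> where "0 \<le> \<rho>" "\<And>f q. pface f \<Longrightarrow> q \<in> R (N f) \<Longrightarrow> norm q \<le> \<rho>"
    "\<And>\<tau>. \<tau> \<in> T\<^sub>0 \<Longrightarrow> norm \<tau> \<le> \<rho>"
proof -
  have "\<exists>\<rho>\<ge>0. \<forall>C\<in>N ` {f. pface f} \<union> {{0}}. \<forall>q\<in>R C. norm q \<le> \<rho>"
  proof (rule finite_uniform_bound)
    show "finite (N ` {f. pface f} \<union> {{0}})"
      using finite_pfaces by simp
    fix C assume "C \<in> N ` {f. pface f} \<union> {{0}}"
    then have "pcone C"
      using pcone_N pcone_zero by blast
    then show "\<exists>B. \<forall>q\<in>R C. norm q \<le> B"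
      using bounded_region bounded_iff by blast
  qed force
  then show ?thesis
    using that region_zero by auto
qed

text \<open>Feasibility at the vertices of \<open>f\<close> provides exactly the hypotheses of the error bound, with \<open>c\<close> a
bound for the size of the regions.\<close>

lemma tiles_near_face:
  obtains B where "\<And>f t x q. pface f \<Longrightarrow> 1 \<le> t \<Longrightarrow> x \<in> feasible t f \<Longrightarrow> q \<in> R (N f) \<Longrightarrow>
    \<exists>z\<in>f. norm (x + q - real t *\<^sub>R z) \<le> B"
proof -
  obtain \<rho> where \<rho>: "0 \<le> \<rho>" "\<And>f q. pface f \<Longrightarrow> q \<in> R (N f) \<Longrightarrow> norm q \<le> \<rho>"
    using uniform_region_bound by metis
  have "\<exists>B\<ge>0. \<forall>f\<in>{f. pface f}. \<forall>t x q. 1 \<le> t \<longrightarrow> x \<in> feasible t f \<longrightarrow> q \<in> R (N f) \<longrightarrow>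
    (\<exists>z\<in>f. norm (x + q - real t *\<^sub>R z) \<le> B)"
  proof (rule finite_uniform_bound[OF finite_pfaces])
    fix f assume "f \<in> {f. pface f}"
    then have f: "pface f"
      by simp
    obtain B where B: "\<And>t y. t \<ge> 1 \<Longrightarrow>
        (\<forall>v\<in>V \<inter> f. \<forall>a\<in>N f. (y - t *\<^sub>R v) \<bullet> a = 0) \<and>
        (\<forall>v\<in>V \<inter> f. \<forall>u\<in>ray_dirs (N {v}). (y - t *\<^sub>R v) \<bullet> u \<le> \<rho>) \<Longrightarrow>
        \<exists>z\<in>f. norm (y - t *\<^sub>R z) \<le> B"
      using near_face[OF f \<rho>(1)] by blast
    have "\<exists>z\<in>f. norm (x + q - real t *\<^sub>R z) \<le> B + \<rho>"
      if t: "1 \<le> t" and x: "x \<in> feasible t f" and q: "q \<in> R (N f)" for t x q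
    proof -
      have ft: "x - real t *\<^sub>R v \<in> feasible_translations \<Lambda> D (N {v}) (N f)" if "v \<in> V \<inter> f" for v
        using x that mem_feasible_iff[OF f] by blast
      have perp: "(x - real t *\<^sub>R v) \<bullet> a = 0" if "v \<in> V \<inter> f" "a \<in> N f" for v a
        using feasible_translations_L[OF ft[OF that(1)]] that(2) by (simp add: mem_L_iff)
      have "(x - real t *\<^sub>R v) \<bullet> u \<le> \<rho>" if v: "v \<in> V \<inter> f" and u: "u \<in> ray_dirs (N {v})" for v u
      proof (cases "u \<in> N f")
        case True
        then show ?thesis
          using perp[OF v True] \<rho>(1) by simp
      next
        case False
        have pv: "pface {v}" and vf: "{v} \<subseteq> f"
          using v pface_vertex by auto
        have "N f \<noteq> N {v}"
          using False u ray_dirs_subset by blast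
        then have "x - real t *\<^sub>R v \<in> X (N {v}) (N f)"
          using feasible_translations_X[OF ft[OF v]] by blast
        then have "(x - real t *\<^sub>R v + q) \<bullet> u < 0"
          using mem_X_iff[OF pcone_N[OF pv] N_face_of_N[OF pv f vf] N_nonempty[OF f]] u False q
          by blast
        moreover have "- norm q \<le> q \<bullet> u"
          using norm_cauchy_schwarz[of "- q" u] norm_ray_dirs[OF u] by simp
        ultimately show ?thesis
          using \<rho>(2)[OF f q] by (simp add: inner_add_left)
      qed
      then obtain z where z: "z \<in> f" "norm (x - real t *\<^sub>R z) \<le> B"
        using B[of "real t" x] t perp by auto
      have "norm (x + q - real t *\<^sub>R z) = norm ((x - real t *\<^sub>R z) + q)"
        by (simp add: algebra_simps)
      also have "\<dots> \<le> B + \<rho>"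
        using z(2) \<rho>(2)[OF f q] norm_triangle_ineq[of "x - real t *\<^sub>R z" q] by linarith
      finally show ?thesis
        using z(1) by blast
    qed
    then show "\<exists>B. \<forall>t x q. 1 \<le> t \<longrightarrow> x \<in> feasible t f \<longrightarrow> q \<in> R (N f) \<longrightarrow>
        (\<exists>z\<in>f. norm (x + q - real t *\<^sub>R z) \<le> B)"
      by blast
  next
    fix f :: "'a set" and B B' :: real
    assume "\<forall>t x q. 1 \<le> t \<longrightarrow> x \<in> feasible t f \<longrightarrow> q \<in> R (N f) \<longrightarrow>
      (\<exists>z\<in>f. norm (x + q - real t *\<^sub>R z) \<le> B)" "B \<le> B'"
    then show "\<forall>t x q. 1 \<le> t \<longrightarrow> x \<in> feasible t f \<longrightarrow> q \<in> R (N f) \<longrightarrow>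
      (\<exists>z\<in>f. norm (x + q - real t *\<^sub>R z) \<le> B')"
      by (meson order_trans)
  qed
  then show ?thesis
    using that by blast
qed

text \<open>The tile \<open>z + T\<^sub>0\<close> through a point of \<open>R (N f)\<close> has a point in the polar cone of \<open>N f\<close>; its shift by
\<open>x\<close> is claimed to lie in \<open>t P\<close>. The inequalities at vertices of \<open>t f\<close> follow from the result for a
single cone. The remaining ones have slack growing linearly in \<open>t\<close> along \<open>t f\<close>, and the point is at
bounded distance from \<open>t f\<close>.\<close>

lemma tiles_inside_CDC:
  "\<exists>t\<^sub>0. \<forall>t\<ge>t\<^sub>0. \<forall>f x q. pface f \<longrightarrow> x \<in> feasible t f \<longrightarrow> q \<in> R (N f) \<longrightarrow> x + q \<in> cdc (scaled t)"
proof -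
  obtain \<rho> where \<rho>: "0 \<le> \<rho>" "\<And>\<tau>. \<tau> \<in> T\<^sub>0 \<Longrightarrow> norm \<tau> \<le> \<rho>"
    using uniform_region_bound by metis
  obtain B where B: "\<And>f t x q. pface f \<Longrightarrow> 1 \<le> t \<Longrightarrow> x \<in> feasible t f \<Longrightarrow> q \<in> R (N f) \<Longrightarrow>
      \<exists>z\<in>f. norm (x + q - real t *\<^sub>R z) \<le> B"
    using tiles_near_face by metis
  let ?c = "B + 2 * \<rho>"
  let ?Q = "\<lambda>(f, v, u) b. (\<forall>v'\<in>V \<inter> f. u \<notin> N {v'}) \<longrightarrow>
      (\<forall>w\<in>f. \<forall>t\<ge>b. t * (u \<bullet> w) + ?c \<le> t * (u \<bullet> v))"
  have "\<exists>b\<ge>0. \<forall>i\<in>{f. pface f} \<times> (SIGMA v:V. ray_dirs (N {v})). ?Q i b"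
  proof (rule finite_uniform_bound)
    show "finite ({f. pface f} \<times> (SIGMA v:V. ray_dirs (N {v})))"
      using finite_pfaces finite_vertex_rays by (rule finite_cartesian_product)
    fix i assume "i \<in> {f. pface f} \<times> (SIGMA v:V. ray_dirs (N {v}))"
    then obtain f v u where i: "i = (f, v, u)" "pface f" "v \<in> V" "u \<in> ray_dirs (N {v})"
      by auto
    have u: "u \<in> N {v}"
      using i(4) ray_dirs_subset by blast
    have "\<exists>b. \<forall>w\<in>f. \<forall>t\<ge>b. t * (u \<bullet> w) + ?c \<le> t * (u \<bullet> v)" if out: "\<forall>v'\<in>V \<inter> f. u \<notin> N {v'}"
    proof -
      obtain \<delta> where \<delta>: "\<delta> > 0" "\<And>w. w \<in> f \<Longrightarrow> u \<bullet> w \<le> u \<bullet> v - \<delta>"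
        using gap_off_vertex_cones[OF i(2,3) u] out by blast
      have "t * (u \<bullet> w) + ?c \<le> t * (u \<bullet> v)" if w: "w \<in> f" and t: "t \<ge> \<bar>?c\<bar> / \<delta>" for w t
      proof -
        have "0 \<le> \<bar>?c\<bar> / \<delta>"
          using \<delta>(1) by simp
        then have t0: "0 \<le> t"
          using t by linarith
        have "?c \<le> t * \<delta>"
          using t \<delta>(1) by (simp add: pos_divide_le_eq)
        moreover have "t * (u \<bullet> w) \<le> t * (u \<bullet> v - \<delta>)"
          using \<delta>(2)[OF w] t0 by (rule mult_left_mono)
        ultimately show ?thesis
          by (simp add: right_diff_distrib)
      qed
      then show ?thesis
        by blast
    qed
    then show "\<exists>b. ?Q i b"
      unfolding i(1) by auto
  qed auto
  then obtain b where b: "b \<ge> 0" "\<And>f v u w t. pface f \<Longrightarrow> v \<in> V \<Longrightarrow> u \<in> ray_dirs (N {v}) \<Longrightarrow>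
      (\<And>v'. v' \<in> V \<inter> f \<Longrightarrow> u \<notin> N {v'}) \<Longrightarrow> w \<in> f \<Longrightarrow> b \<le> t \<Longrightarrow> t * (u \<bullet> w) + ?c \<le> t * (u \<bullet> v)"
    by fastforce
  have "x + q \<in> cdc (scaled t)"
    if t: "nat \<lceil>b\<rceil> + 1 \<le> t" and f: "pface f" and x: "x \<in> feasible t f" and q: "q \<in> R (N f)" for t f x q
  proof -
    have t1: "1 \<le> t" and tb: "b \<le> real t"
      using t b(1) by linarith+
    obtain w where w: "w \<in> f" "norm (x + q - real t *\<^sub>R w) \<le> B"
      using B[OF f t1 x q] by blast
    have ft: "x - real t *\<^sub>R v \<in> feasible_translations \<Lambda> D (N {v}) (N f)" if "v \<in> V \<inter> f" for v
      using x that mem_feasible_iff[OF f] by blast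
    have xL: "x - real t *\<^sub>R v \<in> L (N f)" if "v \<in> V \<inter> f" for v
      using feasible_translations_L[OF ft[OF that]] .
    obtain v0 where v0: "v0 \<in> V \<inter> f"
      using pface_has_vertex[OF f] by blast
    have x\<Lambda>: "x \<in> \<Lambda>"
    proof -
      have "x - real t *\<^sub>R v0 \<in> \<Lambda>"
        using xL[OF v0] by (simp add: mem_L_iff)
      then have "x - real t *\<^sub>R v0 + real t *\<^sub>R v0 \<in> \<Lambda>"
        using scaled_vertex_lattice[of v0 t] v0 by (intro lattice_add) auto
      then show ?thesis
        by simp
    qed
    obtain z \<tau> \<tau>' where z: "z \<in> \<Lambda>" "\<tau> \<in> T\<^sub>0" "\<tau>' \<in> T\<^sub>0" "q = z + \<tau>" "z + \<tau>' \<in> polar_cone (N f)"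
      using region_subset_CDC[OF pcone_N[OF f] q] by (auto simp: mem_CDC_iff)
    have at_vertex: "x + z + \<tau>' - real t *\<^sub>R v \<in> polar_cone (N {v})" if v: "v \<in> V \<inter> f" for v
    proof -
      let ?x = "x - real t *\<^sub>R v"
      have pv: "pface {v}" and vf: "{v} \<subseteq> f"
        using v pface_vertex by auto
      have "?x + z \<in> \<Lambda>"
        using xL[OF v] z(1) lattice_add by (simp add: mem_L_iff)
      moreover have "?x + q = (?x + z) + \<tau>"
        by (simp add: z(4))
      moreover have "(z + \<tau>') + ?x \<in> polar_cone (N f)"
        using polar_cone_add_L[OF z(5) xL[OF v]] .
      then have "(?x + z) + \<tau>' \<in> polar_cone (N f)"
        by (simp add: algebra_simps)
      ultimately have "(?x + z) + \<tau>' \<in> polar_cone (N {v})"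
        using feasible_region_in_polar_cone[OF pcone_N[OF pv] N_face_of_N[OF pv f vf] N_nonempty[OF f]
            xL[OF v] feasible_translations_X[OF ft[OF v]] q _ z(2,3)] by blast
      then show ?thesis
        by (simp add: algebra_simps)
    qed
    have "x + z + \<tau>' \<in> scaled t"
    proof -
      have "x + z + \<tau>' - real t *\<^sub>R v \<in> polar_cone (N {v})" if v: "v \<in> V" for v
        unfolding mem_polar_cone_iff_rays[OF pcone_N[OF pface_vertex[OF v]]]
      proof
        fix u assume u: "u \<in> ray_dirs (N {v})"
        then have uN: "u \<in> N {v}"
          using ray_dirs_subset by blast
        show "(x + z + \<tau>' - real t *\<^sub>R v) \<bullet> u \<le> 0"
        proof (cases "\<exists>v'\<in>V \<inter> f. u \<in> N {v'}")
          case True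
          then obtain v' where v': "v' \<in> V \<inter> f" "u \<in> N {v'}"
            by blast
          have "u \<bullet> v' \<le> u \<bullet> v" "u \<bullet> v \<le> u \<bullet> v'"
            using uN v'(2) N_vertex_iff[OF v] N_vertex_iff[of v'] v v'(1) V_subset by blast+
          then have "(real t *\<^sub>R v) \<bullet> u = (real t *\<^sub>R v') \<bullet> u"
            by (simp add: inner_commute)
          moreover have "(x + z + \<tau>' - real t *\<^sub>R v') \<bullet> u \<le> 0"
            using at_vertex[OF v'(1)] v'(2) by (simp add: polar_cone_def)
          ultimately show ?thesis
            by (simp only: inner_diff_left)
        next
          case False
          have "real t * (u \<bullet> w) + ?c \<le> real t * (u \<bullet> v)"
            using b(2)[OF f v u _ w(1) tb] False by blast
          moreover have "(x + q - real t *\<^sub>R w) \<bullet> u \<le> B"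
            using norm_cauchy_schwarz[of "x + q - real t *\<^sub>R w" u] w(2) norm_ray_dirs[OF u] by simp
          moreover have "(\<tau>' - \<tau>) \<bullet> u \<le> 2 * \<rho>"
            using norm_cauchy_schwarz[of "\<tau>' - \<tau>" u] norm_ray_dirs[OF u] norm_triangle_ineq4[of \<tau>' \<tau>]
              \<rho>(2)[OF z(2)] \<rho>(2)[OF z(3)] by simp
          moreover have "(x + z + \<tau>' - real t *\<^sub>R v) \<bullet> u =
              (x + q - real t *\<^sub>R w) \<bullet> u + (\<tau>' - \<tau>) \<bullet> u + real t * (u \<bullet> w) - real t * (u \<bullet> v)"
            by (simp add: z(4) inner_diff_left inner_add_left inner_commute[of u])
          ultimately show ?thesis
            by linarith
        qed
      qed
      then show ?thesis
        using mem_scaled_P_iff[of t] t1 by simp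
    qed
    moreover have "x + q = (x + z) + \<tau>" "x + z \<in> \<Lambda>"
      using z(4) lattice_add[OF x\<Lambda> z(1)] by auto
    ultimately show ?thesis
      using z(2,3) mem_CDC_iff by blast
  qed
  then show ?thesis
    by blast
qed

text \<open>Disjoint faces of \<open>t P\<close> have distance growing linearly in \<open>t\<close>, so the translates can only meet
when the faces share a vertex, and there the disjointness for a single cone applies.\<close>

lemma tiles_disjoint:
  "\<exists>t\<^sub>0. \<forall>t\<ge>t\<^sub>0. \<forall>f x q g y r. pface f \<longrightarrow> x \<in> feasible t f \<longrightarrow> q \<in> R (N f) \<longrightarrow>
    pface g \<longrightarrow> y \<in> feasible t g \<longrightarrow> r \<in> R (N g) \<longrightarrow> x + q = y + r \<longrightarrow> f = g \<and> x = y"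
proof -
  obtain B where B: "\<And>f t x q. pface f \<Longrightarrow> 1 \<le> t \<Longrightarrow> x \<in> feasible t f \<Longrightarrow> q \<in> R (N f) \<Longrightarrow>
      \<exists>z\<in>f. norm (x + q - real t *\<^sub>R z) \<le> B"
    using tiles_near_face by metis
  let ?Q = "\<lambda>(f, g) b. f \<inter> g = {} \<longrightarrow> (\<forall>t\<ge>b. \<forall>w\<in>f. \<forall>w'\<in>g. 2 * B < t * dist w w')"
  have "\<exists>b\<ge>0. \<forall>i\<in>{f. pface f} \<times> {f. pface f}. ?Q i b"
  proof (rule finite_uniform_bound)
    show "finite ({f. pface f} \<times> {f. pface f})"
      using finite_pfaces by simp
    fix i assume "i \<in> {f. pface f} \<times> {f. pface f}"
    then obtain f g where i: "i = (f, g)" "pface f" "pface g"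
      by auto
    have "\<exists>b. \<forall>t\<ge>b. \<forall>w\<in>f. \<forall>w'\<in>g. 2 * B < t * dist w w'" if dis: "f \<inter> g = {}"
    proof -
      obtain d where d: "d > 0" "\<And>w w'. w \<in> f \<Longrightarrow> w' \<in> g \<Longrightarrow> d \<le> dist w w'"
        using separate_compact_closed[OF pface_compact[OF i(2)] compact_imp_closed[OF pface_compact[OF i(3)]] dis]
        by blast
      have "2 * B < t * dist w w'" if t: "(\<bar>2 * B\<bar> + 1) / d \<le> t" and w: "w \<in> f" "w' \<in> g" for t w w'
      proof -
        have "\<bar>2 * B\<bar> + 1 \<le> t * d"
          using t d(1) by (simp add: pos_divide_le_eq)
        moreover have "0 \<le> (\<bar>2 * B\<bar> + 1) / d"
          using d(1) by simp
        then have "t * d \<le> t * dist w w'"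
          using d(2)[OF w] t by (intro mult_left_mono) linarith+
        ultimately show ?thesis
          by linarith
      qed
      then show ?thesis
        by blast
    qed
    then show "\<exists>b. ?Q i b"
      unfolding i(1) by auto
  qed auto
  then obtain b where b: "b \<ge> 0" "\<And>f g t w w'. pface f \<Longrightarrow> pface g \<Longrightarrow> f \<inter> g = {} \<Longrightarrow> b \<le> t \<Longrightarrow>
      w \<in> f \<Longrightarrow> w' \<in> g \<Longrightarrow> 2 * B < t * dist w w'"
    by fastforce
  have "f = g \<and> x = y"
    if t: "nat \<lceil>b\<rceil> + 1 \<le> t" and f: "pface f" "x \<in> feasible t f" "q \<in> R (N f)"
      and g: "pface g" "y \<in> feasible t g" "r \<in> R (N g)" and eq: "x + q = y + r" for t f x q g y r
  proof -
    have t1: "1 \<le> t" and tb: "b \<le> real t"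
      using t b(1) by linarith+
    have "f \<inter> g \<noteq> {}"
    proof
      assume dis: "f \<inter> g = {}"
      obtain w w' where w: "w \<in> f" "norm (x + q - real t *\<^sub>R w) \<le> B"
          "w' \<in> g" "norm (y + r - real t *\<^sub>R w') \<le> B"
        using B[OF f(1) t1 f(2,3)] B[OF g(1) t1 g(2,3)] by blast
      have "real t * dist w w' = norm (real t *\<^sub>R (w - w'))"
        by (simp add: dist_norm)
      also have "real t *\<^sub>R (w - w') = (y + r - real t *\<^sub>R w') - (x + q - real t *\<^sub>R w)"
        unfolding eq by (simp add: algebra_simps)
      also have "norm \<dots> \<le> 2 * B"
        using norm_triangle_ineq4[of "y + r - real t *\<^sub>R w'" "x + q - real t *\<^sub>R w"] w(2,4) by linarith
      finally show False
        using b(2)[OF f(1) g(1) dis tb w(1,3)] by simp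
    qed
    then have "V \<inter> (f \<inter> g) \<noteq> {}"
      using pface_has_vertex[OF pface_Int[OF f(1) g(1)]] by blast
    then obtain v where v: "v \<in> V" "{v} \<subseteq> f" "{v} \<subseteq> g"
      by auto
    have pv: "pface {v}"
      using pface_vertex[OF v(1)] .
    have "x - real t *\<^sub>R v \<in> feasible_translations \<Lambda> D (N {v}) (N f)"
      "y - real t *\<^sub>R v \<in> feasible_translations \<Lambda> D (N {v}) (N g)"
      using f g v mem_feasible_iff by auto
    moreover have "x - real t *\<^sub>R v + q = y - real t *\<^sub>R v + r"
      using eq by (simp add: algebra_simps)
    ultimately have "N f = N g \<and> x - real t *\<^sub>R v = y - real t *\<^sub>R v"
      using feasible_regions_disjoint[OF pcone_N[OF pv] N_face_of_N[OF pv f(1) v(2)] N_nonempty[OF f(1)]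
          N_face_of_N[OF pv g(1) v(3)] N_nonempty[OF g(1)] _ _ f(3) g(3)] by blast
    then show ?thesis
      using N_inj[OF f(1) g(1)] by simp
  qed
  then show ?thesis
    by blast
qed

text \<open>By compactness: the total slack of the inequalities in \<open>S\<close> attains its minimum on \<open>P\<close>, which is
either \<open>0\<close> or gives an \<open>\<epsilon>\<close> for which the premise fails.\<close>

lemma almost_tight_imp_tight:
  assumes S: "S \<subseteq> (SIGMA v:V. ray_dirs (N {v}))"
  shows "\<exists>\<epsilon>>0. \<forall>y\<in>P. (\<forall>(v, u)\<in>S. - \<epsilon> \<le> (y - v) \<bullet> u) \<longrightarrow> (\<exists>y\<in>P. \<forall>(v, u)\<in>S. (y - v) \<bullet> u = 0)"
proof -
  have fin: "finite S"
    using finite_subset[OF S finite_vertex_rays] .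
  define h where "h y = (\<Sum>(v, u)\<in>S. (v - y) \<bullet> u)" for y
  have nonneg: "0 \<le> (v - y) \<bullet> u" if "(v, u) \<in> S" "y \<in> P" for v u y
  proof -
    have "v \<in> V" "u \<in> N {v}"
      using that S ray_dirs_subset by blast+
    then have "u \<bullet> y \<le> u \<bullet> v"
      using N_vertex_iff that(2) by blast
    then show ?thesis
      by (simp add: inner_diff_left inner_diff_right inner_commute)
  qed
  have "continuous_on P h"
    unfolding h_def split_def by (intro continuous_intros)
  then obtain y0 where y0: "y0 \<in> P" "\<And>y. y \<in> P \<Longrightarrow> h y0 \<le> h y"
    using continuous_attains_inf[OF compact_P P_nonempty] by blast
  show ?thesis
  proof (cases "h y0 = 0")
    case True
    then have "\<forall>(v, u)\<in>S. (v - y0) \<bullet> u = 0"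
      unfolding h_def split_def using fin nonneg y0(1) by (subst (asm) sum_nonneg_eq_0_iff) auto
    then have "\<forall>(v, u)\<in>S. (y0 - v) \<bullet> u = 0"
      by (auto simp: inner_diff_left)
    then show ?thesis
      using y0(1) by (intro exI[of _ 1]) auto
  next
    case False
    have "0 \<le> h y0"
      unfolding h_def using nonneg y0(1) by (intro sum_nonneg) auto
    then have pos: "0 < h y0"
      using False by simp
    define \<epsilon> where "\<epsilon> = h y0 / (real (card S) + 1)"
    have "\<not> (\<forall>(v, u)\<in>S. - \<epsilon> \<le> (y - v) \<bullet> u)" if y: "y \<in> P" for y
    proof
      assume *: "\<forall>(v, u)\<in>S. - \<epsilon> \<le> (y - v) \<bullet> u"
      have "h y \<le> (\<Sum>i\<in>S. \<epsilon>)"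
        unfolding h_def using * by (intro sum_mono) (auto simp: inner_diff_left)
      also have "\<dots> = real (card S) * \<epsilon>"
        by simp
      also have "\<dots> < h y0"
        unfolding \<epsilon>_def using pos by (simp add: field_simps)
      finally show False
        using y0(2)[OF y] by simp
    qed
    moreover have "\<epsilon> > 0"
      using pos by (simp add: \<epsilon>_def)
    ultimately show ?thesis
      by blast
  qed
qed

text \<open>The normal cone of a vertex is full-dimensional: a vector \<open>y\<close> orthogonal to it would place
\<open>v + y\<close> in the face \<open>{v}\<close>. This matches the convention that only \<open>0\<close> is feasible at a vertex.\<close>

lemma L_vertex_cone:
  assumes v: "v \<in> V" and y: "y \<in> L (N {v})"
  shows "y = 0"
proof -
  have "v + y \<in> {v}"
  proof (rule mem_pface_of_vertex_cones[OF pface_vertex[OF v]])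
    show "(v + y - v') \<bullet> a = 0" if "v' \<in> V \<inter> {v}" "a \<in> N {v}" for v' a
      using that y by (simp add: mem_L_iff)
    show "v + y - v' \<in> polar_cone (N {v'})" if "v' \<in> V \<inter> {v}" for v'
      using that y by (simp add: mem_L_iff polar_cone_def)
  qed
  then show ?thesis
    by simp
qed

text \<open>For large \<open>t\<close> the inequalities which are almost tight at \<open>p\<close> are tight on a common nonempty face
\<open>f\<close>, so \<open>p\<close> is far from all hyperplanes whose normal is outside \<open>N f\<close>. The covering for the cone \<open>N f\<close>
gives a face \<open>g\<close> that contains \<open>f\<close> and a translate of \<open>R (N g)\<close> through \<open>p\<close>. To see that it is feasible
at a vertex \<open>v\<close> of \<open>g\<close>, which need not be a vertex of \<open>f\<close>, restrict from \<open>N f\<close> to the common face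
\<open>N {v} \<inter> N f\<close> and transfer from there to \<open>N {v}\<close>.\<close>

lemma tiles_cover:
  "\<exists>t\<^sub>0. \<forall>t\<ge>t\<^sub>0. \<forall>p\<in>cdc (scaled t). \<exists>f x q. pface f \<and> x \<in> feasible t f \<and> q \<in> R (N f) \<and> p = x + q"
proof -
  let ?U = "SIGMA v:V. ray_dirs (N {v})"
  obtain \<rho> where \<rho>: "0 \<le> \<rho>" "\<And>f q. pface f \<Longrightarrow> q \<in> R (N f) \<Longrightarrow> norm q \<le> \<rho>"
      "\<And>\<tau>. \<tau> \<in> T\<^sub>0 \<Longrightarrow> norm \<tau> \<le> \<rho>"
    using uniform_region_bound by metis
  have "\<exists>b\<ge>0. \<forall>S\<in>Pow ?U. \<forall>t\<ge>b. 0 < t \<longrightarrow> (\<forall>y\<in>P. (\<forall>(v, u)\<in>S. - (5 * \<rho>) \<le> t * ((y - v) \<bullet> u)) \<longrightarrow>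
      (\<exists>y\<in>P. \<forall>(v, u)\<in>S. (y - v) \<bullet> u = 0))"
  proof (rule finite_uniform_bound)
    show "finite (Pow ?U)"
      using finite_vertex_rays by simp
    fix S assume "S \<in> Pow ?U"
    then obtain \<epsilon> where \<epsilon>: "\<epsilon> > 0" "\<And>y. y \<in> P \<Longrightarrow> \<forall>(v, u)\<in>S. - \<epsilon> \<le> (y - v) \<bullet> u \<Longrightarrow>
        \<exists>y\<in>P. \<forall>(v, u)\<in>S. (y - v) \<bullet> u = 0"
      using almost_tight_imp_tight[of S] by blast
    have "\<exists>y\<in>P. \<forall>(v, u)\<in>S. (y - v) \<bullet> u = 0"
      if t: "5 * \<rho> / \<epsilon> \<le> t" "0 < t" and y: "y \<in> P" and le: "\<forall>(v, u)\<in>S. - (5 * \<rho>) \<le> t * ((y - v) \<bullet> u)" for t y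
    proof (rule \<epsilon>(2)[OF y])
      have t\<epsilon>: "5 * \<rho> \<le> t * \<epsilon>"
        using t(1) \<epsilon>(1) by (simp add: pos_divide_le_eq)
      have "- \<epsilon> \<le> (y - v) \<bullet> u" if "(v, u) \<in> S" for v u
      proof -
        have "- (5 * \<rho>) \<le> t * ((y - v) \<bullet> u)"
          using le that by blast
        then have "t * (- \<epsilon>) \<le> t * ((y - v) \<bullet> u)"
          using t\<epsilon> by simp
        then show ?thesis
          using t(2) by (rule mult_left_le_imp_le)
      qed
      then show "\<forall>(v, u)\<in>S. - \<epsilon> \<le> (y - v) \<bullet> u"
        by blast
    qed
    then show "\<exists>b. \<forall>t\<ge>b. 0 < t \<longrightarrow> (\<forall>y\<in>P. (\<forall>(v, u)\<in>S. - (5 * \<rho>) \<le> t * ((y - v) \<bullet> u)) \<longrightarrow>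
        (\<exists>y\<in>P. \<forall>(v, u)\<in>S. (y - v) \<bullet> u = 0))"
      by blast
  next
    fix S and b b' :: real
    assume H: "\<forall>t\<ge>b. 0 < t \<longrightarrow> (\<forall>y\<in>P. (\<forall>(v, u)\<in>S. - (5 * \<rho>) \<le> t * ((y - v) \<bullet> u)) \<longrightarrow>
      (\<exists>y\<in>P. \<forall>(v, u)\<in>S. (y - v) \<bullet> u = 0))" and bb': "b \<le> b'"
    show "\<forall>t\<ge>b'. 0 < t \<longrightarrow> (\<forall>y\<in>P. (\<forall>(v, u)\<in>S. - (5 * \<rho>) \<le> t * ((y - v) \<bullet> u)) \<longrightarrow>
      (\<exists>y\<in>P. \<forall>(v, u)\<in>S. (y - v) \<bullet> u = 0))"
      using H order_trans[OF bb'] by blast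
  qed
  then obtain b where b: "b \<ge> 0" "\<forall>S\<in>Pow ?U. \<forall>t\<ge>b. 0 < t \<longrightarrow>
      (\<forall>y\<in>P. (\<forall>(v, u)\<in>S. - (5 * \<rho>) \<le> t * ((y - v) \<bullet> u)) \<longrightarrow>
        (\<exists>y\<in>P. \<forall>(v, u)\<in>S. (y - v) \<bullet> u = 0))"
    by (elim exE conjE)
  have "\<exists>f x q. pface f \<and> x \<in> feasible t f \<and> q \<in> R (N f) \<and> p = x + q"
    if t: "nat \<lceil>b\<rceil> + 1 \<le> t" and p: "p \<in> cdc (scaled t)" for t p
  proof -
    have t0: "0 < real t" and tb: "b \<le> real t"
      using t b(1) by linarith+
    \<comment> \<open>The pairs for which \<open>X_transfer\<close> does not apply. As \<open>p\<close> is within \<open>2 \<rho>\<close> of \<open>t P\<close>, some point of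
      \<open>t P\<close> violates tightness for them by at most \<open>5 \<rho>\<close>.\<close>
    define S where "S = {(v, u). (v, u) \<in> ?U \<and> - (3 * \<rho>) \<le> (p - real t *\<^sub>R v) \<bullet> u}"
    have SU: "S \<subseteq> ?U"
      by (auto simp: S_def)
    obtain y0 where y0: "y0 \<in> P" "norm (p - real t *\<^sub>R y0) \<le> 2 * \<rho>"
      using CDC_near[OF p \<rho>(3)] by auto
    have "- (5 * \<rho>) \<le> real t * ((y0 - v) \<bullet> u)" if vu: "(v, u) \<in> S" for v u
    proof -
      have "norm u = 1"
        using vu SU norm_ray_dirs by blast
      then have "(p - real t *\<^sub>R y0) \<bullet> u \<le> 2 * \<rho>"
        using norm_cauchy_schwarz[of "p - real t *\<^sub>R y0" u] y0(2) by simp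
      moreover have "(p - real t *\<^sub>R v) \<bullet> u = (p - real t *\<^sub>R y0) \<bullet> u + real t * ((y0 - v) \<bullet> u)"
        by (simp add: inner_diff_left right_diff_distrib)
      moreover have "- (3 * \<rho>) \<le> (p - real t *\<^sub>R v) \<bullet> u"
        using vu by (simp add: S_def)
      ultimately show ?thesis
        by linarith
    qed
    then have "\<forall>(v, u)\<in>S. - (5 * \<rho>) \<le> real t * ((y0 - v) \<bullet> u)"
      by blast
    then obtain y1 where y1: "y1 \<in> P" "\<forall>(v, u)\<in>S. (y1 - v) \<bullet> u = 0"
      using bspec[OF b(2), of S] SU tb t0 y0(1) by blast
    have tight_le: "(y - v) \<bullet> u \<le> 0" if "(v, u) \<in> S" "y \<in> P" for v u y
    proof -
      have "v \<in> V" "u \<in> N {v}"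
        using that SU ray_dirs_subset by blast+
      then have "u \<bullet> y \<le> u \<bullet> v"
        using N_vertex_iff that(2) by blast
      then show ?thesis
        by (simp add: inner_diff_left inner_diff_right inner_commute)
    qed
    define f where "f = P \<inter> {y. \<forall>(v, u)\<in>S. (y - v) \<bullet> u = 0}"
    have f: "pface f"
    proof -
      let ?a = "\<Sum>(v, u)\<in>S. u"
      let ?b = "\<Sum>(v, u)\<in>S. v \<bullet> u"
      have diff: "?a \<bullet> y - ?b = (\<Sum>(v, u)\<in>S. (y - v) \<bullet> u)" for y
      proof -
        have "(\<Sum>(v, u)\<in>S. (y - v) \<bullet> u) = y \<bullet> ?a - ?b"
          by (simp add: inner_sum_right split_def inner_diff_left sum_subtractf)
        then show ?thesis
          by (simp add: inner_commute[of ?a])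
      qed
      have fin: "finite S"
        using finite_subset[OF SU finite_vertex_rays] .
      have "?a \<bullet> y = ?b \<longleftrightarrow> (\<forall>(v, u)\<in>S. (y - v) \<bullet> u = 0)" if y: "y \<in> P" for y
      proof -
        have "?a \<bullet> y = ?b \<longleftrightarrow> (\<Sum>(v, u)\<in>S. (y - v) \<bullet> u) = 0"
          using diff[of y] by auto
        also have "\<dots> \<longleftrightarrow> (\<Sum>i\<in>S. - ((y - fst i) \<bullet> snd i)) = 0"
          by (simp add: sum_negf split_def)
        also have "\<dots> \<longleftrightarrow> (\<forall>i\<in>S. - ((y - fst i) \<bullet> snd i) = 0)"
          using tight_le y by (intro sum_nonneg_eq_0_iff[OF fin]) auto
        also have "\<dots> \<longleftrightarrow> (\<forall>(v, u)\<in>S. (y - v) \<bullet> u = 0)"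
          by auto
        finally show ?thesis .
      qed
      then have "f = P \<inter> {y. ?a \<bullet> y = ?b}"
        by (auto simp: f_def)
      moreover have "?a \<bullet> y \<le> ?b" if y: "y \<in> P" for y
      proof -
        have "(\<Sum>(v, u)\<in>S. (y - v) \<bullet> u) \<le> 0"
          using tight_le y by (intro sum_nonpos) auto
        then show ?thesis
          using diff[of y] by simp
      qed
      ultimately have "f face_of P"
        using face_of_Int_supporting_hyperplane_le[OF convex_P, of ?a ?b] by simp
      moreover have "y1 \<in> f"
        using y1 by (simp add: f_def)
      ultimately show ?thesis
        by (auto simp: pface_def)
    qed
    have SN: "u \<in> N f" if vu: "(v, u) \<in> S" for v u
      unfolding mem_N_iff[OF f]
    proof (intro ballI)
      fix w y assume w: "w \<in> f" and y: "y \<in> P"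
      have "(w - v) \<bullet> u = 0"
        using w vu by (auto simp: f_def)
      then show "u \<bullet> y \<le> u \<bullet> w"
        using tight_le[OF vu y] by (simp add: inner_diff_left inner_diff_right inner_commute)
    qed
    obtain v0 where v0: "v0 \<in> V \<inter> f"
      using pface_has_vertex[OF f] by blast
    have tv\<Lambda>: "real t *\<^sub>R v \<in> \<Lambda>" if "v \<in> V" for v
      using scaled_vertex_lattice that .
    have "p + - (real t *\<^sub>R v0) \<in> cdc (polar_cone (N f))"
    proof (rule CDC_translate[OF p])
      show "- (real t *\<^sub>R v0) \<in> \<Lambda>"
        using lattice_diff[OF lattice_zero tv\<Lambda>[of v0]] v0 by simp
      fix y assume "y \<in> scaled t"
      then obtain y' where y': "y' \<in> P" "y = real t *\<^sub>R y'"
        by blast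
      have "(y' - v0) \<bullet> a \<le> 0" if "a \<in> N f" for a
      proof -
        have "a \<bullet> y' \<le> a \<bullet> v0"
          using that v0 y'(1) mem_N_iff[OF f] by blast
        then show ?thesis
          by (simp add: inner_diff_left inner_diff_right inner_commute)
      qed
      then have "real t * ((y' - v0) \<bullet> a) \<le> 0" if "a \<in> N f" for a
        using that by (simp add: mult_nonneg_nonpos)
      moreover have "(y + - (real t *\<^sub>R v0)) \<bullet> a = real t * ((y' - v0) \<bullet> a)" for a
        by (simp add: y'(2) inner_diff_left right_diff_distrib)
      ultimately show "y + - (real t *\<^sub>R v0) \<in> polar_cone (N f)"
        by (simp add: polar_cone_def)
    qed
    then obtain J y q where J: "J face_of N f" "J \<noteq> {}" "y \<in> L J" "J \<noteq> N f \<Longrightarrow> y \<in> X (N f) J"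
        "q \<in> R J" "p + - (real t *\<^sub>R v0) = y + q"
      using regions_cover[OF pcone_N[OF f]] by blast
    obtain g where g: "pface g" "f \<subseteq> g" "J = N g"
      using face_of_normal_cone_is_normal_cone[OF f J(1,2)] .
    define x where "x = y + real t *\<^sub>R v0"
    have px: "p = x + q"
      using J(6) by (simp add: x_def algebra_simps)
    have shift: "real t *\<^sub>R (v0 - v) \<in> L K"
      if v: "v \<in> V" and K: "\<And>a. a \<in> K \<Longrightarrow> a \<bullet> v0 = a \<bullet> v" for v K
    proof -
      have "real t *\<^sub>R v0 - real t *\<^sub>R v \<in> \<Lambda>"
        using lattice_diff[OF tv\<Lambda> tv\<Lambda>] v v0 by blast
      moreover have "(v0 - v) \<bullet> a = 0" if "a \<in> K" for a
        using K[OF that] by (simp add: inner_diff_left inner_diff_right inner_commute)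
      ultimately show ?thesis
        by (simp add: mem_L_iff scaleR_diff_right[symmetric])
    qed
    have "x - real t *\<^sub>R v \<in> feasible_translations \<Lambda> D (N {v}) (N g)" if v: "v \<in> V \<inter> g" for v
    proof -
      have vV: "v \<in> V" and vg: "{v} \<subseteq> g"
        using v by auto
      note pv = pface_vertex[OF vV]
      have eq: "x - real t *\<^sub>R v = y + real t *\<^sub>R (v0 - v)"
        by (simp add: x_def algebra_simps)
      have "real t *\<^sub>R (v0 - v) \<in> L (N g)"
        using v v0 g N_const[OF g(1)] by (intro shift[OF vV]) blast
      then have xL: "x - real t *\<^sub>R v \<in> L (N g)"
        unfolding eq using J(3) g(3) L_add by blast
      show ?thesis
      proof (cases "N g = N {v}")
        case True
        then have "x - real t *\<^sub>R v = 0"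
          using L_vertex_cone[OF vV, of "x - real t *\<^sub>R v"] xL by simp
        then show ?thesis
          using True by (simp add: feasible_translations_def)
      next
        case ne: False
        define K where "K = N {v} \<inter> N f"
        have K: "K face_of N {v}" "K face_of N f"
          using N_Int_face[OF pv f] N_Int_face[OF f pv] by (simp_all add: K_def Int_commute)
        have gK: "N g \<subseteq> K"
          using N_antimono[OF pv g(1) vg] N_antimono[OF f g(1,2)] by (simp add: K_def)
        have Kne: "K \<noteq> {}"
          using gK N_nonempty[OF g(1)] by blast
        have "x - real t *\<^sub>R v \<in> X (N {v}) (N g)"
        proof (rule X_transfer[OF pcone_N[OF pv] N_face_of_N[OF pv g(1) vg] N_nonempty[OF g(1)] ne K(1) gK xL])
          assume gneK: "N g \<noteq> K"
          have "N g \<noteq> N f"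
            using gneK gK by (auto simp: K_def)
          then have "y \<in> X (N f) (N g)"
            using J(4) g(3) by blast
          then have yX: "y \<in> X K (N g)"
            using X_antimono[OF pcone_N[OF f] N_face_of_N[OF f g(1,2)] N_nonempty[OF g(1)] K(2) gK] by blast
          have gfK: "N g face_of K"
            using face_subset_iff[OF N_face_of_N[OF f g(1,2)] K(2)] gK by blast
          have "real t *\<^sub>R (v0 - v) \<in> L K"
          proof (rule shift[OF vV])
            fix a assume "a \<in> K"
            then have a: "a \<in> N {v}" "a \<in> N f"
              by (auto simp: K_def)
            have "a \<bullet> v0 \<le> a \<bullet> v"
              using a(1) N_vertex_iff[OF vV] v0 V_subset by blast
            moreover have "a \<bullet> v \<le> a \<bullet> v0"
              using a(2) mem_N_iff[OF f] v0 vV V_subset by blast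
            ultimately show "a \<bullet> v0 = a \<bullet> v"
              by simp
          qed
          then show "x - real t *\<^sub>R v \<in> X K (N g)"
            unfolding eq
            using X_translate[OF pcone_face[OF pcone_N[OF f] K(2) Kne] gfK N_nonempty[OF g(1)] yX] by blast
        next
          show "q \<in> R (N g)"
            using J(5) g(3) by simp
          show "p - real t *\<^sub>R v = x - real t *\<^sub>R v + q"
            by (simp add: px)
          show "norm z \<le> \<rho>" if J': "J' face_of N {v}" "J' \<noteq> {}" "J' \<noteq> N {v}" "z \<in> R J'" for J' z
          proof -
            obtain h where "pface h" "J' = N h"
              using face_of_normal_cone_is_normal_cone[OF pv J'(1,2)] by metis
            then show ?thesis
              using \<rho>(2) J'(4) by blast
          qed
          show "(p - real t *\<^sub>R v) \<bullet> u < - (3 * \<rho>)" if u: "u \<in> ray_dirs (N {v})" "u \<notin> K" for u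
          proof -
            have "u \<notin> N f"
              using u ray_dirs_subset by (auto simp: K_def)
            then have "(v, u) \<notin> S"
              using SN by blast
            then show ?thesis
              using u(1) vV by (simp add: S_def not_le)
          qed
        qed
        then show ?thesis
          using ne by (simp add: feasible_translations_def)
      qed
    qed
    then have "x \<in> feasible t g"
      using mem_feasible_iff[OF g(1)] by blast
    then show ?thesis
      using g px J(5) by blast
  qed
  then show ?thesis
    by blast
qed

end

theorem theorem1:
  fixes \<Lambda> P :: "'a::euclidean_space set" and D :: "'a set \<Rightarrow> 'a set"
  assumes "full_rank_lattice \<Lambda>"
    and "perp_lattices_full_rank \<Lambda>"
    and "fundamental_domain_choice \<Lambda> D"
    and "lattice_polytope \<Lambda> P"
    and "aff_dim P = int DIM('a)"
  shows "\<exists>t\<^sub>0 :: nat. t\<^sub>0 > 0 \<and> (\<forall>t\<ge>t\<^sub>0.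
           tiling (SIGMA f : {f. f face_of P \<and> f \<noteq> {}}. feasible_points \<Lambda> D P t f)
             (\<lambda>(f, x). (+) x ` region \<Lambda> D (normal_cone P f))
             (CDC \<Lambda> D ((*\<^sub>R) (real t) ` P)))"
proof -
  interpret lattice_polytope_tiles \<Lambda> D P
    by unfold_locales (use assms in auto)
  obtain t1 where inside: "\<And>t f x q. t \<ge> t1 \<Longrightarrow> pface f \<Longrightarrow> x \<in> feasible t f \<Longrightarrow> q \<in> R (N f) \<Longrightarrow>
      x + q \<in> cdc (scaled t)"
    using tiles_inside_CDC by metis
  obtain t2 where disjoint: "\<And>t f x q g y r. t \<ge> t2 \<Longrightarrow> pface f \<Longrightarrow> x \<in> feasible t f \<Longrightarrow> q \<in> R (N f) \<Longrightarrow>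
      pface g \<Longrightarrow> y \<in> feasible t g \<Longrightarrow> r \<in> R (N g) \<Longrightarrow> x + q = y + r \<Longrightarrow> f = g \<and> x = y"
    using tiles_disjoint by metis
  obtain t3 where cover: "\<And>t p. t \<ge> t3 \<Longrightarrow> p \<in> cdc (scaled t) \<Longrightarrow>
      \<exists>f x q. pface f \<and> x \<in> feasible t f \<and> q \<in> R (N f) \<and> p = x + q"
    using tiles_cover by metis
  have faces: "{f. f face_of P \<and> f \<noteq> {}} = {f. pface f}"
    by (simp add: pface_def)
  have "tiling (SIGMA f:{f. pface f}. feasible t f) (\<lambda>(f, x). (+) x ` R (N f)) (cdc (scaled t))"
    if t: "t1 + t2 + t3 + 1 \<le> t" for t
    unfolding tiling_def
  proof
    have ts: "t1 \<le> t" "t2 \<le> t" "t3 \<le> t"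
      using t by auto
    show "(\<Union>i\<in>SIGMA f:{f. pface f}. feasible t f. case i of (f, x) \<Rightarrow> (+) x ` R (N f)) = cdc (scaled t)"
    proof
      show "(\<Union>i\<in>SIGMA f:{f. pface f}. feasible t f. case i of (f, x) \<Rightarrow> (+) x ` R (N f)) \<subseteq> cdc (scaled t)"
        using inside[OF ts(1)] by auto
      show "cdc (scaled t) \<subseteq> (\<Union>i\<in>SIGMA f:{f. pface f}. feasible t f. case i of (f, x) \<Rightarrow> (+) x ` R (N f))"
      proof
        fix p assume "p \<in> cdc (scaled t)"
        then obtain f x q where "pface f" "x \<in> feasible t f" "q \<in> R (N f)" "p = x + q"
          using cover[OF ts(3)] by blast
        then show "p \<in> (\<Union>i\<in>SIGMA f:{f. pface f}. feasible t f. case i of (f, x) \<Rightarrow> (+) x ` R (N f))"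
          by (intro UN_I[of "(f, x)"]) auto
      qed
    qed
    show "disjoint_family_on (\<lambda>(f, x). (+) x ` R (N f)) (SIGMA f:{f. pface f}. feasible t f)"
      unfolding disjoint_family_on_def
    proof (intro ballI impI)
      fix i j
      assume i: "i \<in> (SIGMA f:{f. pface f}. feasible t f)" and j: "j \<in> (SIGMA f:{f. pface f}. feasible t f)"
        and "i \<noteq> j"
      then show "(case i of (f, x) \<Rightarrow> (+) x ` R (N f)) \<inter> (case j of (f, x) \<Rightarrow> (+) x ` R (N f)) = {}"
        using disjoint[OF ts(2)] by (cases i; cases j) blast
    qed
  qed
  then show ?thesis
    unfolding faces by (intro exI[of _ "t1 + t2 + t3 + 1"]) simp
qed

end
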